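(* Let $(M,\Lambda_0)$ be a compact holomorphic Poisson manifold and let $(\lambda,\theta)\in A^{0,0}(M,\wedge^2\Theta_M)\oplus A^{0,1}(M,\Theta_M)$ define an element of $\mathbb{H}^1(M,\Theta_M^\bullet)$. In order that there exist a Poisson analytic family $(\mathcal{M},\Lambda,B,\omega)$ with $0\in B\subset\mathbb{C}$, $\omega^{-1}(0)=(M,\Lambda_0)$ and $\left(\frac{\partial(M_t,\Lambda_t)}{\partial t}\right)_{t=0}=(\theta,\lambda)$, it is necessary that $$[\theta+\lambda,\theta+\lambda]=[\lambda,\lambda]+2[\lambda,\theta]+[\theta,\theta]\in A^{0,0}(M,\wedge^3\Theta_M)\oplus A^{0,1}(M,\wedge^2\Theta_M)\oplus A^{0,2}(M,\Theta_M)$$ defines the zero class in $\mathbb{H}^2(M,\Theta_M^\bullet)$.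
   Context: A holomorphic Poisson manifold $(M,\Lambda_0)$ is a complex manifold $M$ with $\Lambda_0\in H^0(M,\wedge^2\Theta_M)$ satisfying $[\Lambda_0,\Lambda_0]=0$; $\Theta_M$ is the sheaf of germs of holomorphic vector fields and $[-,-]$ is the Schouten bracket. $\mathbb{H}^i(M,\Theta_M^\bullet)$ is the hypercohomology of the complex of sheaves $\Theta_M\to\wedge^2\Theta_M\to\cdots\to\wedge^n\Theta_M\to 0$ with differential $[\Lambda_0,-]$ and $\Theta_M$ placed in degree $0$. Let $A^{0,p}(M,\wedge^q\Theta_M)$ be the space of global $C^\infty$ $(0,p)$-forms with coefficients in $\wedge^q\Theta_M$. With $\bar\partial$ and the Schouten bracket extended to $\bigoplus_{p\ge0,q\ge1}A^{0,p}(M,\wedge^q\Theta_M)$, graded by $p+q-1$, this is a differential graded Lie algebra, and $\mathbb{H}^i(M,\Theta_M^\bullet)$ is the cohomology of $\bigoplus_{p+q-1=i}A^{0,p}(M,\wedge^q\Theta_M)$ with differential $L=\bar\partial+[\Lambda_0,-]$ (Dolbeault resolution). The pair $(\lambda,\theta)$ defines an element of $\mathbb{H}^1$ means $[\Lambda_0,\lambda]=0$, $\bar\partial\lambda+[\Lambda_0,\theta]=0$, $\bar\partial\theta=0$. A Poisson analytic family $(\mathcal{M},\Lambda,B,\omega)$ over a domain $B\subset\mathbb{C}^m$ is a holomorphic Poisson manifold $(\mathcal{M},\Lambda)$ with a holomorphic map $\omega:\mathcal{M}\to B$ such that each $\omega^{-1}(t)$ is a compact holomorphic Poisson submanifold,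 $(M_t,\Lambda_t)=\omega^{-1}(t)$ carries the induced Poisson structure, and the Jacobian of $\omega$ has rank $m$ everywhere. Near $0\in B$ a Poisson analytic family with $\omega^{-1}(0)=(M,\Lambda_0)$ is represented by convergent power series $\varphi(t)$ with coefficients in $A^{0,1}(M,\Theta_M)$ and $\Lambda(t)$ with coefficients in $A^{0,0}(M,\wedge^2\Theta_M)$, with $\varphi(0)=0$, $\Lambda(0)=0$ and $L(\varphi(t)+\Lambda(t))+\frac12[\varphi(t)+\Lambda(t),\varphi(t)+\Lambda(t)]=0$ (and conversely such series define a Poisson analytic family). In these terms $\left(\frac{\partial(M_t,\Lambda_t)}{\partial t}\right)_{t=0}\in\mathbb{H}^1(M,\Theta_M^\bullet)$ is the class of $\left(\frac{\partial\varphi(t)}{\partial t}\big|_{t=0},\frac{\partial\Lambda(t)}{\partial t}\big|_{t=0}\right)$. *)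

theory Defs
  imports "HOL-Analysis.Analysis" "HOL-Library.Function_Algebras" "HOL-Library.Option_ord"
begin

section \<open>Smooth and holomorphic functions on open subsets of complex coordinate space\<close>

text \<open>Both notions below are used only on open sets.\<close>

primrec Ck_on :: "nat \<Rightarrow> 'v::real_normed_vector set \<Rightarrow> ('v \<Rightarrow> 'w::real_normed_vector) \<Rightarrow> bool" where
  "Ck_on 0 S f \<longleftrightarrow> continuous_on S f"
| "Ck_on (Suc k) S f \<longleftrightarrow> (\<forall>x\<in>S. f differentiable (at x)) \<and>
     (\<forall>v. Ck_on k S (\<lambda>x. frechet_derivative f (at x) v))"

definition smooth_on :: "'v::real_normed_vector set \<Rightarrow> ('v \<Rightarrow> 'w::real_normed_vector) \<Rightarrow> bool" where
  "smooth_on S f \<longleftrightarrow> (\<forall>k. Ck_on k S f)"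

text \<open>The Wirtinger derivatives with respect to the \<open>i\<close>-th coordinate and its conjugate;
  \<^term>\<open>axis i 1\<close> and \<^term>\<open>axis i \<i>\<close> are the real and imaginary coordinate directions.\<close>

definition del :: "'n::finite \<Rightarrow> (complex ^ 'n \<Rightarrow> complex) \<Rightarrow> complex ^ 'n \<Rightarrow> complex" where
  "del i u z = (frechet_derivative u (at z) (axis i 1) - \<i> * frechet_derivative u (at z) (axis i \<i>)) / 2"

definition delbar :: "'n::finite \<Rightarrow> (complex ^ 'n \<Rightarrow> complex) \<Rightarrow> complex ^ 'n \<Rightarrow> complex" where
  "delbar i u z = (frechet_derivative u (at z) (axis i 1) + \<i> * frechet_derivative u (at z) (axis i \<i>)) / 2"

definition holo_on :: "(complex ^ 'n::finite) set \<Rightarrow> (complex ^ 'n \<Rightarrow> complex) \<Rightarrow> bool" where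
  "holo_on S u \<longleftrightarrow> smooth_on S u \<and> (\<forall>z\<in>S. \<forall>i. delbar i u z = 0)"

section \<open>Complex manifolds\<close>

type_synonym ('a, 'n) chart = "'a set \<times> ('a \<Rightarrow> complex ^ 'n)"

record ('a, 'n) cplx_mfd =
  top_of :: "'a topology"
  atlas :: "('a, 'n) chart set"

abbreviation points :: "('a, 'n) cplx_mfd \<Rightarrow> 'a set" where
  "points M \<equiv> topspace (top_of M)"

abbreviation chart_image :: "('a, 'n) chart \<Rightarrow> (complex ^ 'n) set" where
  "chart_image c \<equiv> snd c ` fst c"

abbreviation chart_inv :: "('a, 'n) chart \<Rightarrow> complex ^ 'n \<Rightarrow> 'a" where
  "chart_inv c \<equiv> inv_into (fst c) (snd c)"

definition complex_manifold :: "('a, 'n::finite) cplx_mfd \<Rightarrow> bool" where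
  "complex_manifold M \<longleftrightarrow>
     Hausdorff_space (top_of M) \<and> second_countable (top_of M) \<and>
     points M = (\<Union>c\<in>atlas M. fst c) \<and>
     (\<forall>c\<in>atlas M. openin (top_of M) (fst c) \<and> open (chart_image c) \<and>
        homeomorphic_map (subtopology (top_of M) (fst c)) (top_of_set (chart_image c)) (snd c)) \<and>
     (\<forall>c\<in>atlas M. \<forall>c'\<in>atlas M. \<forall>k.
        holo_on (snd c ` (fst c \<inter> fst c')) (\<lambda>z. snd c' (chart_inv c z) $ k))"

text \<open>The \<open>k\<close>-th coordinate, in the chart \<open>d\<close> of the target, of a map \<open>F\<close> read in the chart \<open>c\<close>
  of the source.\<close>

abbreviation coord_rep ::
  "('a, 'n) chart \<Rightarrow> ('b, 'k::finite) chart \<Rightarrow> ('a \<Rightarrow> 'b) \<Rightarrow> 'k \<Rightarrow> complex ^ 'n \<Rightarrow> complex" where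
  "coord_rep c d F k \<equiv> (\<lambda>z. snd d (F (chart_inv c z)) $ k)"

definition smooth_map ::
  "('a, 'n::finite) cplx_mfd \<Rightarrow> ('b, 'k::finite) cplx_mfd \<Rightarrow> ('a \<Rightarrow> 'b) \<Rightarrow> bool" where
  "smooth_map M N F \<longleftrightarrow> continuous_map (top_of M) (top_of N) F \<and>
     (\<forall>c\<in>atlas M. \<forall>d\<in>atlas N. \<forall>k. smooth_on (snd c ` (fst c \<inter> F -` fst d)) (coord_rep c d F k))"

definition holomorphic_map ::
  "('a, 'n::finite) cplx_mfd \<Rightarrow> ('b, 'k::finite) cplx_mfd \<Rightarrow> ('a \<Rightarrow> 'b) \<Rightarrow> bool" where
  "holomorphic_map M N F \<longleftrightarrow> continuous_map (top_of M) (top_of N) F \<and>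
     (\<forall>c\<in>atlas M. \<forall>d\<in>atlas N. \<forall>k. holo_on (snd c ` (fst c \<inter> F -` fst d)) (coord_rep c d F k))"

definition diffeo ::
  "('a, 'n::finite) cplx_mfd \<Rightarrow> ('b, 'k::finite) cplx_mfd \<Rightarrow> ('a \<Rightarrow> 'b) \<Rightarrow> bool" where
  "diffeo M N F \<longleftrightarrow> bij_betw F (points M) (points N) \<and> smooth_map M N F \<and>
     smooth_map N M (inv_into (points M) F)"

definition open_submanifold :: "('a, 'n) cplx_mfd \<Rightarrow> 'a set \<Rightarrow> ('a, 'n) cplx_mfd" where
  "open_submanifold M W = \<lparr>top_of = subtopology (top_of M) W,
     atlas = {(fst c \<inter> W, snd c) | c. c \<in> atlas M}\<rparr>"

text \<open>The product of \<open>M\<close> with the disc of radius \<open>r\<close>. The index \<^term>\<open>None\<close> is the disc coordinate.\<close>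

definition disc_product :: "('a, 'n::finite) cplx_mfd \<Rightarrow> real \<Rightarrow> ('a \<times> complex, 'n option) cplx_mfd" where
  "disc_product M r = \<lparr>top_of = prod_topology (top_of M) (top_of_set (ball 0 r)),
     atlas = {(fst c \<times> ball 0 r,
               \<lambda>p. \<chi> k. case k of None \<Rightarrow> snd p | Some j \<Rightarrow> snd c (fst p) $ j) | c. c \<in> atlas M}\<rparr>"

section \<open>Differential forms of type (0,p) with values in polyvectors\<close>

text \<open>At a point of a coordinate patch, \<open>a :: 'n pvform\<close> stands for
  \<open>\<Sum>I J. a I J dzbar\<^sub>I \<otimes> \<partial>\<^sub>J\<close>, where the factors of
  \<open>dzbar\<^sub>I = dzbar\<^sub>i\<^sub>1 \<and> \<dots> \<and> dzbar\<^sub>i\<^sub>p\<close> and \<open>\<partial>\<^sub>J = \<partial>\<^sub>j\<^sub>1 \<and> \<dots> \<and> \<partial>\<^sub>j\<^sub>q\<close> are in increasing order. This is the exterior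
  algebra on the odd generators \<open>dzbar\<^sub>i\<close> and \<open>\<partial>\<^sub>j\<close>, with the \<open>dzbar\<close>'s written to the left.\<close>

type_synonym 'n pvform = "'n set \<Rightarrow> 'n set \<Rightarrow> complex"

definition inversions :: "'n::linorder set \<Rightarrow> 'n set \<Rightarrow> nat" where
  "inversions A B = card {(x, y). x \<in> A \<and> y \<in> B \<and> y < x}"

definition wedge :: "'n::{finite,linorder} pvform \<Rightarrow> 'n pvform \<Rightarrow> 'n pvform" where
  "wedge a b = (\<lambda>I J. \<Sum>I'\<in>Pow I. \<Sum>J'\<in>Pow J.
     (-1) ^ (inversions I' (I - I') + inversions J' (J - J') + card J' * card (I - I')) *
     a I' J' * b (I - I') (J - J'))"

text \<open>Left and right derivatives with respect to the odd generator \<open>\<partial>\<^sub>i\<close>.\<close>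

definition left_contract :: "'n::{finite,linorder} \<Rightarrow> 'n pvform \<Rightarrow> 'n pvform" where
  "left_contract i a = (\<lambda>I J. if i \<in> J then 0
     else (-1) ^ (card I + card {j\<in>J. j < i}) * a I (insert i J))"

definition right_contract :: "'n::{finite,linorder} \<Rightarrow> 'n pvform \<Rightarrow> 'n pvform" where
  "right_contract i a = (\<lambda>I J. if i \<in> J then 0
     else (-1) ^ card {j\<in>J. i < j} * a I (insert i J))"

definition coeff_del :: "'n::finite \<Rightarrow> (complex ^ 'n \<Rightarrow> 'n pvform) \<Rightarrow> complex ^ 'n \<Rightarrow> 'n pvform" where
  "coeff_del i a z = (\<lambda>I J. del i (\<lambda>w. a w I J) z)"

text \<open>The operator \<open>\<Sum>i. dzbar\<^sub>i \<and> \<partial>/\<partial>zbar\<^sub>i\<close>.\<close>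

definition local_dbar ::
  "(complex ^ 'n::{finite,linorder} \<Rightarrow> 'n pvform) \<Rightarrow> complex ^ 'n::{finite,linorder} \<Rightarrow> 'n pvform" where
  "local_dbar a z = (\<lambda>I J. \<Sum>i\<in>I. (-1) ^ card {j\<in>I. j < i} * delbar i (\<lambda>w. a w (I - {i}) J) z)"

text \<open>The Schouten bracket. In lowest degrees it is the commutator of vector fields and \<open>[X, f] = X f\<close>,
  and it satisfies
  \<open>[dzbar\<^sub>I \<otimes> X, dzbar\<^sub>K \<otimes> Y] = (-1)^(|K| (deg X - 1)) dzbar\<^sub>I \<and> dzbar\<^sub>K \<otimes> [X, Y]\<close>
  for polyvector fields \<open>X\<close> and \<open>Y\<close>.\<close>

definition local_schouten ::
  "(complex ^ 'n::{finite,linorder} \<Rightarrow> 'n pvform) \<Rightarrow> (complex ^ 'n::{finite,linorder} \<Rightarrow> 'n pvform) \<Rightarrow>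
   complex ^ 'n::{finite,linorder} \<Rightarrow> 'n pvform" where
  "local_schouten a b z = (\<Sum>i\<in>UNIV.
     wedge (right_contract i (a z)) (coeff_del i b z) -
     wedge (coeff_del i a z) (left_contract i (b z)))"

subsection \<open>Change of coordinates\<close>

definition one_pvform :: "'n pvform" where
  "one_pvform = (\<lambda>I J. if I = {} \<and> J = {} then 1 else 0)"

text \<open>\<open>\<partial>/\<partial>z\<^sub>j = \<Sum>k. (\<partial>w\<^sub>k/\<partial>z\<^sub>j) \<partial>/\<partial>w\<^sub>k\<close> and \<open>dzbar\<^sub>i = \<Sum>k. cnj (\<partial>z\<^sub>i/\<partial>w\<^sub>k) dwbar\<^sub>k\<close>, where \<open>z\<close> and \<open>w\<close> are
  the coordinates of the charts \<open>c\<close> and \<open>c'\<close>, and \<open>x\<close> is a point of both.\<close>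

definition vector_in_chart ::
  "('a, 'n::finite) chart \<Rightarrow> ('a, 'n) chart \<Rightarrow> 'a \<Rightarrow> 'n \<Rightarrow> 'n pvform" where
  "vector_in_chart c c' x j = (\<lambda>I J. \<Sum>k\<in>UNIV. if I = {} \<and> J = {k}
     then del j (\<lambda>z. snd c' (chart_inv c z) $ k) (snd c x) else 0)"

definition covector_in_chart ::
  "('a, 'n::finite) chart \<Rightarrow> ('a, 'n) chart \<Rightarrow> 'a \<Rightarrow> 'n \<Rightarrow> 'n pvform" where
  "covector_in_chart c c' x i = (\<lambda>I J. \<Sum>k\<in>UNIV. if I = {k} \<and> J = {}
     then cnj (del k (\<lambda>w. snd c (chart_inv c' w) $ i) (snd c' x)) else 0)"

definition basis_in_chart ::
  "('a, 'n::{finite,linorder}) chart \<Rightarrow> ('a, 'n) chart \<Rightarrow> 'a \<Rightarrow> 'n set \<Rightarrow> 'n set \<Rightarrow> 'n pvform" where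
  "basis_in_chart c c' x I J = foldr wedge
     (map (covector_in_chart c c' x) (sorted_list_of_set I) @
      map (vector_in_chart c c' x) (sorted_list_of_set J)) one_pvform"

definition change_chart ::
  "('a, 'n::{finite,linorder}) chart \<Rightarrow> ('a, 'n) chart \<Rightarrow> 'a \<Rightarrow> 'n pvform \<Rightarrow> 'n pvform" where
  "change_chart c c' x a = (\<lambda>K L. \<Sum>I\<in>UNIV. \<Sum>J\<in>UNIV. a I J * basis_in_chart c c' x I J K L)"

subsection \<open>Global sections\<close>

text \<open>A global section is given by its coefficients in all charts of the atlas. The coefficients are
  functions of the coordinates, and are set to 0 wherever they carry no information, so that equality
  of sections is equality of functions.\<close>

type_synonym ('a, 'n) pvsection = "('a, 'n) chart \<Rightarrow> complex ^ 'n \<Rightarrow> 'n pvform"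

definition smooth_sections :: "('a, 'n::{finite,linorder}) cplx_mfd \<Rightarrow> ('a, 'n) pvsection set" where
  "smooth_sections M = {s.
     (\<forall>c z. \<not> (c \<in> atlas M \<and> z \<in> chart_image c) \<longrightarrow> s c z = 0) \<and>
     (\<forall>c\<in>atlas M. \<forall>I J. smooth_on (chart_image c) (\<lambda>z. s c z I J)) \<and>
     (\<forall>c\<in>atlas M. \<forall>c'\<in>atlas M. \<forall>x \<in> fst c \<inter> fst c'.
        s c' (snd c' x) = change_chart c c' x (s c (snd c x)))}"

text \<open>\<open>A M p q\<close> is the space of global smooth (0,p)-forms with coefficients in the
  \<open>q\<close>-th exterior power of the holomorphic tangent bundle.\<close>

definition A :: "('a, 'n::{finite,linorder}) cplx_mfd \<Rightarrow> nat \<Rightarrow> nat \<Rightarrow> ('a, 'n) pvsection set" where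
  "A M p q = {s \<in> smooth_sections M. \<forall>c z I J. s c z I J \<noteq> 0 \<longrightarrow> card I = p \<and> card J = q}"

definition on_charts ::
  "('a, 'n) cplx_mfd \<Rightarrow> (('a, 'n) chart \<Rightarrow> complex ^ 'n \<Rightarrow> 'n pvform) \<Rightarrow> ('a, 'n) pvsection" where
  "on_charts M s = (\<lambda>c z. if c \<in> atlas M \<and> z \<in> chart_image c then s c z else 0)"

definition dbar :: "('a, 'n::{finite,linorder}) cplx_mfd \<Rightarrow> ('a, 'n) pvsection \<Rightarrow> ('a, 'n) pvsection" where
  "dbar M s = on_charts M (\<lambda>c. local_dbar (s c))"

definition schouten ::
  "('a, 'n::{finite,linorder}) cplx_mfd \<Rightarrow> ('a, 'n) pvsection \<Rightarrow> ('a, 'n) pvsection \<Rightarrow> ('a, 'n) pvsection" where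
  "schouten M s s' = on_charts M (\<lambda>c. local_schouten (s c) (s' c))"

definition scale :: "complex \<Rightarrow> ('a, 'n) pvsection \<Rightarrow> ('a, 'n) pvsection" where
  "scale k s = (\<lambda>c z I J. k * s c z I J)"

section \<open>Holomorphic Poisson manifolds\<close>

definition holomorphic_sections ::
  "('a, 'n::{finite,linorder}) cplx_mfd \<Rightarrow> nat \<Rightarrow> ('a, 'n) pvsection set" where
  "holomorphic_sections M q =
     {s \<in> A M 0 q. \<forall>c\<in>atlas M. \<forall>J. holo_on (chart_image c) (\<lambda>z. s c z {} J)}"

definition holomorphic_poisson_manifold ::
  "('a, 'n::{finite,linorder}) cplx_mfd \<Rightarrow> ('a, 'n) pvsection \<Rightarrow> bool" where
  "holomorphic_poisson_manifold M \<Lambda> \<longleftrightarrow>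
     complex_manifold M \<and> \<Lambda> \<in> holomorphic_sections M 2 \<and> schouten M \<Lambda> \<Lambda> = 0"

text \<open>The antisymmetric coefficient matrix of the bivector part of \<open>a\<close>, and its value \<open>a(du, dv)\<close> on
  the differentials of two functions.\<close>

definition bivec :: "'n::linorder pvform \<Rightarrow> 'n \<Rightarrow> 'n \<Rightarrow> complex" where
  "bivec a j k = (if j < k then a {} {j, k} else if k < j then - a {} {j, k} else 0)"

definition bivec_apply ::
  "'n::{finite,linorder} pvform \<Rightarrow> (complex ^ 'n::{finite,linorder} \<Rightarrow> complex) \<Rightarrow> (complex ^ 'n::{finite,linorder} \<Rightarrow> complex) \<Rightarrow>
   complex ^ 'n::{finite,linorder} \<Rightarrow> complex" where
  "bivec_apply a u v z = (\<Sum>j\<in>UNIV. \<Sum>k\<in>UNIV. bivec a j k * del j u z * del k v z)"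

text \<open>A holomorphic Poisson embedding is a holomorphic immersion that is a homeomorphism onto its image
  and a Poisson map; the Poisson condition is stated for the coordinate functions of the target,
  i.e. the bivector of \<open>S\<close> is pushed forward to that of \<open>N\<close>.\<close>

definition poisson_embedding ::
  "('a, 'n::{finite,linorder}) cplx_mfd \<Rightarrow> ('a, 'n) pvsection \<Rightarrow>
   ('b, 'k::{finite,linorder}) cplx_mfd \<Rightarrow> ('b, 'k) pvsection \<Rightarrow> ('a \<Rightarrow> 'b) \<Rightarrow> bool" where
  "poisson_embedding S \<Lambda>\<^sub>S N \<Lambda> e \<longleftrightarrow>
     holomorphic_map S N e \<and> embedding_map (top_of S) (top_of N) e \<and>
     (\<forall>c\<in>atlas S. \<forall>d\<in>atlas N. \<forall>x\<in>fst c. e x \<in> fst d \<longrightarrow>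
        inj (frechet_derivative (\<lambda>z. snd d (e (chart_inv c z))) (at (snd c x))) \<and>
        (\<forall>k l. bivec_apply (\<Lambda>\<^sub>S c (snd c x)) (coord_rep c d e k) (coord_rep c d e l) (snd c x)
             = bivec (\<Lambda> d (snd d (e x))) k l))"

section \<open>Hypercohomology\<close>

definition poisson_dbar ::
  "('a, 'n::{finite,linorder}) cplx_mfd \<Rightarrow> ('a, 'n) pvsection \<Rightarrow> ('a, 'n) pvsection \<Rightarrow> ('a, 'n) pvsection" where
  "poisson_dbar M \<Lambda>\<^sub>0 s = dbar M s + schouten M \<Lambda>\<^sub>0 s"

text \<open>\<open>total M i\<close> is the direct sum of the spaces \<open>A M p q\<close> with \<open>p + q - 1 = i\<close> and \<open>q \<ge> 1\<close>.\<close>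

definition total :: "('a, 'n::{finite,linorder}) cplx_mfd \<Rightarrow> nat \<Rightarrow> ('a, 'n) pvsection set" where
  "total M i = {s \<in> smooth_sections M.
     \<forall>c z I J. s c z I J \<noteq> 0 \<longrightarrow> card I + card J = Suc i \<and> 1 \<le> card J}"

definition cocycles ::
  "('a, 'n::{finite,linorder}) cplx_mfd \<Rightarrow> ('a, 'n) pvsection \<Rightarrow> nat \<Rightarrow> ('a, 'n) pvsection set" where
  "cocycles M \<Lambda>\<^sub>0 i = {s \<in> total M i. poisson_dbar M \<Lambda>\<^sub>0 s = 0}"

definition coboundaries ::
  "('a, 'n::{finite,linorder}) cplx_mfd \<Rightarrow> ('a, 'n) pvsection \<Rightarrow> nat \<Rightarrow> ('a, 'n) pvsection set" where
  "coboundaries M \<Lambda>\<^sub>0 i = (case i of 0 \<Rightarrow> {0} | Suc j \<Rightarrow> poisson_dbar M \<Lambda>\<^sub>0 ` total M j)"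

definition cohomologous ::
  "('a, 'n::{finite,linorder}) cplx_mfd \<Rightarrow> ('a, 'n) pvsection \<Rightarrow> nat \<Rightarrow> ('a, 'n) pvsection rel" where
  "cohomologous M \<Lambda>\<^sub>0 i = {(s, s'). s \<in> cocycles M \<Lambda>\<^sub>0 i \<and> s' \<in> cocycles M \<Lambda>\<^sub>0 i \<and>
     s - s' \<in> coboundaries M \<Lambda>\<^sub>0 i}"

definition hypercohomology ::
  "('a, 'n::{finite,linorder}) cplx_mfd \<Rightarrow> ('a, 'n) pvsection \<Rightarrow> nat \<Rightarrow> ('a, 'n) pvsection set set" where
  "hypercohomology M \<Lambda>\<^sub>0 i = cocycles M \<Lambda>\<^sub>0 i // cohomologous M \<Lambda>\<^sub>0 i"

definition hyper_class ::
  "('a, 'n::{finite,linorder}) cplx_mfd \<Rightarrow> ('a, 'n) pvsection \<Rightarrow> nat \<Rightarrow> ('a, 'n) pvsection \<Rightarrow>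
   ('a, 'n) pvsection set" where
  "hyper_class M \<Lambda>\<^sub>0 i s = cohomologous M \<Lambda>\<^sub>0 i `` {s}"

section \<open>Poisson analytic families over a domain in the complex plane\<close>

definition fibre :: "('e, 'k) cplx_mfd \<Rightarrow> ('e \<Rightarrow> complex) \<Rightarrow> complex \<Rightarrow> 'e set" where
  "fibre N \<omega> t = {x \<in> points N. \<omega> x = t}"

text \<open>The total space has coordinates indexed by \<open>'n option\<close>, so that its dimension is one more than that
  of the fibres.\<close>

definition poisson_analytic_family ::
  "('e, 'n::{finite,linorder} option) cplx_mfd \<Rightarrow> ('e, 'n option) pvsection \<Rightarrow> complex set \<Rightarrow>
   ('e \<Rightarrow> complex) \<Rightarrow> bool" where
  "poisson_analytic_family N \<Lambda> B \<omega> \<longleftrightarrow>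
     holomorphic_poisson_manifold N \<Lambda> \<and>
     open B \<and> connected B \<and>
     \<omega> ` points N \<subseteq> B \<and>
     (\<forall>d\<in>atlas N. holo_on (chart_image d) (\<lambda>z. \<omega> (chart_inv d z))) \<and>
     (\<forall>d\<in>atlas N. \<forall>z\<in>chart_image d. \<exists>k. del k (\<lambda>w. \<omega> (chart_inv d w)) z \<noteq> 0) \<and>
     (\<forall>t\<in>B. \<exists>(S :: ('e, 'n) cplx_mfd) \<Lambda>\<^sub>t.
        holomorphic_poisson_manifold S \<Lambda>\<^sub>t \<and> compact_space (top_of S) \<and>
        points S = fibre N \<omega> t \<and> poisson_embedding S \<Lambda>\<^sub>t N \<Lambda> id)"

text \<open>The embedding \<open>e\<close> identifies \<open>(M, \<Lambda>\<^sub>0)\<close> with the fibre of \<open>\<omega>\<close> over 0.\<close>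

definition central_fibre ::
  "('a, 'n::{finite,linorder}) cplx_mfd \<Rightarrow> ('a, 'n) pvsection \<Rightarrow>
   ('e, 'n option) cplx_mfd \<Rightarrow> ('e, 'n option) pvsection \<Rightarrow> ('e \<Rightarrow> complex) \<Rightarrow> ('a \<Rightarrow> 'e) \<Rightarrow> bool" where
  "central_fibre M \<Lambda>\<^sub>0 N \<Lambda> \<omega> e \<longleftrightarrow>
     poisson_embedding M \<Lambda>\<^sub>0 N \<Lambda> e \<and> e ` points M = fibre N \<omega> 0"

text \<open>Joint smoothness of the sum makes the convergence of the power series locally uniform together
  with all derivatives along \<open>M\<close>.\<close>

definition convergent_series ::
  "('a, 'n::{finite,linorder}) cplx_mfd \<Rightarrow> nat \<Rightarrow> nat \<Rightarrow> real \<Rightarrow> (complex \<Rightarrow> ('a, 'n) pvsection) \<Rightarrow> bool" where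
  "convergent_series M p q r \<phi> \<longleftrightarrow>
     (\<exists>a. (\<forall>m. a m \<in> A M p q) \<and>
        (\<forall>t\<in>ball 0 r. \<forall>c z I J. (\<lambda>m. a m c z I J * t ^ m) sums \<phi> t c z I J)) \<and>
     (\<forall>c\<in>atlas M. \<forall>I J. smooth_on (chart_image c \<times> ball 0 r) (\<lambda>(z, t). \<phi> t c z I J))"

definition derivative_at_0 :: "(complex \<Rightarrow> ('a, 'n) pvsection) \<Rightarrow> ('a, 'n) pvsection" where
  "derivative_at_0 \<phi> = (\<lambda>c z I J. deriv (\<lambda>t. \<phi> t c z I J) 0)"

definition maurer_cartan ::
  "('a, 'n::{finite,linorder}) cplx_mfd \<Rightarrow> ('a, 'n) pvsection \<Rightarrow> ('a, 'n) pvsection \<Rightarrow> bool" where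
  "maurer_cartan M \<Lambda>\<^sub>0 s \<longleftrightarrow> poisson_dbar M \<Lambda>\<^sub>0 s + scale (1/2) (schouten M s s) = 0"

text \<open>The family is represented over the disc of radius \<open>r\<close> by \<open>(\<phi>(t), L(t))\<close>: there is a smooth
  trivialization \<open>\<Psi>\<close> over the disc which is the given identification over 0, such that for the
  coordinate functions \<open>\<zeta>\<^sub>k\<close> of \<open>N\<close>, transported to \<open>M\<close> by \<open>\<Psi>\<close> at time \<open>t\<close>,
  \<open>(dbar + \<phi>(t)) \<zeta>\<^sub>k = 0\<close> (that is, the tangent vectors of type (0,1) of the fibre over \<open>t\<close> are spanned by
  \<open>\<partial>/\<partial>zbar\<^sub>v + (\<Sum>j. \<phi>\<^sub>v\<^sub>j(t) \<partial>/\<partial>z\<^sub>j)\<close>) and \<open>(\<Lambda>\<^sub>0 + L(t))(d\<zeta>\<^sub>k, d\<zeta>\<^sub>l)\<close> is the Poisson bracket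
  of \<open>\<zeta>\<^sub>k\<close> and \<open>\<zeta>\<^sub>l\<close>. The sign of \<open>\<phi>\<close> is the one compatible with the Maurer-Cartan equation.\<close>

definition represented_by ::
  "('a, 'n::{finite,linorder}) cplx_mfd \<Rightarrow> ('a, 'n) pvsection \<Rightarrow>
   ('e, 'n option) cplx_mfd \<Rightarrow> ('e, 'n option) pvsection \<Rightarrow> complex set \<Rightarrow> ('e \<Rightarrow> complex) \<Rightarrow> ('a \<Rightarrow> 'e) \<Rightarrow>
   real \<Rightarrow> (complex \<Rightarrow> ('a, 'n) pvsection) \<Rightarrow> (complex \<Rightarrow> ('a, 'n) pvsection) \<Rightarrow> bool" where
  "represented_by M \<Lambda>\<^sub>0 N \<Lambda> B \<omega> e r \<phi> L \<longleftrightarrow>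
     0 < r \<and> ball 0 r \<subseteq> B \<and>
     convergent_series M 1 1 r \<phi> \<and> convergent_series M 0 2 r L \<and>
     \<phi> 0 = 0 \<and> L 0 = 0 \<and>
     (\<forall>t\<in>ball 0 r. maurer_cartan M \<Lambda>\<^sub>0 (\<phi> t + L t)) \<and>
     (\<exists>\<Psi>. diffeo (disc_product M r) (open_submanifold N {x \<in> points N. \<omega> x \<in> ball 0 r}) \<Psi> \<and>
        (\<forall>x\<in>points M. \<Psi> (x, 0) = e x) \<and>
        (\<forall>x\<in>points M. \<forall>t\<in>ball 0 r. \<omega> (\<Psi> (x, t)) = t) \<and>
        (\<forall>t\<in>ball 0 r. \<forall>c\<in>atlas M. \<forall>d\<in>atlas N. \<forall>x\<in>fst c. \<Psi> (x, t) \<in> fst d \<longrightarrow>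
           (let z = snd c x; \<zeta> = coord_rep c d (\<lambda>y. \<Psi> (y, t)) in
             (\<forall>k v. delbar v (\<zeta> k) z + (\<Sum>j\<in>UNIV. \<phi> t c z {v} {j} * del j (\<zeta> k) z) = 0) \<and>
             (\<forall>k l. bivec_apply (\<Lambda>\<^sub>0 c z + L t c z) (\<zeta> k) (\<zeta> l) z
                  = bivec (\<Lambda> d (snd d (\<Psi> (x, t)))) k l))))"

definition infinitesimal_deformation ::
  "('a, 'n::{finite,linorder}) cplx_mfd \<Rightarrow> ('a, 'n) pvsection \<Rightarrow>
   ('e, 'n option) cplx_mfd \<Rightarrow> ('e, 'n option) pvsection \<Rightarrow> complex set \<Rightarrow> ('e \<Rightarrow> complex) \<Rightarrow> ('a \<Rightarrow> 'e) \<Rightarrow>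
   ('a, 'n) pvsection set \<Rightarrow> bool" where
  "infinitesimal_deformation M \<Lambda>\<^sub>0 N \<Lambda> B \<omega> e C \<longleftrightarrow>
     C \<in> hypercohomology M \<Lambda>\<^sub>0 1 \<and>
     (\<exists>r \<phi> L. represented_by M \<Lambda>\<^sub>0 N \<Lambda> B \<omega> e r \<phi> L \<and>
        C = hyper_class M \<Lambda>\<^sub>0 1 (derivative_at_0 \<phi> + derivative_at_0 L))"

end

(* Let d denote the differential L = dbar + [Lambda_0, -] and write phi(t) + Lambda(t) = s_1 t + s_2 t^2 + ...
   The coefficient of t^2 in the Maurer-Cartan equation is d s_2 + (1/2)[s_1, s_1] = 0, so the square of the
   derivative s_1 is a coboundary. If s = theta + lambda is another representative of its class, s_1 - s = d v,
   then [s_1, s_1] - [s, s] = [d v, s_1 + s] = d [v, s_1 + s], so [s, s] is a coboundary too.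

   The identities of a differential graded Lie algebra are checked in coordinates. There the bracket is the defect of
   the second-order operator bv = sum_i (d/dz_i)(d/d xi_i), where the xi_i are the odd generators d/dz_i of the
   exterior algebra, from being a derivation, and bv^2 = 0 makes dbar and the brackets with even
   fields derivations of the bracket. The bracket does not depend on the coordinates because a holomorphic change
   of coordinates acts by a homomorphism of exterior algebras, and the derivatives of its Jacobian matrix
   cancel by symmetry. *)

theory Submission
  imports Defs
begin

text \<open>Three obstacles shape the proof: signs, invariance of the bracket, and an exchange of
  limits. Signs: the cochains that are bracketed are either even (Lambda_0, theta + lambda, the s_k)
  or odd (the primitive v). The identities are therefore proved for a first argument of one of these
  two parities, while the parity automorphism \<open>eps\<close> carries the signs that come from an
  arbitrary second argument. Invariance: [v, s_1 + s] can serve as a primitive only if it is again a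
  global section, which is why the transformation law under changes of charts enters. Limits: the
  series in t converge coefficient by coefficient, but the Maurer-Cartan equation also
  differentiates along M. Its t^2 coefficient can be read off only after differentiation along M is
  exchanged with expansion in t. Joint smoothness gives this through the symmetry of second
  derivatives, and an expansion to second order along real t is enough.\<close>

section \<open>The exterior algebra of polyforms\<close>

text \<open>A copy of \<^typ>\<open>'n pvform\<close> that can carry the exterior product: the function type has the pointwise one.\<close>

typedef 'n polyform = "UNIV :: 'n pvform set" morphisms coeff Pv by simp

lemma coeff_Pv [simp]: "coeff (Pv a) = a"
  by (simp add: Pv_inverse)

lemma Pv_coeff [simp]: "Pv (coeff a) = a"
  by (simp add: coeff_inverse)

lemma polyform_eqI: "(\<And>I J. coeff a I J = coeff b I J) \<Longrightarrow> a = b"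
  by (metis coeff_inject ext)

section \<open>Signs of reorderings and associativity of the product\<close>

lemma inversions_Un_left:
  fixes A B C :: "'n::{finite,linorder} set"
  assumes "A \<inter> B = {}"
  shows "inversions (A \<union> B) C = inversions A C + inversions B C"
proof -
  have "{(x, y). x \<in> A \<union> B \<and> y \<in> C \<and> y < x}
      = {(x, y). x \<in> A \<and> y \<in> C \<and> y < x} \<union> {(x, y). x \<in> B \<and> y \<in> C \<and> y < x}" by auto
  moreover have "{(x, y). x \<in> A \<and> y \<in> C \<and> y < x} \<inter> {(x, y). x \<in> B \<and> y \<in> C \<and> y < x} = {}"
    using assms by auto
  ultimately show ?thesis
    unfolding inversions_def by (simp add: card_Un_disjoint)
qed

lemma inversions_Un_right:
  fixes A B C :: "'n::{finite,linorder} set"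
  assumes "B \<inter> C = {}"
  shows "inversions A (B \<union> C) = inversions A B + inversions A C"
proof -
  have "{(x, y). x \<in> A \<and> y \<in> B \<union> C \<and> y < x}
      = {(x, y). x \<in> A \<and> y \<in> B \<and> y < x} \<union> {(x, y). x \<in> A \<and> y \<in> C \<and> y < x}" by auto
  moreover have "{(x, y). x \<in> A \<and> y \<in> B \<and> y < x} \<inter> {(x, y). x \<in> A \<and> y \<in> C \<and> y < x} = {}"
    using assms by auto
  ultimately show ?thesis
    unfolding inversions_def by (simp add: card_Un_disjoint)
qed

lemma inversions_empty [simp]: "inversions {} K = 0" "inversions K {} = 0"
  by (simp_all add: inversions_def)

definition below :: "'n::linorder \<Rightarrow> 'n set \<Rightarrow> nat" where
  "below i J = card {j\<in>J. j < i}"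

lemma inversions_singleton_left:
  fixes i :: "'n::{finite,linorder}"
  shows "inversions {i} B = below i B"
  unfolding inversions_def below_def
  by (rule bij_betw_same_card[of snd]) (auto simp: bij_betw_def inj_on_def image_def)

text \<open>The sign that sorts the product of two monomials: the inversions reorder the two kinds
  of generators among themselves, and the last summand moves the vectors of the first monomial past
  the covectors of the second.\<close>

definition msign :: "'n::{finite,linorder} set \<Rightarrow> 'n set \<Rightarrow> 'n set \<Rightarrow> 'n set \<Rightarrow> complex" where
  "msign K L K' L' = (-1) ^ (inversions K K' + inversions L L' + card L * card K')"

text \<open>Each summand of the exponent is additive over disjoint unions in either argument, so the
  two exponents agree even before reduction modulo 2. Associativity of the product rests on this
  cocycle condition.\<close>

lemma msign_cocycle:
  fixes A A' A'' B B' B'' :: "'n::{finite,linorder} set"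
  assumes "A \<inter> A' = {}" "A \<inter> A'' = {}" "A' \<inter> A'' = {}" "B \<inter> B' = {}" "B \<inter> B'' = {}" "B' \<inter> B'' = {}"
  shows "msign A B A' B' * msign (A \<union> A') (B \<union> B') A'' B''
       = msign A' B' A'' B'' * msign A B (A' \<union> A'') (B' \<union> B'')"
  unfolding msign_def power_add[symmetric] using assms
  by (simp add: inversions_Un_left inversions_Un_right card_Un_disjoint algebra_simps)

text \<open>A chain A \<subseteq> D \<subseteq> I is the same as an ordered partition of I into
  three blocks.\<close>

lemma sum_Pow_Pow:
  fixes f :: "'n::finite set \<Rightarrow> 'n set \<Rightarrow> 'n set \<Rightarrow> 'b::comm_monoid_add"
  shows "(\<Sum>D\<in>Pow I. \<Sum>A\<in>Pow D. f A (D - A) (I - D)) = (\<Sum>A\<in>Pow I. \<Sum>B\<in>Pow (I - A). f A B (I - A - B))"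
  unfolding sum.Sigma[OF finite_Pow_iff[THEN iffD2, OF finite] ballI[OF finite_Pow_iff[THEN iffD2, OF finite]]]
  by (rule sum.reindex_bij_witness[where i="\<lambda>(A, B). (A \<union> B, A)" and j="\<lambda>(D, A). (A, D - A)"])
     (auto simp: Diff_Un Un_Diff Int_absorb1 intro!: arg_cong[where f="f _ _"])

instantiation polyform :: ("{finite,linorder}") ring_1
begin

definition "0 = Pv (\<lambda>I J. 0)"
definition "1 = Pv one_pvform"
definition "a + b = Pv (\<lambda>I J. coeff a I J + coeff b I J)"
definition "a - b = Pv (\<lambda>I J. coeff a I J - coeff b I J)"
definition "- a = Pv (\<lambda>I J. - coeff a I J)"
definition "a * b = Pv (wedge (coeff a) (coeff b))"

lemma coeff_mult: "coeff (a * b) I J = (\<Sum>I'\<in>Pow I. \<Sum>J'\<in>Pow J.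
   msign I' J' (I - I') (J - J') * coeff a I' J' * coeff b (I - I') (J - J'))"
  by (simp add: times_polyform_def wedge_def msign_def)

text \<open>Both bracketings expand into sums over ordered partitions of I and J into three blocks.
  The summands then differ only in their signs, which the cocycle condition equates.\<close>

lemma polyform_mult_assoc: "(a * b) * c = a * (b * (c :: 'a polyform))"
proof (rule polyform_eqI)
  fix I J
  let ?g = "\<lambda>A A' A'' B B' B''. msign A B A' B' * msign (A \<union> A') (B \<union> B') A'' B'' *
     coeff a A B * coeff b A' B' * coeff c A'' B''"
  have "coeff ((a * b) * c) I J = (\<Sum>D\<in>Pow I. \<Sum>E\<in>Pow J. \<Sum>A\<in>Pow D. \<Sum>B\<in>Pow E.
      ?g A (D - A) (I - D) B (E - B) (J - E))"
    unfolding coeff_mult sum_distrib_left sum_distrib_right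
    by (intro sum.cong refl) (auto simp: Un_absorb1)
  also have "\<dots> = (\<Sum>D\<in>Pow I. \<Sum>A\<in>Pow D. \<Sum>E\<in>Pow J. \<Sum>B\<in>Pow E.
      ?g A (D - A) (I - D) B (E - B) (J - E))"
    by (rule sum.cong[OF refl]) (rule sum.swap)
  also have "\<dots> = (\<Sum>A\<in>Pow I. \<Sum>A'\<in>Pow (I - A). \<Sum>E\<in>Pow J. \<Sum>B\<in>Pow E.
      ?g A A' (I - A - A') B (E - B) (J - E))"
    by (rule sum_Pow_Pow)
  also have "\<dots> = (\<Sum>A\<in>Pow I. \<Sum>A'\<in>Pow (I - A). \<Sum>B\<in>Pow J. \<Sum>B'\<in>Pow (J - B).
      ?g A A' (I - A - A') B B' (J - B - B'))"
    by (rule sum.cong[OF refl], rule sum.cong[OF refl], rule sum_Pow_Pow)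
  also have "\<dots> = (\<Sum>A\<in>Pow I. \<Sum>A'\<in>Pow (I - A). \<Sum>B\<in>Pow J. \<Sum>B'\<in>Pow (J - B).
      msign A B (I - A) (J - B) * coeff a A B *
      (msign A' B' (I - A - A') (J - B - B') * coeff b A' B' * coeff c (I - A - A') (J - B - B')))"
  proof (intro sum.cong refl)
    fix A A' B B' assume "A \<in> Pow I" "A' \<in> Pow (I - A)" "B \<in> Pow J" "B' \<in> Pow (J - B)"
    then have "A' \<union> (I - A - A') = I - A" "B' \<union> (J - B - B') = J - B"
      "A \<inter> A' = {}" "A \<inter> (I - A - A') = {}" "A' \<inter> (I - A - A') = {}"
      "B \<inter> B' = {}" "B \<inter> (J - B - B') = {}" "B' \<inter> (J - B - B') = {}" by auto
    then show "?g A A' (I - A - A') B B' (J - B - B') = msign A B (I - A) (J - B) * coeff a A B *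
      (msign A' B' (I - A - A') (J - B - B') * coeff b A' B' * coeff c (I - A - A') (J - B - B'))"
      by (subst msign_cocycle) auto
  qed
  also have "\<dots> = (\<Sum>A\<in>Pow I. \<Sum>B\<in>Pow J. \<Sum>A'\<in>Pow (I - A). \<Sum>B'\<in>Pow (J - B).
      msign A B (I - A) (J - B) * coeff a A B *
      (msign A' B' (I - A - A') (J - B - B') * coeff b A' B' * coeff c (I - A - A') (J - B - B')))"
    by (rule sum.cong[OF refl]) (rule sum.swap)
  also have "\<dots> = coeff (a * (b * c)) I J"
    unfolding coeff_mult sum_distrib_left by simp
  finally show "coeff ((a * b) * c) I J = coeff (a * (b * c)) I J" .
qed

lemma msign_empty [simp]: "msign {} {} K L = 1" "msign K L {} {} = 1"
  by (simp_all add: msign_def)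

lemma sum_Pow_singleton:
  fixes f :: "'a set \<Rightarrow> 'b::comm_monoid_add"
  assumes "\<And>A. A \<noteq> K \<Longrightarrow> f A = 0"
  shows "(\<Sum>A\<in>Pow I. f A) = (if K \<subseteq> I then f K else 0)"
  using assms by (subst sum.mono_neutral_right[of _ "if K \<subseteq> I then {K} else {}"]) auto

lemma polyform_mult_one: "1 * a = (a :: 'a polyform)" "a * 1 = a"
proof -
  show "1 * a = a"
    by (rule polyform_eqI) (simp add: coeff_mult one_polyform_def one_pvform_def
        sum_Pow_singleton[where K="{}"])
  show "a * 1 = a"
  proof (rule polyform_eqI)
    fix I J :: "'a set"
    have *: "(I - I' = {} \<and> J - J' = {}) \<longleftrightarrow> (I' = I \<and> J' = J)" if "I' \<in> Pow I" "J' \<in> Pow J" for I' J'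
      using that by auto
    have "coeff (a * 1) I J = (\<Sum>I'\<in>Pow I. \<Sum>J'\<in>Pow J. if J' = J then if I' = I then coeff a I J else 0 else 0)"
      unfolding coeff_mult one_polyform_def one_pvform_def coeff_Pv
      by (intro sum.cong refl) (auto simp: *)
    then show "coeff (a * 1) I J = coeff a I J"
      by simp
  qed
qed

instance
proof
  fix a b c :: "'a polyform"
  show "a + b + c = a + (b + c)" "a + b = b + a" "0 + a = a" "- a + a = 0" "a - b = a + - b"
    by (simp_all add: plus_polyform_def zero_polyform_def uminus_polyform_def minus_polyform_def add_ac)
  show "a * b * c = a * (b * c)" by (rule polyform_mult_assoc)
  show "1 * a = a" "a * 1 = a" by (rule polyform_mult_one)+
  show "(a + b) * c = a * c + b * c" "a * (b + c) = a * b + a * c"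
    by (rule polyform_eqI; simp add: plus_polyform_def coeff_mult sum.distrib algebra_simps)+
  have "coeff (0 :: 'a polyform) {} {} \<noteq> coeff 1 {} {}"
    by (simp add: zero_polyform_def one_polyform_def one_pvform_def)
  then show "(0 :: 'a polyform) \<noteq> 1" by auto
qed

end

lemma coeff_simps [simp]:
  "coeff 0 I J = 0" "coeff (a + b) I J = coeff a I J + coeff b I J"
  "coeff (a - b) I J = coeff a I J - coeff b I J" "coeff (- a) I J = - coeff a I J"
  "coeff 1 I J = (if I = {} \<and> J = {} then 1 else 0)"
  by (simp_all add: zero_polyform_def plus_polyform_def minus_polyform_def uminus_polyform_def
      one_polyform_def one_pvform_def)

lemma coeff_sum: "coeff (sum f S) I J = (\<Sum>x\<in>S. coeff (f x) I J)"
  by (induction S rule: infinite_finite_induct) auto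

lemma eq_neg_imp_0: "x = - x \<Longrightarrow> x = 0" for x :: "'n::{finite,linorder} polyform"
proof (rule polyform_eqI)
  fix I J assume "x = - x"
  then have "coeff x I J = - coeff x I J" using coeff_simps(4) by metis
  then show "coeff x I J = coeff 0 I J" by simp
qed

section \<open>Scalars, generators and monomials\<close>

definition scl :: "complex \<Rightarrow> 'n polyform \<Rightarrow> 'n polyform" where
  "scl k a = Pv (\<lambda>I J. k * coeff a I J)"

lemma coeff_scl [simp]: "coeff (scl k a) I J = k * coeff a I J"
  by (simp add: scl_def)

lemma scl_simps [simp]:
  fixes a b :: "'n::{finite,linorder} polyform"
  shows "scl k a * b = scl k (a * b)" "a * scl k b = scl k (a * b)" "scl k (scl l a) = scl (k * l) a"
    "scl 1 a = a" "scl 0 a = 0" "scl k 0 = 0"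
  by (auto intro!: polyform_eqI simp: coeff_mult sum_distrib_left mult_ac)

lemma scl_distrib:
  fixes a b :: "'n::{finite,linorder} polyform"
  shows "scl k (a + b) = scl k a + scl k b" "scl k (a - b) = scl k a - scl k b" "scl k (- a) = - scl k a"
    "scl (k + l) a = scl k a + scl l a" "scl (k - l) a = scl k a - scl l a" "scl (- k) a = - scl k a"
  by (auto intro!: polyform_eqI simp: algebra_simps)

lemma scl_sum: "scl k (sum f S) = (\<Sum>x\<in>S. scl k (f x :: 'n::{finite,linorder} polyform))"
  by (auto intro!: polyform_eqI simp: coeff_sum sum_distrib_left)

lemma below_simps:
  fixes J :: "'n::{finite,linorder} set"
  shows "i \<in> J \<Longrightarrow> i < j \<Longrightarrow> below j J = Suc (below j (J - {i}))"
    and "\<not> i < j \<Longrightarrow> below j (J - {i}) = below j J"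
    and "i \<notin> J \<Longrightarrow> i < j \<Longrightarrow> below j (insert i J) = Suc (below j J)"
    and "\<not> i < j \<Longrightarrow> below j (insert i J) = below j J"
proof -
  show "below j J = Suc (below j (J - {i}))" if "i \<in> J" "i < j"
  proof -
    have "{k\<in>J. k < j} = insert i {k\<in>J - {i}. k < j}" using that by auto
    then show ?thesis by (simp add: below_def)
  qed
  show "below j (insert i J) = Suc (below j J)" if "i \<notin> J" "i < j"
  proof -
    have "{k\<in>insert i J. k < j} = insert i {k\<in>J. k < j}" using that by auto
    then show ?thesis using that by (simp add: below_def)
  qed
  show "below j (J - {i}) = below j J" if "\<not> i < j"
    unfolding below_def by (rule arg_cong[of _ _ card]) (use that in auto)
  show "below j (insert i J) = below j J" if "\<not> i < j"
    unfolding below_def by (rule arg_cong[of _ _ card]) (use that in auto)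
qed

lemma card_Suc_obtain:
  fixes I :: "'n::finite set"
  assumes "i \<in> I" obtains n where "card I = Suc n"
  using assms by (metis card_Suc_Diff1 finite)

text \<open>The generators \<open>dzbar\<^sub>i\<close> and \<open>\<partial>\<^sub>i\<close>.\<close>

definition eta :: "'n \<Rightarrow> 'n polyform" where
  "eta i = Pv (\<lambda>I J. if I = {i} \<and> J = {} then 1 else 0)"

definition xi :: "'n \<Rightarrow> 'n polyform" where
  "xi i = Pv (\<lambda>I J. if I = {} \<and> J = {i} then 1 else 0)"

definition monomial :: "'n set \<Rightarrow> 'n set \<Rightarrow> 'n polyform" where
  "monomial I J = Pv (\<lambda>I' J'. if I' = I \<and> J' = J then 1 else 0)"

lemma coeff_monomial: "coeff (monomial I J) I' J' = (if I' = I \<and> J' = J then 1 else 0)"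
  by (simp add: monomial_def)

lemma coeff_monomial_mult:
  "coeff (monomial K L * a) I J = (if K \<subseteq> I \<and> L \<subseteq> J then msign K L (I - K) (J - L) * coeff a (I - K) (J - L) else 0)"
  unfolding coeff_mult
  by (subst sum_Pow_singleton[where K=K], simp add: coeff_monomial, subst sum_Pow_singleton[where K=L])
     (auto simp: coeff_monomial)

lemma eta_eq_monomial: "eta i = monomial {i} {}" and xi_eq_monomial: "xi i = monomial {} {i}"
  by (simp_all add: eta_def xi_def monomial_def)

lemma coeff_eta_mult: "coeff (eta i * a) I J =
  (if i \<in> I then (-1) ^ below i I * coeff a (I - {i}) J else 0)"
  using below_simps(2)[of i i I]
  by (simp add: eta_eq_monomial coeff_monomial_mult msign_def inversions_singleton_left)

lemma coeff_xi_mult: "coeff (xi i * a) I J =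
  (if i \<in> J then (-1) ^ (card I + below i J) * coeff a I (J - {i}) else 0)"
  using below_simps(2)[of i i J]
  by (simp add: xi_eq_monomial coeff_monomial_mult msign_def inversions_singleton_left add_ac)

lemma monomial_empty [simp]: "monomial {} {} = (1 :: 'n::{finite,linorder} polyform)"
  by (rule polyform_eqI) (simp add: coeff_monomial)

text \<open>Since i precedes all of I, the product is already in increasing order and no sign
  appears. This is the situation of an induction that adds new minimal elements.\<close>

lemma monomial_insert_eta:
  assumes "\<forall>j\<in>I. i < j" shows "monomial (insert i I) J = eta i * monomial I J"
proof (rule polyform_eqI)
  fix K L
  have "below i K = 0" if "i \<in> K" "K - {i} = I"
    using that assms less_asym by (fastforce simp: below_def)
  moreover have "i \<notin> I" using assms by force
  ultimately show "coeff (monomial (insert i I) J) K L = coeff (eta i * monomial I J) K L"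
    by (cases "i \<in> K") (auto simp: coeff_monomial coeff_eta_mult)
qed

lemma monomial_insert_xi:
  assumes "\<forall>k\<in>J. j < k" shows "monomial {} (insert j J) = xi j * monomial {} J"
proof (rule polyform_eqI)
  fix K L
  have "below j L = 0" if "j \<in> L" "L - {j} = J"
    using that assms less_asym by (fastforce simp: below_def)
  moreover have "j \<notin> J" using assms by force
  ultimately show "coeff (monomial {} (insert j J)) K L = coeff (xi j * monomial {} J) K L"
    by (cases "j \<in> L") (auto simp: coeff_monomial coeff_xi_mult)
qed

lemma polyform_expand: "a = (\<Sum>I\<in>UNIV. \<Sum>J\<in>UNIV. scl (coeff a I J) (monomial I J))"
  for a :: "'n::{finite,linorder} polyform"
proof (rule polyform_eqI)
  fix K L
  have "(\<Sum>I\<in>UNIV. \<Sum>J\<in>UNIV. coeff a I J * coeff (monomial I J) K L)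
      = (\<Sum>I\<in>UNIV. \<Sum>J\<in>UNIV. if J = L then if I = K then coeff a K L else 0 else 0)"
    by (intro sum.cong refl) (auto simp: coeff_monomial)
  then show "coeff a K L = coeff (\<Sum>I\<in>UNIV. \<Sum>J\<in>UNIV. scl (coeff a I J) (monomial I J)) K L"
    by (simp add: coeff_sum)
qed

text \<open>Ordered monomials arise from 1 by left multiplication with generators in decreasing
  order, first the \<open>xi\<close> and then the \<open>eta\<close>, and they span. A linear
  identity is thereby reduced to its behaviour under multiplication by a single generator.\<close>

lemma polyform_induct [case_names one eta xi add scl]:
  fixes a :: "'n::{finite,linorder} polyform"
  assumes one: "P 1" and eta: "\<And>i a. P a \<Longrightarrow> P (eta i * a)" and xi: "\<And>i a. P a \<Longrightarrow> P (xi i * a)"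
    and add: "\<And>a b. P a \<Longrightarrow> P b \<Longrightarrow> P (a + b)" and scl: "\<And>k a. P a \<Longrightarrow> P (scl k a)"
  shows "P a"
proof -
  have 1: "P (monomial {} J)" for J
    by (induction J rule: finite_linorder_min_induct[OF finite]) (simp_all add: one xi monomial_insert_xi)
  have 2: "P (monomial I J)" for I J
    by (induction I rule: finite_linorder_min_induct[OF finite]) (simp_all add: 1 eta monomial_insert_eta)
  have 0: "P 0" using scl[OF one, of 0] by simp
  have s: "P (sum f S)" if "finite S" "\<And>x. P (f x)" for f and S :: "'n set set"
    using that by (induction S rule: finite_induct) (simp_all add: 0 add)
  show ?thesis
    by (subst polyform_expand) (intro s scl 2 finite)
qed

section \<open>The parity automorphism, supercommutativity and contractions\<close>

definition eps :: "'n polyform \<Rightarrow> 'n polyform" where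
  "eps a = Pv (\<lambda>I J. (-1) ^ (card I + card J) * coeff a I J)"

definition left_con :: "'n::{finite,linorder} \<Rightarrow> 'n polyform \<Rightarrow> 'n polyform" where
  "left_con i a = Pv (left_contract i (coeff a))"

definition right_con :: "'n::{finite,linorder} \<Rightarrow> 'n polyform \<Rightarrow> 'n polyform" where
  "right_con i a = Pv (right_contract i (coeff a))"

lemma coeff_eps [simp]: "coeff (eps a) I J = (-1) ^ (card I + card J) * coeff a I J"
  by (simp add: eps_def)

lemma coeff_left_con: "coeff (left_con i a) I J =
   (if i \<in> J then 0 else (-1) ^ (card I + below i J) * coeff a I (insert i J))"
  by (simp add: left_con_def left_contract_def below_def)

lemma eps_linear:
  fixes a b :: "'n::{finite,linorder} polyform"
  shows "eps (a + b) = eps a + eps b" "eps (scl k a) = scl k (eps a)"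
  by (auto intro!: polyform_eqI simp: algebra_simps)

lemma left_con_linear:
  fixes a b :: "'n::{finite,linorder} polyform"
  shows "left_con i (a + b) = left_con i a + left_con i b" "left_con i (scl k a) = scl k (left_con i a)"
  by (auto intro!: polyform_eqI simp: coeff_left_con algebra_simps)

lemma eps_one [simp]: "eps 1 = (1 :: 'n::{finite,linorder} polyform)"
  by (rule polyform_eqI) simp

lemma eps_eps [simp]: "eps (eps a) = (a :: 'n::{finite,linorder} polyform)"
  by (rule polyform_eqI) (simp add: mult.assoc[symmetric] power_add[symmetric])

lemma eps_gen_mult:
  fixes a :: "'n::{finite,linorder} polyform"
  shows "eps (eta i * a) = - (eta i * eps a)" "eps (xi i * a) = - (xi i * eps a)"
proof -
  show "eps (eta i * a) = - (eta i * eps a)"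
  proof (rule polyform_eqI)
    fix I J
    show "coeff (eps (eta i * a)) I J = coeff (- (eta i * eps a)) I J"
      by (cases "i \<in> I") (erule card_Suc_obtain, simp_all add: coeff_eta_mult power_add)
  qed
  show "eps (xi i * a) = - (xi i * eps a)"
  proof (rule polyform_eqI)
    fix I J
    show "coeff (eps (xi i * a)) I J = coeff (- (xi i * eps a)) I J"
      by (cases "i \<in> J") (erule card_Suc_obtain, simp_all add: coeff_xi_mult power_add)
  qed
qed

lemma eps_mult: "eps (a * b) = eps a * eps b" for a b :: "'n::{finite,linorder} polyform"
  by (induction a rule: polyform_induct) (simp_all add: mult.assoc eps_gen_mult eps_linear distrib_right)

text \<open>Removing the smaller of the two indices shifts the position of the larger one by one,
  while removing the larger does not affect the smaller.\<close>

lemma below_swap_sign: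
  fixes I :: "'n::{finite,linorder} set"
  assumes "i \<noteq> j" "i \<in> I" "j \<in> I"
  shows "(-1) ^ (below i I + below j (I - {i})) = - ((-1) ^ (below j I + below i (I - {j})) :: complex)"
proof (cases "i < j")
  case True
  then have "below j I = Suc (below j (I - {i}))" "below i (I - {j}) = below i I"
    using assms below_simps(1)[of i I j] below_simps(2)[of j i I] by auto
  then show ?thesis by (simp add: power_add)
next
  case False
  then have "below i I = Suc (below i (I - {j}))" "below j (I - {i}) = below j I"
    using assms below_simps(1)[of j I i] below_simps(2)[of i j I] by auto
  then show ?thesis by (simp add: power_add)
qed

text \<open>The trailing factor \<open>a\<close> lets these rules act inside products associated to
  the right. For i = j the first two say that the square of a generator vanishes.\<close>

lemma gen_anticommute:
  fixes a :: "'n::{finite,linorder} polyform"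
  shows "eta i * (eta j * a) = - (eta j * (eta i * a))" (is ?A)
    and "xi i * (xi j * a) = - (xi j * (xi i * a))" (is ?B)
    and "eta i * (xi j * a) = - (xi j * (eta i * a))" (is ?C)
proof -
  have c: "I - {i} - {j} = I - {j} - {i}" for I by auto
  show ?A
  proof (rule polyform_eqI)
    fix I J
    show "coeff (eta i * (eta j * a)) I J = coeff (- (eta j * (eta i * a))) I J"
    proof (cases "i \<noteq> j \<and> i \<in> I \<and> j \<in> I")
      case True
      then have "coeff (eta i * (eta j * a)) I J
          = (-1) ^ (below i I + below j (I - {i})) * coeff a (I - {i} - {j}) J"
        by (auto simp: coeff_eta_mult power_add)
      also have "\<dots> = - ((-1) ^ (below j I + below i (I - {j})) * coeff a (I - {j} - {i}) J)"
        using True below_swap_sign[of i j I] by (simp only: c) simp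
      finally show ?thesis using True by (auto simp: coeff_eta_mult power_add)
    qed (auto simp: coeff_eta_mult)
  qed
  show ?B
  proof (rule polyform_eqI)
    fix I J
    show "coeff (xi i * (xi j * a)) I J = coeff (- (xi j * (xi i * a))) I J"
    proof (cases "i \<noteq> j \<and> i \<in> J \<and> j \<in> J")
      case True
      then have "coeff (xi i * (xi j * a)) I J
          = (-1) ^ (2 * card I) * ((-1) ^ (below i J + below j (J - {i})) * coeff a I (J - {i} - {j}))"
        by (auto simp: coeff_xi_mult power_add mult_2)
      also have "\<dots> = - ((-1) ^ (2 * card I) * ((-1) ^ (below j J + below i (J - {j})) * coeff a I (J - {j} - {i})))"
        using True below_swap_sign[of i j J] by (simp only: c) simp
      finally show ?thesis using True by (auto simp: coeff_xi_mult power_add mult_2)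
    qed (auto simp: coeff_xi_mult)
  qed
  show ?C
  proof (rule polyform_eqI)
    fix I J
    show "coeff (eta i * (xi j * a)) I J = coeff (- (xi j * (eta i * a))) I J"
      by (cases "i \<in> I") (erule card_Suc_obtain, simp_all add: coeff_xi_mult coeff_eta_mult power_add)
  qed
qed

text \<open>Supercommutativity in its simplest case: \<open>eps\<close> records the sign for each
  generator that is passed. The rules \<open>even_commute\<close> and \<open>odd_commute\<close>
  extend it from a generator to an arbitrary factor.\<close>

lemma mult_gen:
  fixes a :: "'n::{finite,linorder} polyform"
  shows "a * eta i = eta i * eps a" and "a * xi i = xi i * eps a"
proof -
  show "a * eta i = eta i * eps a"
    by (induction a rule: polyform_induct)
       (simp_all add: mult.assoc eps_gen_mult eps_linear distrib_right distrib_left gen_anticommute(1)[of i]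
          gen_anticommute(3)[of i])
  show "a * xi i = xi i * eps a"
    by (induction a rule: polyform_induct)
       (simp_all add: mult.assoc eps_gen_mult eps_linear distrib_right distrib_left gen_anticommute(2)[of i]
          gen_anticommute(3)[of _ i])
qed

lemma even_commute:
  fixes a :: "'n::{finite,linorder} polyform"
  assumes "eps a = a" shows "a * b = b * a"
proof (induction b rule: polyform_induct)
  case (eta i b)
  have "a * (eta i * b) = eta i * (a * b)"
    using assms mult_gen(1)[of a i] by (simp add: mult.assoc[symmetric])
  then show ?case by (simp only: eta mult.assoc)
next
  case (xi i b)
  have "a * (xi i * b) = xi i * (a * b)"
    using assms mult_gen(2)[of a i] by (simp add: mult.assoc[symmetric])
  then show ?case by (simp only: xi mult.assoc)
qed (simp_all add: distrib_left distrib_right)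

lemma odd_commute:
  fixes a :: "'n::{finite,linorder} polyform"
  assumes "eps a = - a" shows "a * b = eps b * a"
proof (induction b rule: polyform_induct)
  case (eta i b)
  have "a * (eta i * b) = - (eta i * (a * b))"
    using assms mult_gen(1)[of a i] by (simp add: mult.assoc[symmetric])
  then show ?case by (simp only: eta eps_gen_mult mult.assoc mult_minus_left)
next
  case (xi i b)
  have "a * (xi i * b) = - (xi i * (a * b))"
    using assms mult_gen(2)[of a i] by (simp add: mult.assoc[symmetric])
  then show ?case by (simp only: xi eps_gen_mult mult.assoc mult_minus_left)
qed (simp_all add: distrib_left distrib_right eps_linear)

lemma left_con_one [simp]: "left_con i 1 = 0"
  by (rule polyform_eqI) (simp add: coeff_left_con)

lemma left_con_eta_mult: "left_con i (eta k * a) = - (eta k * left_con i a)"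
proof (rule polyform_eqI)
  fix I J
  show "coeff (left_con i (eta k * a)) I J = coeff (- (eta k * left_con i a)) I J"
    by (cases "k \<in> I") (erule card_Suc_obtain, simp_all add: coeff_left_con coeff_eta_mult power_add)
qed

lemma sign_square: "(-1) ^ n * ((-1) ^ m * ((-1) ^ n * (-1) ^ m)) = (1::complex)"
  by (cases "even n"; cases "even m") simp_all

lemma left_con_xi_mult: "left_con i (xi k * a) = (if i = k then a else 0) - xi k * left_con i a"
proof (rule polyform_eqI)
  fix I J
  have sq: "(-1) ^ n * ((-1) ^ n * x) = x" for n and x :: complex
    by (simp add: mult.assoc[symmetric] power_add[symmetric])
  show "coeff (left_con i (xi k * a)) I J = coeff ((if i = k then a else 0) - xi k * left_con i a) I J"
  proof (cases "i \<in> J")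
    case True
    then show ?thesis
      by (auto simp: coeff_left_con coeff_xi_mult insert_absorb below_simps sq)
  next
    case False
    have c: "k \<noteq> i \<Longrightarrow> insert i J - {k} = insert i (J - {k})" by auto
    show ?thesis using False
      by (cases i k rule: linorder_cases)
         (auto simp: coeff_left_con coeff_xi_mult c sq power_add below_simps(3)[of i J k] below_simps(1)[of k J i]
           below_simps(4)[of i k J] below_simps(2)[of k i J] below_simps(4)[of k k J] sign_square)
  qed
qed

lemma left_con_mult: "left_con i (a * b) = left_con i a * b + eps a * left_con i b"
  by (induction a rule: polyform_induct)
     (simp_all add: mult.assoc left_con_eta_mult left_con_xi_mult left_con_linear eps_linear eps_gen_mult
       algebra_simps scl_distrib)

lemma left_con_anticommute: "left_con i (left_con j a) = - left_con j (left_con i a)"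
proof -
  have [simp]: "left_con i 0 = 0" for i :: 'a by (rule polyform_eqI) (simp add: coeff_left_con)
  have [simp]: "left_con i (- a) = - left_con i a" "left_con i (a - b) = left_con i a - left_con i b" for i :: 'a and a b
    by (rule polyform_eqI; simp add: coeff_left_con algebra_simps)+
  show ?thesis
    by (induction a rule: polyform_induct)
       (simp_all add: left_con_eta_mult left_con_xi_mult left_con_linear algebra_simps scl_distrib)
qed

lemma eps_left_con: "eps (left_con i a) = - left_con i (eps a)"
proof (rule polyform_eqI)
  fix I J
  show "coeff (eps (left_con i a)) I J = coeff (- left_con i (eps a)) I J"
    by (simp add: coeff_left_con)
qed

text \<open>Moving the generator from the front of a monomial to its end crosses all the other
  generators. Their number is card I + card J, since I and J index what remains after the removal,
  and this is the exponent in \<open>eps\<close>.\<close>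

lemma right_con_eq: "right_con i a = eps (left_con i a)"
proof (rule polyform_eqI)
  fix I J
  have "card J = card {j\<in>J. j < i} + card {j\<in>J. i < j}" if "i \<notin> J"
  proof -
    have "J = {j\<in>J. j < i} \<union> {j\<in>J. i < j}" using that by (auto simp: not_less_iff_gr_or_eq)
    moreover have "{j\<in>J. j < i} \<inter> {j\<in>J. i < j} = {}" by auto
    ultimately show ?thesis by (metis card_Un_disjoint finite)
  qed
  then show "coeff (right_con i a) I J = coeff (eps (left_con i a)) I J"
    by (auto simp: right_con_def right_contract_def coeff_left_con power_add below_def sign_square)
qed

section \<open>Smooth functions\<close>

lemma frechet_derivative_cong:
  assumes "open S" "x \<in> S" "\<And>y. y \<in> S \<Longrightarrow> f y = g y"
  shows "frechet_derivative f (at x) = frechet_derivative g (at x)"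
proof -
  have "(f has_derivative D) (at x) \<longleftrightarrow> (g has_derivative D) (at x)" for D
    using has_derivative_transform_within_open[of f D x UNIV S g]
      has_derivative_transform_within_open[of g D x UNIV S f] assms by auto
  then show ?thesis unfolding frechet_derivative_def by simp
qed

lemma frechet_derivative_eqI: "(f has_derivative D) (at x) \<Longrightarrow> frechet_derivative f (at x) v = D v"
  using frechet_derivative_at by metis

lemma differentiable_cong:
  assumes "open S" "x \<in> S" "\<And>y. y \<in> S \<Longrightarrow> f y = g y"
  shows "f differentiable (at x) \<longleftrightarrow> g differentiable (at x)"
  unfolding differentiable_def
  using has_derivative_transform_within_open[of f _ x UNIV S g]
      has_derivative_transform_within_open[of g _ x UNIV S f] assms by metis

lemma Ck_on_cong:
  assumes "open S" "\<And>x. x \<in> S \<Longrightarrow> f x = g x"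
  shows "Ck_on k S f \<longleftrightarrow> Ck_on k S g"
  using assms(2)
proof (induction k arbitrary: f g)
  case 0
  then show ?case by (auto intro: continuous_on_cong)
next
  case (Suc k)
  have 1: "Ck_on k S (\<lambda>x. frechet_derivative f (at x) v) \<longleftrightarrow> Ck_on k S (\<lambda>x. frechet_derivative g (at x) v)" for v
  proof (rule Suc.IH)
    fix x assume "x \<in> S"
    then show "frechet_derivative f (at x) v = frechet_derivative g (at x) v"
      by (metis frechet_derivative_cong[OF assms(1)] Suc.prems)
  qed
  have 2: "f differentiable (at x) \<longleftrightarrow> g differentiable (at x)" if "x \<in> S" for x
    using differentiable_cong[OF assms(1) that] Suc.prems by blast
  show ?case using 1 2 by simp
qed

lemma smooth_on_cong:
  assumes "open S" "\<And>x. x \<in> S \<Longrightarrow> f x = g x"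
  shows "smooth_on S f \<longleftrightarrow> smooth_on S g"
  by (simp add: smooth_on_def Ck_on_cong[OF assms])

lemma Ck_on_Suc: "Ck_on (Suc k) S f \<Longrightarrow> Ck_on k S f"
proof (induction k arbitrary: f)
  case 0
  then show ?case
    by (auto intro!: continuous_at_imp_continuous_on differentiable_imp_continuous_within)
qed auto

lemma Ck_on_add:
  assumes "open S" "Ck_on k S f" "Ck_on k S g"
  shows "Ck_on k S (\<lambda>x. f x + g x)"
  using assms(2,3)
proof (induction k arbitrary: f g)
  case 0
  then show ?case by (simp add: continuous_on_add)
next
  case (Suc k)
  have d: "((\<lambda>x. f x + g x) has_derivative (\<lambda>v. frechet_derivative f (at x) v + frechet_derivative g (at x) v)) (at x)"
    if "x \<in> S" for x
    using Suc.prems that frechet_derivative_works by (auto intro!: has_derivative_add)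
  have "Ck_on k S (\<lambda>x. frechet_derivative (\<lambda>x. f x + g x) (at x) v)" for v
    using Suc.IH[of "\<lambda>x. frechet_derivative f (at x) v" "\<lambda>x. frechet_derivative g (at x) v"] Suc.prems d
    by (subst Ck_on_cong[OF assms(1), of _ "\<lambda>x. frechet_derivative f (at x) v + frechet_derivative g (at x) v"])
       (auto simp: frechet_derivative_eqI[OF d])
  then show ?case using d by (auto simp: differentiable_def)
qed

lemma Ck_on_mult:
  fixes f g :: "'v::real_normed_vector \<Rightarrow> 'w::real_normed_algebra"
  assumes "open S" "Ck_on k S f" "Ck_on k S g"
  shows "Ck_on k S (\<lambda>x. f x * g x)"
  using assms(2,3)
proof (induction k arbitrary: f g)
  case 0
  then show ?case by (simp add: continuous_on_mult)
next
  case (Suc k)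
  have d: "((\<lambda>x. f x * g x) has_derivative (\<lambda>v. f x * frechet_derivative g (at x) v + frechet_derivative f (at x) v * g x)) (at x)"
    if "x \<in> S" for x
    using Suc.prems that frechet_derivative_works by (auto intro!: has_derivative_mult)
  have "Ck_on k S (\<lambda>x. frechet_derivative (\<lambda>x. f x * g x) (at x) v)" for v
    using Suc.prems d Ck_on_Suc[OF Suc.prems(1)] Ck_on_Suc[OF Suc.prems(2)]
    by (subst Ck_on_cong[OF assms(1), of _ "\<lambda>x. f x * frechet_derivative g (at x) v + frechet_derivative f (at x) v * g x"])
       (auto simp: frechet_derivative_eqI[OF d] intro!: Ck_on_add[OF assms(1)] Suc.IH)
  then show ?case using d by (auto simp: differentiable_def)
qed

lemma Ck_on_const: "Ck_on k S (\<lambda>x. c)"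
proof (induction k arbitrary: c)
  case (Suc k)
  then show ?case by simp
qed simp

lemma smooth_on_const [simp]: "smooth_on S (\<lambda>x. c)"
  by (simp add: smooth_on_def Ck_on_const)

lemma smooth_on_add: "open S \<Longrightarrow> smooth_on S f \<Longrightarrow> smooth_on S g \<Longrightarrow> smooth_on S (\<lambda>x. f x + g x)"
  by (simp add: smooth_on_def Ck_on_add)

lemma smooth_on_mult:
  fixes f g :: "'v::real_normed_vector \<Rightarrow> 'w::real_normed_algebra"
  shows "open S \<Longrightarrow> smooth_on S f \<Longrightarrow> smooth_on S g \<Longrightarrow> smooth_on S (\<lambda>x. f x * g x)"
  by (simp add: smooth_on_def Ck_on_mult)

lemma smooth_on_cmult:
  fixes f :: "'v::real_normed_vector \<Rightarrow> 'w::real_normed_algebra"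
  shows "open S \<Longrightarrow> smooth_on S f \<Longrightarrow> smooth_on S (\<lambda>x. c * f x)"
  by (simp add: smooth_on_mult)

lemma smooth_on_sum:
  assumes "open S" "\<And>i. i \<in> I \<Longrightarrow> smooth_on S (f i)"
  shows "smooth_on S (\<lambda>x. \<Sum>i\<in>I. f i x)"
  using assms(2)
  by (induction I rule: infinite_finite_induct) (auto intro!: smooth_on_add[OF assms(1)])

lemma smooth_on_differentiable: "smooth_on S f \<Longrightarrow> x \<in> S \<Longrightarrow> f differentiable (at x)"
  unfolding smooth_on_def by (metis Ck_on.simps(2))

lemma smooth_on_derivative: "smooth_on S f \<Longrightarrow> smooth_on S (\<lambda>x. frechet_derivative f (at x) v)"
  unfolding smooth_on_def by (metis Ck_on.simps(2))

text \<open>The mean value inequality in direction v, applied to the difference of f in direction w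
  minus its expected linear term. The derivative of this function compares the v-derivative of f at
  two points near x; differentiability of that v-derivative at x alone bounds it by e * t.\<close>

lemma second_difference:
  fixes f :: "'v::real_normed_vector \<Rightarrow> 'w::real_normed_vector"
  assumes S: "open S" "x \<in> S" and f: "\<And>y. y \<in> S \<Longrightarrow> f differentiable (at y)"
    and D: "((\<lambda>y. frechet_derivative f (at y) v) has_derivative A') (at x)" and e: "0 < e"
  shows "\<exists>d>0. \<forall>t. 0 < t \<and> t < d \<longrightarrow>
    norm (f (x + t *\<^sub>R v + t *\<^sub>R w) - f (x + t *\<^sub>R v) - f (x + t *\<^sub>R w) + f x - (t * t) *\<^sub>R A' w) \<le> e * (t * t)"
proof -
  \<comment> \<open>For s \<le> t, the number t * N bounds the sum of the lengths of the increments
    s v + t w and s v; the summand 1 keeps N positive if v = w = 0.\<close>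
  define N where "N = 2 * norm v + 2 * norm w + 1"
  have N: "N > 0" unfolding N_def by (simp add: add_nonneg_pos)
  have "e / N > 0" using e N by simp
  with D obtain d1 where d1: "d1 > 0"
    "\<And>y. norm (y - x) < d1 \<Longrightarrow> norm (frechet_derivative f (at y) v - frechet_derivative f (at x) v - A' (y - x)) \<le> e / N * norm (y - x)"
    unfolding has_derivative_within_alt by (metis UNIV_I)
  obtain d2 where d2: "d2 > 0" "ball x d2 \<subseteq> S" using S open_contains_ball by blast
  have linA: "linear A'" using D has_derivative_linear by blast
  define d where "d = min d1 d2 / N"
  have d: "d > 0" using d1 d2 N by (simp add: d_def)
  have small: "norm (s *\<^sub>R v + r *\<^sub>R w) < min d1 d2" if "0 \<le> s" "s \<le> t" "0 \<le> r" "r \<le> t" "t < d" "0 < t" for s r t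
  proof -
    have "norm (s *\<^sub>R v + r *\<^sub>R w) \<le> s * norm v + r * norm w"
      using that norm_triangle_ineq[of "s *\<^sub>R v" "r *\<^sub>R w"] by simp
    also have "\<dots> \<le> t * norm v + t * norm w" using that by (intro add_mono mult_right_mono) auto
    also have "\<dots> \<le> t * N" unfolding N_def using that by (simp add: algebra_simps)
    also have "\<dots> < min d1 d2" using that N unfolding d_def by (simp add: pos_less_divide_eq)
    finally show ?thesis .
  qed
  show ?thesis
  proof (intro exI[of _ d] conjI d allI impI)
    fix t :: real assume t: "0 < t \<and> t < d"
    define G where "G s = f (x + s *\<^sub>R v + t *\<^sub>R w) - f (x + s *\<^sub>R v) - (s * t) *\<^sub>R A' w" for s
    define G' where "G' s = frechet_derivative f (at (x + s *\<^sub>R v + t *\<^sub>R w)) v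
        - frechet_derivative f (at (x + s *\<^sub>R v)) v - t *\<^sub>R A' w" for s
    have inS: "x + s *\<^sub>R v + t *\<^sub>R w \<in> S" "x + s *\<^sub>R v \<in> S" if "0 \<le> s" "s \<le> t" for s
    proof -
      have "norm (s *\<^sub>R v + t *\<^sub>R w) < d2" "norm (s *\<^sub>R v + 0 *\<^sub>R w) < d2"
        using small[of s t t] small[of s t 0] that t by auto
      then show "x + s *\<^sub>R v + t *\<^sub>R w \<in> S" "x + s *\<^sub>R v \<in> S"
        using d2 by (auto simp: subset_iff dist_norm add.assoc norm_minus_commute)
    qed
    have der: "(G has_vector_derivative G' s) (at s)" if "0 \<le> s" "s \<le> t" for s
    proof -
      have f1: "(f has_derivative frechet_derivative f (at y)) (at y)" if "y \<in> S" for y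
        using f[OF that] frechet_derivative_works by blast
      have lin: "linear (frechet_derivative f (at y))" if "y \<in> S" for y
        using f[OF that] linear_frechet_derivative by blast
      have "((\<lambda>s. x + s *\<^sub>R v + t *\<^sub>R w) has_derivative (\<lambda>h. h *\<^sub>R v)) (at s)"
        by (auto intro!: derivative_eq_intros)
      then have 1: "((\<lambda>s. f (x + s *\<^sub>R v + t *\<^sub>R w)) has_derivative
          (\<lambda>h. frechet_derivative f (at (x + s *\<^sub>R v + t *\<^sub>R w)) (h *\<^sub>R v))) (at s)"
        by (rule has_derivative_compose) (rule f1[OF inS(1)[OF that]])
      have "((\<lambda>s. x + s *\<^sub>R v) has_derivative (\<lambda>h. h *\<^sub>R v)) (at s)"
        by (auto intro!: derivative_eq_intros)
      then have 2: "((\<lambda>s. f (x + s *\<^sub>R v)) has_derivative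
          (\<lambda>h. frechet_derivative f (at (x + s *\<^sub>R v)) (h *\<^sub>R v))) (at s)"
        by (rule has_derivative_compose) (rule f1[OF inS(2)[OF that]])
      have 3: "((\<lambda>s. (s * t) *\<^sub>R A' w) has_derivative (\<lambda>h. (h * t) *\<^sub>R A' w)) (at s)"
        by (auto intro!: derivative_eq_intros)
      show ?thesis
        unfolding has_vector_derivative_def G_def[abs_def] G'_def
        by (rule has_derivative_eq_rhs[OF has_derivative_diff[OF has_derivative_diff[OF 1 2] 3]])
           (use linear_scale[OF lin[OF inS(1)[OF that]]] linear_scale[OF lin[OF inS(2)[OF that]]] in \<open>simp add: fun_eq_iff scaleR_diff_right mult.commute\<close>)
    qed
    have bnd: "norm (G' s) \<le> e * t" if "0 < s" "s < t" for s
    proof -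
      let ?P = "\<lambda>h. frechet_derivative f (at (x + h)) v - frechet_derivative f (at x) v - A' h"
      have "norm (?P (s *\<^sub>R v + t *\<^sub>R w)) \<le> e / N * norm (s *\<^sub>R v + t *\<^sub>R w)"
        using d1(2)[of "x + (s *\<^sub>R v + t *\<^sub>R w)"] small[of s t t] that t by simp
      moreover have "norm (?P (s *\<^sub>R v)) \<le> e / N * norm (s *\<^sub>R v)"
        using d1(2)[of "x + (s *\<^sub>R v)"] small[of s t 0] that t by simp
      moreover have "G' s = ?P (s *\<^sub>R v + t *\<^sub>R w) - ?P (s *\<^sub>R v)"
        unfolding G'_def by (simp add: linear_add[OF linA] linear_scale[OF linA] add.assoc[symmetric])
      ultimately have 1: "norm (G' s) \<le> e / N * (norm (s *\<^sub>R v + t *\<^sub>R w) + norm (s *\<^sub>R v))"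
        by (smt (verit) norm_triangle_ineq4 distrib_left)
      have 2: "norm (s *\<^sub>R v + t *\<^sub>R w) + norm (s *\<^sub>R v) \<le> t * N"
      proof -
        have "norm (s *\<^sub>R v + t *\<^sub>R w) \<le> s * norm v + t * norm w"
          using that t norm_triangle_ineq[of "s *\<^sub>R v" "t *\<^sub>R w"] by simp
        moreover have "s * norm v \<le> t * norm v" using that by (intro mult_right_mono) auto
        moreover have "t * norm w \<ge> 0" using t by simp
        moreover have "t * N = 2 * (t * norm v) + 2 * (t * norm w) + t" unfolding N_def by (simp add: algebra_simps)
        moreover have "norm (s *\<^sub>R v) = s * norm v" using that by simp
        ultimately show ?thesis using t by linarith
      qed
      have "norm (G' s) \<le> e / N * (t * N)"
        by (rule order_trans[OF 1 mult_left_mono[OF 2]]) (use e N in simp)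
      then show ?thesis using N by simp
    qed
    have "norm (G t - G 0) \<le> e * t * t - e * t * 0"
    proof (rule differentiable_bound_general[where f'=G' and \<phi>'="\<lambda>_. e * t" and \<phi>="\<lambda>s. e * t * s"])
      show "continuous_on {0..t} G"
        using has_vector_derivative_continuous[OF der] by (intro continuous_at_imp_continuous_on ballI) auto
      show "((\<lambda>s. e * t * s) has_vector_derivative e * t) (at y)" for y
        by (auto intro!: derivative_eq_intros simp: has_vector_derivative_def)
    qed (use t der bnd in \<open>auto intro!: continuous_intros\<close>)
    then show "norm (f (x + t *\<^sub>R v + t *\<^sub>R w) - f (x + t *\<^sub>R v) - f (x + t *\<^sub>R w) + f x - (t * t) *\<^sub>R A' w) \<le> e * (t * t)"
      by (simp add: G_def algebra_simps)
  qed
qed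

text \<open>The second difference of f over the parallelogram spanned by t v and t w does not depend
  on the order of v and w, and divided by t^2 it approximates both mixed derivatives.\<close>

lemma second_derivative_symmetric:
  fixes f :: "'v::real_normed_vector \<Rightarrow> 'w::real_normed_vector"
  assumes S: "open S" "x \<in> S" and f: "\<And>y. y \<in> S \<Longrightarrow> f differentiable (at y)"
    and v: "(\<lambda>y. frechet_derivative f (at y) v) differentiable (at x)"
    and w: "(\<lambda>y. frechet_derivative f (at y) w) differentiable (at x)"
  shows "frechet_derivative (\<lambda>y. frechet_derivative f (at y) v) (at x) w
       = frechet_derivative (\<lambda>y. frechet_derivative f (at y) w) (at x) v" (is "?P = ?Q")
proof -
  have "norm (?P - ?Q) \<le> 0"
  proof (rule field_le_epsilon)
    fix e :: real assume "0 < e"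
    then have e: "0 < e / 2" by simp
    obtain d1 where d1: "d1 > 0" "\<And>t. 0 < t \<and> t < d1 \<Longrightarrow>
      norm (f (x + t *\<^sub>R v + t *\<^sub>R w) - f (x + t *\<^sub>R v) - f (x + t *\<^sub>R w) + f x - (t * t) *\<^sub>R ?P) \<le> e / 2 * (t * t)"
      using second_difference[OF S f v[unfolded frechet_derivative_works] e, of w] by blast
    obtain d2 where d2: "d2 > 0" "\<And>t. 0 < t \<and> t < d2 \<Longrightarrow>
      norm (f (x + t *\<^sub>R w + t *\<^sub>R v) - f (x + t *\<^sub>R w) - f (x + t *\<^sub>R v) + f x - (t * t) *\<^sub>R ?Q) \<le> e / 2 * (t * t)"
      using second_difference[OF S f w[unfolded frechet_derivative_works] e, of v] by blast
    define t where "t = min d1 d2 / 2"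
    have t: "0 < t" "t < d1" "t < d2" using d1(1) d2(1) by (auto simp: t_def)
    define X where "X = f (x + t *\<^sub>R v + t *\<^sub>R w) - f (x + t *\<^sub>R v) - f (x + t *\<^sub>R w) + f x"
    have 1: "norm (X - (t * t) *\<^sub>R ?P) \<le> e / 2 * (t * t)" using d1(2)[of t] t by (simp add: X_def)
    have "f (x + t *\<^sub>R w + t *\<^sub>R v) - f (x + t *\<^sub>R w) - f (x + t *\<^sub>R v) + f x = X"
      unfolding X_def by (simp add: algebra_simps)
    then have 2: "norm (X - (t * t) *\<^sub>R ?Q) \<le> e / 2 * (t * t)" using d2(2)[of t] t by simp
    have "(t * t) *\<^sub>R (?P - ?Q) = (X - (t * t) *\<^sub>R ?Q) - (X - (t * t) *\<^sub>R ?P)" by (simp add: algebra_simps)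
    then have "norm ((t * t) *\<^sub>R (?P - ?Q)) \<le> e * (t * t)"
      using norm_triangle_ineq4[of "X - (t * t) *\<^sub>R ?Q" "X - (t * t) *\<^sub>R ?P"] 1 2 by (simp add: algebra_simps)
    then have "(t * t) * norm (?P - ?Q) \<le> (t * t) * e" using t by (simp only: norm_scaleR abs_of_pos mult_pos_pos mult.commute[of e])
    then show "norm (?P - ?Q) \<le> 0 + e" using t by simp
  qed
  then show ?thesis by simp
qed

lemma smooth_on_symmetric:
  assumes "open S" "smooth_on S f" "x \<in> S"
  shows "frechet_derivative (\<lambda>y. frechet_derivative f (at y) v) (at x) w
       = frechet_derivative (\<lambda>y. frechet_derivative f (at y) w) (at x) v"
  using assms smooth_on_differentiable smooth_on_derivative
  by (intro second_derivative_symmetric[OF assms(1,3)]) blast+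

section \<open>Wirtinger calculus\<close>

lemma frechet_derivative_wirtinger:
  fixes u :: "complex ^ 'n::finite \<Rightarrow> complex"
  assumes "u differentiable (at z)"
  shows "frechet_derivative u (at z) h = (\<Sum>k\<in>UNIV. del k u z * h $ k + delbar k u z * cnj (h $ k))"
proof -
  let ?D = "frechet_derivative u (at z)"
  have lin: "linear ?D" using assms linear_frechet_derivative by blast
  have "h = (\<Sum>k\<in>UNIV. Re (h $ k) *\<^sub>R axis k 1 + Im (h $ k) *\<^sub>R axis k \<i>)"
    by (simp add: vec_eq_iff axis_def if_distrib sum.If_cases complex_eq_iff cong: if_cong)
  then have "?D h = (\<Sum>k\<in>UNIV. Re (h $ k) *\<^sub>R ?D (axis k 1) + Im (h $ k) *\<^sub>R ?D (axis k \<i>))"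
    by (metis (no_types, lifting) linear_sum[OF lin] linear_add[OF lin] linear_scale[OF lin] sum.cong)
  also have "\<dots> = (\<Sum>k\<in>UNIV. del k u z * h $ k + delbar k u z * cnj (h $ k))"
  proof (rule sum.cong[OF refl])
    fix k
    have "Re c *\<^sub>R p + Im c *\<^sub>R q = (p - \<i> * q) / 2 * c + (p + \<i> * q) / 2 * cnj c" for c p q :: complex
      by (simp add: complex_eq_iff field_simps)
    then show "Re (h $ k) *\<^sub>R ?D (axis k 1) + Im (h $ k) *\<^sub>R ?D (axis k \<i>) = del k u z * h $ k + delbar k u z * cnj (h $ k)"
      unfolding del_def delbar_def .
  qed
  finally show ?thesis .
qed

lemma sum_axis:
  fixes p q :: "'n::finite \<Rightarrow> complex"
  shows "(\<Sum>k\<in>UNIV. p k * axis i c $ k + q k * cnj (axis i c $ k)) = p i * c + q i * cnj c"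
  by (subst sum.remove[of _ i]) (auto simp: axis_def intro!: sum.neutral)

text \<open>Comparison of coefficients in a real differential that is split into its complex linear
  and antilinear parts. The sum, product, conjugation and chain rules below all bring a differential
  into this form.\<close>

lemma del_eqI:
  fixes u :: "complex ^ 'n::finite \<Rightarrow> complex"
  assumes "(u has_derivative (\<lambda>h. \<Sum>k\<in>UNIV. p k * h $ k + q k * cnj (h $ k))) (at z)"
  shows "del i u z = p i" "delbar i u z = q i"
proof -
  have D: "frechet_derivative u (at z) = (\<lambda>h. \<Sum>k\<in>UNIV. p k * h $ k + q k * cnj (h $ k))"
    using frechet_derivative_at[OF assms] by simp
  have *: "frechet_derivative u (at z) (axis i 1) = p i + q i"
    "frechet_derivative u (at z) (axis i \<i>) = \<i> * p i - \<i> * q i"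
    unfolding D sum_axis by simp_all
  show "del i u z = p i" "delbar i u z = q i"
    unfolding del_def delbar_def * by (simp_all add: algebra_simps)
qed

lemma has_derivative_wirtinger:
  fixes u :: "complex ^ 'n::finite \<Rightarrow> complex"
  assumes "u differentiable (at z)"
  shows "(u has_derivative (\<lambda>h. \<Sum>k\<in>UNIV. del k u z * h $ k + delbar k u z * cnj (h $ k))) (at z)"
proof -
  have "frechet_derivative u (at z) = (\<lambda>h. \<Sum>k\<in>UNIV. del k u z * h $ k + delbar k u z * cnj (h $ k))"
    using frechet_derivative_wirtinger[OF assms] by blast
  then show ?thesis using assms[unfolded frechet_derivative_works] by simp
qed

lemma del_cong:
  assumes "open S" "z \<in> S" "\<And>y. y \<in> S \<Longrightarrow> u y = v y"
  shows "del i u z = del i v z" "delbar i u z = delbar i v z"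
  using frechet_derivative_cong[OF assms] by (simp_all add: del_def delbar_def)

lemma del_const [simp]: "del i (\<lambda>z. c) z = 0" "delbar i (\<lambda>z. c) z = 0"
  by (simp_all add: del_def delbar_def)

lemma del_add:
  assumes "u differentiable (at z)" "v differentiable (at z)"
  shows "del i (\<lambda>z. u z + v z) z = del i u z + del i v z"
    and "delbar i (\<lambda>z. u z + v z) z = delbar i u z + delbar i v z"
proof -
  have "((\<lambda>z. u z + v z) has_derivative (\<lambda>h. \<Sum>k\<in>UNIV. (del k u z + del k v z) * h $ k
      + (delbar k u z + delbar k v z) * cnj (h $ k))) (at z)"
    by (rule has_derivative_eq_rhs[OF has_derivative_add[OF has_derivative_wirtinger[OF assms(1)]
        has_derivative_wirtinger[OF assms(2)]]]) (simp add: fun_eq_iff sum.distrib[symmetric] algebra_simps)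
  from del_eqI[OF this] show "del i (\<lambda>z. u z + v z) z = del i u z + del i v z"
    and "delbar i (\<lambda>z. u z + v z) z = delbar i u z + delbar i v z" by auto
qed

lemma del_mult:
  assumes "u differentiable (at z)" "v differentiable (at z)"
  shows "del i (\<lambda>z. u z * v z) z = del i u z * v z + u z * del i v z"
    and "delbar i (\<lambda>z. u z * v z) z = delbar i u z * v z + u z * delbar i v z"
proof -
  have "((\<lambda>z. u z * v z) has_derivative (\<lambda>h. \<Sum>k\<in>UNIV. (del k u z * v z + u z * del k v z) * h $ k
      + (delbar k u z * v z + u z * delbar k v z) * cnj (h $ k))) (at z)"
    by (rule has_derivative_eq_rhs[OF has_derivative_mult[OF has_derivative_wirtinger[OF assms(1)]
        has_derivative_wirtinger[OF assms(2)]]])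
      (simp add: fun_eq_iff sum.distrib sum_distrib_left sum_distrib_right algebra_simps)
  from del_eqI[OF this] show "del i (\<lambda>z. u z * v z) z = del i u z * v z + u z * del i v z"
    and "delbar i (\<lambda>z. u z * v z) z = delbar i u z * v z + u z * delbar i v z" by auto
qed

lemma del_cmult:
  assumes "u differentiable (at z)"
  shows "del i (\<lambda>z. c * u z) z = c * del i u z" "delbar i (\<lambda>z. c * u z) z = c * delbar i u z"
  using del_mult[of "\<lambda>z. c" z u i] assms by simp_all

lemma del_sum:
  assumes "finite S" "\<And>x. x \<in> S \<Longrightarrow> f x differentiable (at z)"
  shows "del i (\<lambda>z. \<Sum>x\<in>S. f x z) z = (\<Sum>x\<in>S. del i (f x) z)"
    and "delbar i (\<lambda>z. \<Sum>x\<in>S. f x z) z = (\<Sum>x\<in>S. delbar i (f x) z)"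
  using assms
proof (induction S rule: finite_induct)
  case (insert x S)
  { case 1 then show ?case using insert by (simp add: del_add differentiable_sum) }
  { case 2 then show ?case using insert by (simp add: del_add differentiable_sum) }
qed simp_all

lemma del_cnj:
  assumes "u differentiable (at z)"
  shows "del i (\<lambda>z. cnj (u z)) z = cnj (delbar i u z)" "delbar i (\<lambda>z. cnj (u z)) z = cnj (del i u z)"
proof -
  have "((\<lambda>z. cnj (u z)) has_derivative (\<lambda>h. \<Sum>k\<in>UNIV. cnj (delbar k u z) * h $ k
      + cnj (del k u z) * cnj (h $ k))) (at z)"
    by (rule has_derivative_eq_rhs[OF bounded_linear.has_derivative[OF bounded_linear_cnj has_derivative_wirtinger[OF assms(1)]]])
      (simp add: fun_eq_iff algebra_simps)
  from del_eqI[OF this] show "del i (\<lambda>z. cnj (u z)) z = cnj (delbar i u z)"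
    "delbar i (\<lambda>z. cnj (u z)) z = cnj (del i u z)" by auto
qed

lemma has_derivative_vec:
  fixes f :: "'v::real_normed_vector \<Rightarrow> complex ^ 'n::finite"
  assumes "\<And>k. ((\<lambda>x. f x $ k) has_derivative (\<lambda>h. D h $ k)) (at x)"
  shows "(f has_derivative D) (at x)"
proof -
  have lin: "bounded_linear (axis k :: complex \<Rightarrow> complex ^ 'n)" for k
    unfolding linear_conv_bounded_linear[symmetric]
    by (rule linearI) (auto simp: axis_def vec_eq_iff)
  have e: "(\<Sum>k\<in>UNIV. axis k (y $ k)) = y" for y :: "complex ^ 'n"
    by (simp add: vec_eq_iff axis_def if_distrib sum.If_cases cong: if_cong)
  have "((\<lambda>x. \<Sum>k\<in>UNIV. axis k (f x $ k)) has_derivative (\<lambda>h. \<Sum>k\<in>UNIV. axis k (D h $ k))) (at x)"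
    by (intro has_derivative_sum bounded_linear.has_derivative[OF lin] assms)
  then show ?thesis by (simp add: e)
qed

text \<open>The differential of the inner map is complex linear at z, so the two types of
  derivatives of \<open>u\<close> do not mix.\<close>

lemma del_compose:
  fixes f :: "complex ^ 'n::finite \<Rightarrow> complex ^ 'm::finite"
  assumes u: "u differentiable (at (f z))"
    and f: "\<And>k. (\<lambda>z. f z $ k) differentiable (at z)" "\<And>i k. delbar i (\<lambda>z. f z $ k) z = 0"
  shows "(\<lambda>z. u (f z)) differentiable (at z)"
    and "del i (\<lambda>z. u (f z)) z = (\<Sum>k\<in>UNIV. del k u (f z) * del i (\<lambda>z. f z $ k) z)"
    and "delbar i (\<lambda>z. u (f z)) z = (\<Sum>k\<in>UNIV. delbar k u (f z) * cnj (del i (\<lambda>z. f z $ k) z))"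
proof -
  have F: "(f has_derivative (\<lambda>h. \<chi> k. \<Sum>i\<in>UNIV. del i (\<lambda>z. f z $ k) z * h $ i)) (at z)"
  proof (rule has_derivative_vec)
    fix k
    show "((\<lambda>x. f x $ k) has_derivative (\<lambda>h. (\<chi> k. \<Sum>i\<in>UNIV. del i (\<lambda>z. f z $ k) z * h $ i) $ k)) (at z)"
      using has_derivative_wirtinger[OF f(1)[of k]] f(2) by simp
  qed
  have D: "((\<lambda>z. u (f z)) has_derivative (\<lambda>h. \<Sum>k\<in>UNIV.
       del k u (f z) * (\<Sum>i\<in>UNIV. del i (\<lambda>z. f z $ k) z * h $ i)
       + delbar k u (f z) * cnj (\<Sum>i\<in>UNIV. del i (\<lambda>z. f z $ k) z * h $ i))) (at z)"
    using has_derivative_compose[OF F, OF has_derivative_wirtinger[OF u]] by simp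
  from D show "(\<lambda>z. u (f z)) differentiable (at z)" by (auto simp: differentiable_def)
  have "((\<lambda>z. u (f z)) has_derivative (\<lambda>h. \<Sum>i\<in>UNIV. (\<Sum>k\<in>UNIV. del k u (f z) * del i (\<lambda>z. f z $ k) z) * h $ i
      + (\<Sum>k\<in>UNIV. delbar k u (f z) * cnj (del i (\<lambda>z. f z $ k) z)) * cnj (h $ i))) (at z)"
    by (rule has_derivative_eq_rhs[OF D])
       (simp add: fun_eq_iff sum.distrib sum_distrib_left sum_distrib_right mult.assoc sum.swap[of _ "UNIV :: 'n set"])
  from del_eqI[OF this]
  show "del i (\<lambda>z. u (f z)) z = (\<Sum>k\<in>UNIV. del k u (f z) * del i (\<lambda>z. f z $ k) z)"
    and "delbar i (\<lambda>z. u (f z)) z = (\<Sum>k\<in>UNIV. delbar k u (f z) * cnj (del i (\<lambda>z. f z $ k) z))"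
    by auto
qed

lemma smooth_on_del:
  assumes "open S" "smooth_on S u"
  shows "smooth_on S (del i u)" "smooth_on S (delbar i u)"
proof -
  have 1: "smooth_on S (\<lambda>z. (1/2) * (frechet_derivative u (at z) (axis i 1) + c * frechet_derivative u (at z) (axis i \<i>)))" for c
    by (intro smooth_on_cmult[OF assms(1)] smooth_on_add[OF assms(1)] smooth_on_derivative assms(2))
  have "del i u = (\<lambda>z. (1/2) * (frechet_derivative u (at z) (axis i 1) + (-\<i>) * frechet_derivative u (at z) (axis i \<i>)))"
    by (simp add: fun_eq_iff del_def)
  with 1[of "-\<i>"] show "smooth_on S (del i u)" by (simp only:)
  have "delbar i u = (\<lambda>z. (1/2) * (frechet_derivative u (at z) (axis i 1) + \<i> * frechet_derivative u (at z) (axis i \<i>)))"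
    by (simp add: fun_eq_iff delbar_def)
  with 1[of "\<i>"] show "smooth_on S (delbar i u)" by (simp only:)
qed

text \<open>Both operators are combinations of real directional derivatives with constant
  coefficients, so the symmetry of second derivatives applies term by term.\<close>

lemma del_commute:
  assumes "open S" "smooth_on S u" "z \<in> S"
  shows "del i (del j u) z = del j (del i u) z" "del i (delbar j u) z = delbar j (del i u) z"
proof -
  let ?D = "\<lambda>v y. frechet_derivative u (at y) v"
  have d: "?D v differentiable (at z)" for v
    using smooth_on_differentiable[OF smooth_on_derivative[OF assms(2)] assms(3)] .
  have F: "frechet_derivative (\<lambda>y. (?D v y + c * ?D w y) / 2) (at z) h
      = (frechet_derivative (?D v) (at z) h + c * frechet_derivative (?D w) (at z) h) / 2" for v w c h
  proof -
    have "((\<lambda>y. (?D v y + c * ?D w y) / 2) has_derivative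
       (\<lambda>h. (frechet_derivative (?D v) (at z) h + c * frechet_derivative (?D w) (at z) h) / 2)) (at z)"
      using d[unfolded frechet_derivative_works]
      by (auto intro!: derivative_eq_intros)
    then show ?thesis by (rule frechet_derivative_eqI)
  qed
  have d1: "del j u = (\<lambda>y. (?D (axis j 1) y + (-\<i>) * ?D (axis j \<i>) y) / 2)" for j
    by (simp add: del_def fun_eq_iff)
  have d2: "delbar j u = (\<lambda>y. (?D (axis j 1) y + \<i> * ?D (axis j \<i>) y) / 2)" for j
    by (simp add: delbar_def fun_eq_iff)
  note sym = smooth_on_symmetric[OF assms]
  show "del i (del j u) z = del j (del i u) z"
    unfolding del_def[of i "del j u"] del_def[of j "del i u"] unfolding d1 F
    unfolding sym[of "axis i 1" "axis j 1"] sym[of "axis i 1" "axis j \<i>"] sym[of "axis i \<i>" "axis j 1"]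
      sym[of "axis i \<i>" "axis j \<i>"] by (simp add: field_simps)
  show "del i (delbar j u) z = delbar j (del i u) z"
    unfolding del_def[of i "delbar j u"] delbar_def[of j "del i u"] unfolding d1 d2 F
    unfolding sym[of "axis i 1" "axis j 1"] sym[of "axis i 1" "axis j \<i>"] sym[of "axis i \<i>" "axis j 1"]
      sym[of "axis i \<i>" "axis j \<i>"] by (simp add: field_simps)
qed

section \<open>The Batalin-Vilkovisky operator and the bracket\<close>

definition plinear :: "('n::{finite,linorder} polyform \<Rightarrow> 'n polyform) \<Rightarrow> bool" where
  "plinear h \<longleftrightarrow> (\<forall>a b. h (a + b) = h a + h b) \<and> (\<forall>k a. h (scl k a) = scl k (h a))"

lemma plinear_add: "plinear h \<Longrightarrow> h (a + b) = h a + h b" and plinear_scl: "plinear h \<Longrightarrow> h (scl k a) = scl k (h a)"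
  by (simp_all add: plinear_def)

lemma plinear_0: "plinear h \<Longrightarrow> h 0 = 0"
  using plinear_scl[of h 0 0] by simp

lemma plinear_minus: "plinear h \<Longrightarrow> h (- a) = - h a"
  using plinear_scl[of h "-1" a] by (simp add: scl_distrib)

lemma plinear_diff: "plinear h \<Longrightarrow> h (a - b) = h a - h b"
  using plinear_add[of h a "- b"] plinear_minus[of h b] by simp

lemma plinear_sum: "plinear h \<Longrightarrow> h (sum f S) = (\<Sum>x\<in>S. h (f x))"
  by (induction S rule: infinite_finite_induct) (simp_all add: plinear_0 plinear_add)

text \<open>A linear map has a constant matrix in the basis of monomials. Hence it preserves smooth
  fields, commutes with \<open>del\<close> and \<open>delbar\<close>, and acts on jets; each of
  these facts is read off from this finite sum.\<close>

lemma plinear_coeff: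
  assumes "plinear h"
  shows "coeff (h a) I J = (\<Sum>K\<in>UNIV. \<Sum>L\<in>UNIV. coeff (h (monomial K L)) I J * coeff a K L)"
  by (subst polyform_expand[of a]) (simp add: plinear_sum[OF assms] plinear_scl[OF assms] coeff_sum mult.commute)

lemma plinear_eps: "plinear eps" and plinear_left_con: "plinear (left_con i)" and plinear_right_con: "plinear (right_con i)"
  and plinear_mult_left: "plinear (\<lambda>a. c * a)" and plinear_scl': "plinear (scl k)"
  by (simp_all add: plinear_def eps_linear left_con_linear right_con_eq distrib_left scl_distrib mult.commute)

text \<open>One predicate for both families of operators, so that each rule for fields is proved
  once and serves \<open>bv\<close> as well as the Dolbeault operator.\<close>

definition wirtinger_op :: "((complex ^ 'n::finite \<Rightarrow> complex) \<Rightarrow> complex ^ 'n \<Rightarrow> complex) \<Rightarrow> bool" where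
  "wirtinger_op P \<longleftrightarrow> (\<exists>i. P = del i \<or> P = delbar i)"

lemma wirtinger_op_intros [simp]: "wirtinger_op (del i)" "wirtinger_op (delbar i)"
  by (auto simp: wirtinger_op_def)

lemma wirtinger_op_const: "wirtinger_op P \<Longrightarrow> P (\<lambda>w. c) z = 0"
  by (auto simp: wirtinger_op_def)

lemma wirtinger_op_add: "wirtinger_op P \<Longrightarrow> u differentiable (at z) \<Longrightarrow> v differentiable (at z) \<Longrightarrow>
    P (\<lambda>w. u w + v w) z = P u z + P v z"
  by (auto simp: wirtinger_op_def del_add)

lemma wirtinger_op_mult: "wirtinger_op P \<Longrightarrow> u differentiable (at z) \<Longrightarrow> v differentiable (at z) \<Longrightarrow>
    P (\<lambda>w. u w * v w) z = P u z * v z + u z * P v z"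
  by (auto simp: wirtinger_op_def del_mult)

lemma wirtinger_op_cmult: "wirtinger_op P \<Longrightarrow> u differentiable (at z) \<Longrightarrow> P (\<lambda>w. c * u w) z = c * P u z"
  by (auto simp: wirtinger_op_def del_cmult)

lemma wirtinger_op_sum: "wirtinger_op P \<Longrightarrow> finite S \<Longrightarrow> (\<And>x. x \<in> S \<Longrightarrow> f x differentiable (at z)) \<Longrightarrow>
    P (\<lambda>w. \<Sum>x\<in>S. f x w) z = (\<Sum>x\<in>S. P (f x) z)"
  by (auto simp: wirtinger_op_def del_sum)

lemma wirtinger_op_cong: "wirtinger_op P \<Longrightarrow> open S \<Longrightarrow> z \<in> S \<Longrightarrow> (\<And>y. y \<in> S \<Longrightarrow> u y = v y) \<Longrightarrow> P u z = P v z"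
  using del_cong[of S z u v] by (auto simp: wirtinger_op_def)

lemma wirtinger_op_smooth: "wirtinger_op P \<Longrightarrow> open S \<Longrightarrow> smooth_on S u \<Longrightarrow> smooth_on S (P u)"
  by (auto simp: wirtinger_op_def smooth_on_del)

lemma wirtinger_op_commute: "wirtinger_op P \<Longrightarrow> open S \<Longrightarrow> smooth_on S u \<Longrightarrow> z \<in> S \<Longrightarrow> P (del i u) z = del i (P u) z"
  using del_commute[of S u z] by (auto simp: wirtinger_op_def)

type_synonym 'n pfield = "complex ^ 'n \<Rightarrow> 'n polyform"

definition pdiff :: "'n pfield \<Rightarrow> complex ^ 'n::{finite,linorder} \<Rightarrow> bool" where
  "pdiff a z \<longleftrightarrow> (\<forall>I J. (\<lambda>w. coeff (a w) I J) differentiable (at z))"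

definition pder :: "((complex ^ 'n::{finite,linorder} \<Rightarrow> complex) \<Rightarrow> complex ^ 'n::{finite,linorder} \<Rightarrow> complex) \<Rightarrow>
    'n pfield \<Rightarrow> 'n pfield" where
  "pder P a z = Pv (\<lambda>I J. P (\<lambda>w. coeff (a w) I J) z)"

abbreviation "pdel i \<equiv> pder (del i)"

abbreviation "pdelbar i \<equiv> pder (delbar i)"

lemma pdiff_const [simp]: "pdiff (\<lambda>w. a) z"
  by (simp add: pdiff_def)

lemma pder_const [simp]: "wirtinger_op P \<Longrightarrow> pder P (\<lambda>w. a) z = 0"
  by (auto simp: pder_def wirtinger_op_const intro!: polyform_eqI)

lemma pder_add:
  assumes "pdiff a z" "pdiff b z"
  shows "pdiff (\<lambda>w. a w + b w) z"
    "wirtinger_op P \<Longrightarrow> pder P (\<lambda>w. a w + b w) z = pder P a z + pder P b z"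
  using assms wirtinger_op_add[of P] by (auto simp: pdiff_def pder_def intro!: polyform_eqI)

lemma pder_sum:
  assumes "finite S" "\<And>x. x \<in> S \<Longrightarrow> pdiff (f x) z"
  shows "pdiff (\<lambda>w. \<Sum>x\<in>S. f x w) z"
    "wirtinger_op P \<Longrightarrow> pder P (\<lambda>w. \<Sum>x\<in>S. f x w) z = (\<Sum>x\<in>S. pder P (f x) z)"
  using assms
proof (induction S rule: finite_induct)
  case (insert x S)
  { case 1 then show ?case using insert by (simp add: pder_add) }
  { case 2 then show ?case using insert by (simp add: pder_add) }
qed simp_all

lemma pder_scl:
  assumes "u differentiable (at z)" "pdiff a z"
  shows "pdiff (\<lambda>w. scl (u w) (a w)) z"
    "wirtinger_op P \<Longrightarrow> pder P (\<lambda>w. scl (u w) (a w)) z = scl (P u z) (a z) + scl (u z) (pder P a z)"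
  using assms wirtinger_op_mult[of P] by (auto simp: pdiff_def pder_def intro!: polyform_eqI differentiable_mult)

lemma pder_mult:
  assumes "pdiff a z" "pdiff b z"
  shows "pdiff (\<lambda>w. a w * b w) z"
    "wirtinger_op P \<Longrightarrow> pder P (\<lambda>w. a w * b w) z = pder P a z * b z + a z * pder P b z"
proof -
  have d: "(\<lambda>w. coeff (a w) I J) differentiable (at z)" "(\<lambda>w. coeff (b w) I J) differentiable (at z)" for I J
    using assms by (auto simp: pdiff_def)
  show "pdiff (\<lambda>w. a w * b w) z"
    unfolding pdiff_def coeff_mult by (intro allI differentiable_sum differentiable_mult) (auto simp: d)
  assume P: "wirtinger_op P"
  show "pder P (\<lambda>w. a w * b w) z = pder P a z * b z + a z * pder P b z"
  proof (rule polyform_eqI)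
    fix I J
    have "P (\<lambda>w. coeff (a w * b w) I J) z = (\<Sum>I'\<in>Pow I. \<Sum>J'\<in>Pow J. msign I' J' (I - I') (J - J') *
          (P (\<lambda>w. coeff (a w) I' J') z * coeff (b z) (I - I') (J - J')
           + coeff (a z) I' J' * P (\<lambda>w. coeff (b w) (I - I') (J - J')) z))"
      unfolding coeff_mult mult.assoc
      by (simp add: wirtinger_op_sum[OF P] wirtinger_op_cmult[OF P] wirtinger_op_mult[OF P] d)
    then show "coeff (pder P (\<lambda>w. a w * b w) z) I J = coeff (pder P a z * b z + a z * pder P b z) I J"
      by (simp add: pder_def coeff_mult sum.distrib algebra_simps)
  qed
qed

text \<open>Smooth fields of polyforms on an open set \<open>U\<close>, extended by 0; thereby identities between
  fields are equalities of functions and hold in the ring of functions.\<close>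

definition smooth_fields :: "(complex ^ 'n::{finite,linorder}) set \<Rightarrow> 'n pfield set" where
  "smooth_fields U = {a. (\<forall>z. z \<notin> U \<longrightarrow> a z = 0) \<and> (\<forall>I J. smooth_on U (\<lambda>z. coeff (a z) I J))}"

definition deriv_on :: "(complex ^ 'n::{finite,linorder}) set \<Rightarrow> ((complex ^ 'n::{finite,linorder} \<Rightarrow> complex) \<Rightarrow> complex ^ 'n::{finite,linorder} \<Rightarrow> complex) \<Rightarrow>
    'n pfield \<Rightarrow> 'n pfield" where
  "deriv_on U P a = (\<lambda>z. if z \<in> U then pder P a z else 0)"

definition eps_on :: "('v \<Rightarrow> 'n polyform) \<Rightarrow> 'v \<Rightarrow> 'n polyform" where
  "eps_on a = (\<lambda>z. eps (a z))"

definition bv :: "(complex ^ 'n::{finite,linorder}) set \<Rightarrow> 'n pfield \<Rightarrow> 'n pfield" where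
  "bv U a = (\<lambda>z. \<Sum>i\<in>UNIV. left_con i (deriv_on U (del i) a z))"

definition dbar_on :: "(complex ^ 'n::{finite,linorder}) set \<Rightarrow> 'n pfield \<Rightarrow> 'n pfield" where
  "dbar_on U a = (\<lambda>z. \<Sum>i\<in>UNIV. eta i * deriv_on U (delbar i) a z)"

definition brkt :: "(complex ^ 'n::{finite,linorder}) set \<Rightarrow> 'n pfield \<Rightarrow> 'n pfield \<Rightarrow>
    'n pfield" where
  "brkt U a b = (\<lambda>z. \<Sum>i\<in>UNIV. right_con i (a z) * deriv_on U (del i) b z - deriv_on U (del i) a z * left_con i (b z))"

definition even_field :: "(complex ^ 'n::{finite,linorder}) set \<Rightarrow> 'n pfield \<Rightarrow> bool" where
  "even_field U a \<longleftrightarrow> a \<in> smooth_fields U \<and> eps_on a = a"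

definition odd_field :: "(complex ^ 'n::{finite,linorder}) set \<Rightarrow> 'n pfield \<Rightarrow> bool" where
  "odd_field U a \<longleftrightarrow> a \<in> smooth_fields U \<and> eps_on a = - a"

section \<open>Calculus of smooth fields on an open set\<close>

context
  fixes U :: "(complex ^ 'n::{finite,linorder}) set"
  assumes U: "open U"
begin

lemma fieldsD: "a \<in> smooth_fields U \<Longrightarrow> z \<notin> U \<Longrightarrow> a z = 0" "a \<in> smooth_fields U \<Longrightarrow> smooth_on U (\<lambda>z. coeff (a z) I J)"
  "a \<in> smooth_fields U \<Longrightarrow> z \<in> U \<Longrightarrow> (\<lambda>z. coeff (a z) I J) differentiable (at z)"
  using smooth_on_differentiable[of U "\<lambda>z. coeff (a z) I J" z] by (auto simp: smooth_fields_def)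

lemma fields_pdiff: "a \<in> smooth_fields U \<Longrightarrow> z \<in> U \<Longrightarrow> pdiff a z"
  by (simp add: pdiff_def fieldsD(3))

lemma fields_plinear:
  assumes "plinear h" "a \<in> smooth_fields U" shows "(\<lambda>z. h (a z)) \<in> smooth_fields U"
  unfolding smooth_fields_def
proof (intro CollectI conjI allI impI)
  fix z assume "z \<notin> U" then show "h (a z) = 0" using assms fieldsD(1) plinear_0 by metis
next
  fix I J show "smooth_on U (\<lambda>z. coeff (h (a z)) I J)"
    unfolding plinear_coeff[OF assms(1), of "a _"]
    by (intro smooth_on_sum smooth_on_cmult U fieldsD(2) assms)
qed

lemma fields_add: "a \<in> smooth_fields U \<Longrightarrow> b \<in> smooth_fields U \<Longrightarrow> a + b \<in> smooth_fields U"
  using U by (auto simp: smooth_fields_def smooth_on_add)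

lemma fields_0: "0 \<in> smooth_fields U"
  by (simp add: smooth_fields_def)

lemma fields_uminus: "a \<in> smooth_fields U \<Longrightarrow> - a \<in> smooth_fields U"
  using fields_plinear[of uminus a] by (simp add: plinear_def scl_distrib fun_Compl_def)

lemma fields_diff: "a \<in> smooth_fields U \<Longrightarrow> b \<in> smooth_fields U \<Longrightarrow> a - b \<in> smooth_fields U"
  using fields_add[of a "- b"] fields_uminus[of b] by simp

lemma fields_sum: "(\<And>i. i \<in> S \<Longrightarrow> f i \<in> smooth_fields U) \<Longrightarrow> (\<lambda>z. \<Sum>i\<in>S. f i z) \<in> smooth_fields U"
proof (induction S rule: infinite_finite_induct)
  case (insert x S)
  then have "f x + (\<lambda>z. \<Sum>i\<in>S. f i z) \<in> smooth_fields U" by (intro fields_add) auto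
  then show ?case using insert by (simp add: plus_fun_def)
qed (use fields_0 in \<open>simp_all add: zero_fun_def\<close>)

lemma fields_mult:
  assumes "a \<in> smooth_fields U" "b \<in> smooth_fields U" shows "a * b \<in> smooth_fields U"
  unfolding smooth_fields_def
proof (intro CollectI conjI allI impI)
  fix z assume "z \<notin> U" then show "(a * b) z = 0" using fieldsD(1)[OF assms(1)] by simp
next
  fix I J show "smooth_on U (\<lambda>z. coeff ((a * b) z) I J)"
    unfolding coeff_mult times_fun_apply mult.assoc
    by (intro smooth_on_sum smooth_on_cmult smooth_on_mult U fieldsD(2) assms)
qed

lemma fields_deriv_on: "wirtinger_op P \<Longrightarrow> a \<in> smooth_fields U \<Longrightarrow> deriv_on U P a \<in> smooth_fields U"
  unfolding smooth_fields_def
proof (intro CollectI conjI allI impI)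
  fix z assume "z \<notin> U" then show "deriv_on U P a z = 0" by (simp add: deriv_on_def)
next
  fix I J assume "wirtinger_op P" "a \<in> {a. (\<forall>z. z \<notin> U \<longrightarrow> a z = 0) \<and> (\<forall>I J. smooth_on U (\<lambda>z. coeff (a z) I J))}"
  then have "smooth_on U (P (\<lambda>w. coeff (a w) I J))" by (auto intro: wirtinger_op_smooth[OF _ U])
  then show "smooth_on U (\<lambda>z. coeff (deriv_on U P a z) I J)"
    by (subst smooth_on_cong[OF U, of _ "P (\<lambda>w. coeff (a w) I J)"]) (auto simp: deriv_on_def pder_def)
qed

lemma fields_eps_on: "a \<in> smooth_fields U \<Longrightarrow> eps_on a \<in> smooth_fields U"
  unfolding eps_on_def by (rule fields_plinear[OF plinear_eps])

lemma fields_bv: "a \<in> smooth_fields U \<Longrightarrow> bv U a \<in> smooth_fields U"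
  unfolding bv_def by (intro fields_sum fields_plinear[OF plinear_left_con] fields_deriv_on) auto

lemma fields_dbar_on: "a \<in> smooth_fields U \<Longrightarrow> dbar_on U a \<in> smooth_fields U"
  unfolding dbar_on_def by (intro fields_sum fields_plinear[OF plinear_mult_left] fields_deriv_on) auto

lemma fields_brkt:
  assumes "a \<in> smooth_fields U" "b \<in> smooth_fields U" shows "brkt U a b \<in> smooth_fields U"
proof -
  have "(\<lambda>z. right_con i (a z)) * deriv_on U (del i) b - deriv_on U (del i) a * (\<lambda>z. left_con i (b z)) \<in> smooth_fields U" for i
    using assms by (intro fields_diff fields_mult fields_deriv_on fields_plinear[OF plinear_left_con] fields_plinear[OF plinear_right_con]) auto
  from fields_sum[of UNIV, OF this] show ?thesis by (simp add: brkt_def)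
qed

lemma deriv_on_plinear:
  assumes "wirtinger_op P" "plinear h" "a \<in> smooth_fields U"
  shows "deriv_on U P (\<lambda>z. h (a z)) = (\<lambda>z. h (deriv_on U P a z))"
proof
  fix z
  show "deriv_on U P (\<lambda>z. h (a z)) z = h (deriv_on U P a z)"
  proof (cases "z \<in> U")
    case True
    have "P (\<lambda>w. coeff (h (a w)) I J) z = coeff (h (deriv_on U P a z)) I J" for I J
    proof -
      have d: "(\<lambda>w. coeff (a w) K L) differentiable (at z)" for K L
        using fieldsD(3)[OF assms(3) True] .
      have "P (\<lambda>w. coeff (h (a w)) I J) z
          = (\<Sum>K\<in>UNIV. \<Sum>L\<in>UNIV. coeff (h (monomial K L)) I J * P (\<lambda>w. coeff (a w) K L) z)"
        unfolding plinear_coeff[OF assms(2), of "a _"]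
        by (simp add: wirtinger_op_sum[OF assms(1)] wirtinger_op_cmult[OF assms(1)] d)
      also have "\<dots> = coeff (h (deriv_on U P a z)) I J"
        unfolding plinear_coeff[OF assms(2), of "deriv_on U P a z"] using True by (simp add: deriv_on_def pder_def)
      finally show ?thesis .
    qed
    then show ?thesis using True by (intro polyform_eqI) (simp add: deriv_on_def pder_def)
  next
    case False
    then show ?thesis by (simp add: deriv_on_def plinear_0[OF assms(2)])
  qed
qed

lemma deriv_on_add:
  assumes "wirtinger_op P" "a \<in> smooth_fields U" "b \<in> smooth_fields U"
  shows "deriv_on U P (a + b) = deriv_on U P a + deriv_on U P b"
proof
  fix z show "deriv_on U P (a + b) z = (deriv_on U P a + deriv_on U P b) z"
    using pder_add(2)[OF fields_pdiff[OF assms(2)] fields_pdiff[OF assms(3)] assms(1), of z]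
    by (cases "z \<in> U") (simp_all add: deriv_on_def plus_fun_def)
qed

lemma deriv_on_uminus:
  assumes "wirtinger_op P" "a \<in> smooth_fields U" shows "deriv_on U P (- a) = - deriv_on U P a"
  using deriv_on_plinear[of P uminus a] assms by (simp add: plinear_def scl_distrib fun_Compl_def)

lemma deriv_on_diff:
  assumes "wirtinger_op P" "a \<in> smooth_fields U" "b \<in> smooth_fields U"
  shows "deriv_on U P (a - b) = deriv_on U P a - deriv_on U P b"
  using deriv_on_add[of P a "- b"] deriv_on_uminus[of P b] fields_uminus[of b] assms by simp

lemma deriv_on_sum:
  assumes "wirtinger_op P" "\<And>i. i \<in> S \<Longrightarrow> f i \<in> smooth_fields U"
  shows "deriv_on U P (\<lambda>z. \<Sum>i\<in>S. f i z) = (\<lambda>z. \<Sum>i\<in>S. deriv_on U P (f i) z)"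
  using assms(2)
proof (induction S rule: infinite_finite_induct)
  case (insert x S)
  have "(\<lambda>z. \<Sum>i\<in>insert x S. f i z) = f x + (\<lambda>z. \<Sum>i\<in>S. f i z)" using insert by auto
  then show ?case using insert fields_sum[of S f] by (auto simp: deriv_on_add[OF assms(1)])
qed (simp_all add: deriv_on_def assms(1) fun_eq_iff)

lemma deriv_on_mult:
  assumes "wirtinger_op P" "a \<in> smooth_fields U" "b \<in> smooth_fields U"
  shows "deriv_on U P (a * b) = deriv_on U P a * b + a * deriv_on U P b"
proof
  fix z show "deriv_on U P (a * b) z = (deriv_on U P a * b + a * deriv_on U P b) z"
    using pder_mult(2)[OF fields_pdiff[OF assms(2)] fields_pdiff[OF assms(3)] assms(1), of z]
    by (cases "z \<in> U") (simp_all add: deriv_on_def times_fun_def)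
qed

lemma deriv_on_commute:
  assumes "wirtinger_op P" "a \<in> smooth_fields U"
  shows "deriv_on U P (deriv_on U (del i) a) = deriv_on U (del i) (deriv_on U P a)"
proof
  fix z show "deriv_on U P (deriv_on U (del i) a) z = deriv_on U (del i) (deriv_on U P a) z"
  proof (cases "z \<in> U")
    case True
    have *: "wirtinger_op Q \<Longrightarrow> P' (\<lambda>w. coeff (deriv_on U Q a w) I J) z = P' (Q (\<lambda>w. coeff (a w) I J)) z"
      if "wirtinger_op P'" for P' Q I J
      by (rule wirtinger_op_cong[OF that U True]) (simp add: deriv_on_def pder_def)
    show ?thesis
      using True wirtinger_op_commute[OF assms(1) U fieldsD(2)[OF assms(2)] True] assms(1)
      by (intro polyform_eqI) (simp add: deriv_on_def[of U P "deriv_on U _ a"] deriv_on_def[of U "del i" "deriv_on U P a"] pder_def *)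
  qed (simp add: deriv_on_def)
qed

lemma eps_on_mult: "eps_on (a * b) = eps_on a * eps_on b" for a b :: "'v \<Rightarrow> 'n polyform"
  by (simp add: eps_on_def fun_eq_iff eps_mult)

lemma bv_add: "a \<in> smooth_fields U \<Longrightarrow> b \<in> smooth_fields U \<Longrightarrow> bv U (a + b) = bv U a + bv U b"
  by (simp add: bv_def deriv_on_add fun_eq_iff left_con_linear sum.distrib)

lemma bv_uminus: "a \<in> smooth_fields U \<Longrightarrow> bv U (- a) = - bv U a"
  by (simp add: bv_def deriv_on_uminus fun_eq_iff plinear_minus[OF plinear_left_con] sum_negf)

lemma bv_diff: "a \<in> smooth_fields U \<Longrightarrow> b \<in> smooth_fields U \<Longrightarrow> bv U (a - b) = bv U a - bv U b"
  by (simp add: bv_def deriv_on_diff fun_eq_iff plinear_diff[OF plinear_left_con] sum_subtractf)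

lemma dbar_on_add: "a \<in> smooth_fields U \<Longrightarrow> b \<in> smooth_fields U \<Longrightarrow> dbar_on U (a + b) = dbar_on U a + dbar_on U b"
  by (simp add: dbar_on_def deriv_on_add fun_eq_iff distrib_left sum.distrib)

lemma dbar_on_diff: "a \<in> smooth_fields U \<Longrightarrow> b \<in> smooth_fields U \<Longrightarrow> dbar_on U (a - b) = dbar_on U a - dbar_on U b"
  by (simp add: dbar_on_def deriv_on_diff fun_eq_iff right_diff_distrib sum_subtractf)

lemma dbar_on_uminus: "a \<in> smooth_fields U \<Longrightarrow> dbar_on U (- a) = - dbar_on U a"
  by (simp add: dbar_on_def deriv_on_uminus fun_eq_iff sum_negf)

lemma brkt_add_right: "b \<in> smooth_fields U \<Longrightarrow> c \<in> smooth_fields U \<Longrightarrow> brkt U a (b + c) = brkt U a b + brkt U a c"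
  by (simp add: brkt_def deriv_on_add fun_eq_iff left_con_linear distrib_left sum.distrib[symmetric] algebra_simps)

lemma brkt_add_left: "b \<in> smooth_fields U \<Longrightarrow> c \<in> smooth_fields U \<Longrightarrow> brkt U (b + c) a = brkt U b a + brkt U c a"
  by (simp add: brkt_def deriv_on_add fun_eq_iff plinear_add[OF plinear_right_con] distrib_right sum.distrib[symmetric] algebra_simps)

lemma brkt_uminus_right: "b \<in> smooth_fields U \<Longrightarrow> brkt U a (- b) = - brkt U a b"
  by (simp add: brkt_def deriv_on_uminus fun_eq_iff plinear_minus[OF plinear_left_con] sum_negf[symmetric])

lemma brkt_diff_right: "b \<in> smooth_fields U \<Longrightarrow> c \<in> smooth_fields U \<Longrightarrow> brkt U a (b - c) = brkt U a b - brkt U a c"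
  using brkt_add_right[of b "- c" a] brkt_uminus_right[of c a] fields_uminus[of c] by simp

lemma deriv_on_eps_on: "wirtinger_op P \<Longrightarrow> a \<in> smooth_fields U \<Longrightarrow> deriv_on U P (eps_on a) = eps_on (deriv_on U P a)"
  unfolding eps_on_def by (rule deriv_on_plinear[OF _ plinear_eps])

lemma eps_on_bv: "a \<in> smooth_fields U \<Longrightarrow> eps_on (bv U a) = - bv U (eps_on a)"
  by (simp add: bv_def deriv_on_eps_on fun_eq_iff) (simp add: eps_on_def plinear_sum[OF plinear_eps] eps_left_con sum_negf)

lemma eps_on_dbar_on: "a \<in> smooth_fields U \<Longrightarrow> eps_on (dbar_on U a) = - dbar_on U (eps_on a)"
  by (simp add: dbar_on_def deriv_on_eps_on fun_eq_iff) (simp add: eps_on_def plinear_sum[OF plinear_eps] eps_gen_mult sum_negf)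

text \<open>Contractions anticommute while derivatives commute, so exchanging the two summation
  indices turns the double sum into its own negative.\<close>

lemma bv_bv:
  assumes "a \<in> smooth_fields U" shows "bv U (bv U a) = 0"
proof
  fix z
  let ?t = "\<lambda>i j. left_con i (left_con j (deriv_on U (del i) (deriv_on U (del j) a) z))"
  have "deriv_on U (del i) (bv U a) = (\<lambda>z. \<Sum>j\<in>UNIV. left_con j (deriv_on U (del i) (deriv_on U (del j) a) z))" for i
    unfolding bv_def
    by (subst deriv_on_sum)
       (auto intro!: fields_plinear[OF plinear_left_con] fields_deriv_on assms simp: deriv_on_plinear[OF _ plinear_left_con] fields_deriv_on assms)
  then have 1: "bv U (bv U a) z = (\<Sum>i\<in>UNIV. \<Sum>j\<in>UNIV. ?t i j)"
    by (simp add: bv_def[of U "bv U a"] plinear_sum[OF plinear_left_con])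
  have neg: "?t i j = - ?t j i" for i j
    using left_con_anticommute[of i j] deriv_on_commute[of "del i" a j] assms by simp
  have "(\<Sum>i\<in>UNIV. \<Sum>j\<in>UNIV. ?t i j) = (\<Sum>i\<in>UNIV. \<Sum>j\<in>UNIV. - ?t j i)"
    by (rule sum.cong[OF refl], rule sum.cong[OF refl], rule neg)
  also have "\<dots> = - (\<Sum>i\<in>UNIV. \<Sum>j\<in>UNIV. ?t j i)"
    by (simp only: sum_negf)
  also have "(\<Sum>i\<in>UNIV. \<Sum>j\<in>UNIV. ?t j i) = (\<Sum>i\<in>UNIV. \<Sum>j\<in>UNIV. ?t i j)"
    by (rule sum.swap)
  finally have "bv U (bv U a) z = - bv U (bv U a) z" unfolding 1 .
  then show "bv U (bv U a) z = 0 z" using eq_neg_imp_0 by simp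
qed

text \<open>The derivatives commute, and a contraction anticommutes with multiplication by a
  generator \<open>eta i\<close>; the latter is the only source of the sign.\<close>

lemma dbar_on_bv:
  assumes "a \<in> smooth_fields U" shows "dbar_on U (bv U a) + bv U (dbar_on U a) = 0"
proof
  fix z
  let ?t = "\<lambda>i j. eta i * left_con j (deriv_on U (del j) (deriv_on U (delbar i) a) z)"
  have "deriv_on U (delbar i) (bv U a) = (\<lambda>z. \<Sum>j\<in>UNIV. left_con j (deriv_on U (delbar i) (deriv_on U (del j) a) z))" for i
    unfolding bv_def
    by (subst deriv_on_sum)
       (auto intro!: fields_plinear[OF plinear_left_con] fields_deriv_on assms simp: deriv_on_plinear[OF _ plinear_left_con] fields_deriv_on assms)
  then have 1: "dbar_on U (bv U a) z = (\<Sum>i\<in>UNIV. \<Sum>j\<in>UNIV. ?t i j)"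
    using assms by (simp add: dbar_on_def sum_distrib_left deriv_on_commute)
  have "deriv_on U (del j) (dbar_on U a) = (\<lambda>z. \<Sum>i\<in>UNIV. eta i * deriv_on U (del j) (deriv_on U (delbar i) a) z)" for j
    unfolding dbar_on_def
    by (subst deriv_on_sum)
       (auto intro!: fields_plinear[OF plinear_mult_left] fields_deriv_on assms simp: deriv_on_plinear[OF _ plinear_mult_left] fields_deriv_on assms)
  then have "bv U (dbar_on U a) z = (\<Sum>j\<in>UNIV. \<Sum>i\<in>UNIV. - ?t i j)"
    by (simp add: bv_def plinear_sum[OF plinear_left_con] left_con_eta_mult)
  also have "\<dots> = (\<Sum>i\<in>UNIV. \<Sum>j\<in>UNIV. - ?t i j)" by (rule sum.swap)
  finally show "(dbar_on U (bv U a) + bv U (dbar_on U a)) z = 0 z"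
    using 1 by (simp add: sum_negf)
qed

lemma dbar_on_mult:
  assumes "a \<in> smooth_fields U" "b \<in> smooth_fields U"
  shows "dbar_on U (a * b) = dbar_on U a * b + eps_on a * dbar_on U b"
proof
  fix z
  have "eta i * (x * y) = eps x * (eta i * y)" for i :: 'n and x y
    using mult_gen(1)[of "eps x" i] by (simp add: mult.assoc[symmetric])
  then show "dbar_on U (a * b) z = (dbar_on U a * b + eps_on a * dbar_on U b) z"
    by (simp add: dbar_on_def deriv_on_mult[OF _ assms] eps_on_def distrib_left sum.distrib sum_distrib_left sum_distrib_right mult.assoc)
qed

text \<open>The contraction and the derivative hit either the same factor or different ones. The sum
  collects the mixed terms, the failure of \<open>bv\<close> to be a derivation; up to sign it is
  the bracket.\<close>

lemma bv_mult:
  assumes "a \<in> smooth_fields U" "b \<in> smooth_fields U"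
  shows "bv U (a * b) z = bv U a z * b z + eps (a z) * bv U b z +
     (\<Sum>i\<in>UNIV. left_con i (a z) * deriv_on U (del i) b z + eps (deriv_on U (del i) a z) * left_con i (b z))"
  by (simp add: bv_def deriv_on_mult[OF _ assms] plinear_add[OF plinear_left_con] left_con_mult sum.distrib sum_distrib_left
      sum_distrib_right algebra_simps)

lemma even_fieldD: "even_field U a \<Longrightarrow> a \<in> smooth_fields U" "even_field U a \<Longrightarrow> eps (a z) = a z" "even_field U a \<Longrightarrow> eps_on a = a"
  by (auto simp: even_field_def eps_on_def fun_eq_iff)

lemma odd_fieldD: "odd_field U a \<Longrightarrow> a \<in> smooth_fields U" "odd_field U a \<Longrightarrow> eps (a z) = - a z" "odd_field U a \<Longrightarrow> eps_on a = - a"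
  by (auto simp: odd_field_def eps_on_def fun_eq_iff)

lemma deriv_on_parity:
  assumes "wirtinger_op P"
  shows "even_field U a \<Longrightarrow> even_field U (deriv_on U P a)" "odd_field U a \<Longrightarrow> odd_field U (deriv_on U P a)"
  using assms deriv_on_eps_on[OF assms, of a]
  by (auto simp: even_field_def odd_field_def fields_deriv_on deriv_on_uminus)

lemma bv_parity:
  shows "even_field U a \<Longrightarrow> odd_field U (bv U a)" "odd_field U a \<Longrightarrow> even_field U (bv U a)"
  using eps_on_bv[of a]
  by (auto simp: even_field_def odd_field_def fields_bv bv_uminus)

text \<open>For even \<open>a\<close> the right contraction is minus the left one and the
  derivatives of \<open>a\<close> are even, so the bracket is minus the mixed terms of
  \<open>bv_mult\<close>.\<close>

lemma brkt_even:
  assumes a: "even_field U a" and b: "b \<in> smooth_fields U"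
  shows "brkt U a b = bv U a * b + a * bv U b - bv U (a * b)"
proof
  fix z
  have "brkt U a b z = - (\<Sum>i\<in>UNIV. left_con i (a z) * deriv_on U (del i) b z + eps (deriv_on U (del i) a z) * left_con i (b z))"
    unfolding brkt_def using even_fieldD[OF a] even_fieldD(2)[OF deriv_on_parity(1)[OF _ a]]
    by (simp add: right_con_eq eps_left_con sum_negf[symmetric])
  then show "brkt U a b z = (bv U a * b + a * bv U b - bv U (a * b)) z"
    using bv_mult[OF even_fieldD(1)[OF a] b, of z] even_fieldD[OF a] by simp
qed

text \<open>For odd \<open>a\<close> the two contractions agree and \<open>eps\<close> negates the
  derivatives of \<open>a\<close>, so the bracket equals the mixed terms of \<open>bv_mult\<close>.
  The sign of the last term comes from \<open>eps (a z) = - a z\<close>.\<close>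

lemma brkt_odd:
  assumes a: "odd_field U a" and b: "b \<in> smooth_fields U"
  shows "brkt U a b = bv U (a * b) - bv U a * b + a * bv U b"
proof
  fix z
  have "brkt U a b z = (\<Sum>i\<in>UNIV. left_con i (a z) * deriv_on U (del i) b z + eps (deriv_on U (del i) a z) * left_con i (b z))"
    unfolding brkt_def using odd_fieldD[OF a] odd_fieldD(2)[OF deriv_on_parity(2)[OF _ a]]
    by (simp add: right_con_eq eps_left_con plinear_minus[OF plinear_left_con])
  then show "brkt U a b z = (bv U (a * b) - bv U a * b + a * bv U b) z"
    using bv_mult[OF odd_fieldD(1)[OF a] b, of z] odd_fieldD[OF a] by simp
qed

text \<open>Even parity means odd degree p + q - 1 in the graded Lie algebra, where graded
  antisymmetry is symmetry. Here it follows from \<open>brkt_even\<close>, whose right-hand side is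
  symmetric because even elements commute with everything.\<close>

lemma brkt_symmetric:
  assumes "even_field U a" "even_field U b" shows "brkt U a b = brkt U b a"
proof -
  have c: "a * x = x * a" "b * x = x * b" for x
    by (intro ext, simp only: times_fun_apply, rule even_commute, rule even_fieldD(2), rule assms)+
  show ?thesis
    unfolding brkt_even[OF assms(1) even_fieldD(1)[OF assms(2)]] brkt_even[OF assms(2) even_fieldD(1)[OF assms(1)]]
    using c(1)[of b] c(1)[of "bv U b"] c(2)[of "bv U a"] by simp
qed

text \<open>The bracket shifts parity by one, so bracketing with an even field is an odd derivation
  of the product and passes \<open>b\<close> with the sign in \<open>eps_on\<close>.\<close>

lemma brkt_mult_even:
  assumes a: "even_field U a" and b: "b \<in> smooth_fields U" and c: "c \<in> smooth_fields U"
  shows "brkt U a (b * c) = brkt U a b * c + eps_on b * brkt U a c"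
proof
  fix z
  have "eps (right_con i (a z)) = - right_con i (a z)" for i
    using even_fieldD(2)[OF a] eps_left_con[of i "a z"] by (simp add: right_con_eq plinear_minus[OF plinear_eps])
  then have 1: "right_con i (a z) * (b z * x) = eps (b z) * (right_con i (a z) * x)" for i x
    using odd_commute[of "right_con i (a z)" "b z"] by (simp add: mult.assoc[symmetric])
  have 2: "deriv_on U (del i) a z * (eps (b z) * x) = eps (b z) * (deriv_on U (del i) a z * x)" for i x
    using even_commute[OF even_fieldD(2)[OF deriv_on_parity(1)[OF _ a]], of "del i" z "eps (b z)"] by (simp add: mult.assoc[symmetric])
  show "brkt U a (b * c) z = (brkt U a b * c + eps_on b * brkt U a c) z"
    by (simp add: brkt_def deriv_on_mult[OF _ b c] eps_on_def distrib_left left_con_mult sum_distrib_left sum_distrib_right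
        sum.distrib[symmetric] left_diff_distrib right_diff_distrib mult.assoc 1 2) (simp add: algebra_simps)
qed

text \<open>Bracketing with an odd field preserves parity, hence there is no sign. In the Jacobi
  identity this is applied to the odd field \<open>bv U c\<close>.\<close>

lemma brkt_mult_odd:
  assumes a: "odd_field U a" and b: "b \<in> smooth_fields U" and c: "c \<in> smooth_fields U"
  shows "brkt U a (b * c) = brkt U a b * c + b * brkt U a c"
proof
  fix z
  have "eps (right_con i (a z)) = right_con i (a z)" for i
    using odd_fieldD(2)[OF a] eps_left_con[of i "a z"] by (simp add: right_con_eq plinear_minus[OF plinear_eps] plinear_minus[OF plinear_left_con])
  then have 1: "right_con i (a z) * (b z * x) = b z * (right_con i (a z) * x)" for i x
    using even_commute[of "right_con i (a z)" "b z"] by (simp add: mult.assoc[symmetric])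
  have 2: "deriv_on U (del i) a z * (eps (b z) * x) = b z * (deriv_on U (del i) a z * x)" for i x
    using odd_commute[OF odd_fieldD(2)[OF deriv_on_parity(2)[OF _ a]], of "del i" z "eps (b z)"] by (simp add: mult.assoc[symmetric])
  show "brkt U a (b * c) z = (brkt U a b * c + b * brkt U a c) z"
    by (simp add: brkt_def deriv_on_mult[OF _ b c] distrib_left left_con_mult sum_distrib_left sum_distrib_right
        sum.distrib[symmetric] left_diff_distrib right_diff_distrib mult.assoc 1 2) (simp add: algebra_simps)
qed

lemma eps_on_brkt_even:
  assumes a: "even_field U a" and b: "b \<in> smooth_fields U"
  shows "eps_on (brkt U a b) = - brkt U a (eps_on b)"
proof -
  note mem = even_fieldD(1)[OF a] b fields_bv fields_eps_on fields_mult
  show ?thesis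
    unfolding brkt_even[OF a b] brkt_even[OF a fields_eps_on[OF b]]
    using eps_on_bv[of a] eps_on_bv[of b] eps_on_bv[of "a * b"] even_fieldD(3)[OF a] mem
    by (simp add: plinear_def eps_on_mult flip: ) (simp add: eps_on_def fun_eq_iff plinear_add[OF plinear_eps] plinear_diff[OF plinear_eps] eps_mult)
qed

text \<open>The two instances of \<open>Q\<close> are the Dolbeault operator and the bracket with an even field.\<close>

lemma odd_derivation_brkt:
  assumes Q: "\<And>a. a \<in> smooth_fields U \<Longrightarrow> Q a \<in> smooth_fields U"
    "\<And>a b. a \<in> smooth_fields U \<Longrightarrow> b \<in> smooth_fields U \<Longrightarrow> Q (a + b) = Q a + Q b"
    "\<And>a b. a \<in> smooth_fields U \<Longrightarrow> b \<in> smooth_fields U \<Longrightarrow> Q (a - b) = Q a - Q b"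
    "\<And>a b. a \<in> smooth_fields U \<Longrightarrow> b \<in> smooth_fields U \<Longrightarrow> Q (a * b) = Q a * b + eps_on a * Q b"
    "\<And>a. a \<in> smooth_fields U \<Longrightarrow> eps_on (Q a) = - Q (eps_on a)"
    "\<And>a. a \<in> smooth_fields U \<Longrightarrow> Q (- a) = - Q a"
    and P: "\<And>a. a \<in> smooth_fields U \<Longrightarrow> Q (bv U a) = P a - bv U (Q a)"
    "\<And>a b. a \<in> smooth_fields U \<Longrightarrow> b \<in> smooth_fields U \<Longrightarrow> P (a * b) = P a * b + a * P b"
    and b: "b \<in> smooth_fields U"
  shows "even_field U a \<Longrightarrow> Q (brkt U a b) = brkt U (Q a) b - brkt U a (Q b)"
    and "odd_field U a \<Longrightarrow> Q (brkt U a b) = brkt U (Q a) b + brkt U a (Q b)"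
proof -
  note mem = b fields_bv fields_mult fields_add fields_diff Q(1)
  show "Q (brkt U a b) = brkt U (Q a) b - brkt U a (Q b)" if a: "even_field U a"
  proof -
    have a': "a \<in> smooth_fields U" "eps_on a = a" "odd_field U (Q a)" "odd_field U (bv U a)"
      using even_fieldD[OF a] bv_parity(1)[OF a] Q(1,5)[of a] by (auto simp: odd_field_def)
    \<comment> \<open>\<open>P\<close> is the anticommutator of \<open>Q\<close> with
      \<open>bv\<close>. Once the brackets are written through \<open>bv\<close>, its contributions
      cancel by the derivation rule for \<open>P\<close>, and what remains are the expressions of
      \<open>brkt_odd\<close> for \<open>Q a\<close> and of \<open>brkt_even\<close> for
      \<open>a\<close>.\<close>
    show ?thesis
      unfolding brkt_even[OF a b] brkt_odd[OF a'(3) b] brkt_even[OF a Q(1)[OF b]]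
      using a' odd_fieldD(3)[OF a'(4)]
      by (simp add: mem Q P bv_add algebra_simps)
  qed
  show "Q (brkt U a b) = brkt U (Q a) b + brkt U a (Q b)" if a: "odd_field U a"
  proof -
    have a': "a \<in> smooth_fields U" "eps_on a = - a" "even_field U (Q a)" "even_field U (bv U a)"
      using odd_fieldD[OF a] bv_parity(2)[OF a] Q(1,5,6)[of a] by (auto simp: even_field_def)
    show ?thesis
      unfolding brkt_odd[OF a b] brkt_even[OF a'(3) b] brkt_odd[OF a Q(1)[OF b]]
      using a' even_fieldD(3)[OF a'(4)]
      by (simp add: mem Q P bv_add bv_diff algebra_simps)
  qed
qed

text \<open>Since \<open>bv\<close> anticommutes with the Dolbeault operator, the derivation
  \<open>P\<close> of \<open>odd_derivation_brkt\<close> is 0 here.\<close>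

lemma dbar_on_brkt:
  assumes "b \<in> smooth_fields U"
  shows "even_field U a \<Longrightarrow> dbar_on U (brkt U a b) = brkt U (dbar_on U a) b - brkt U a (dbar_on U b)"
    and "odd_field U a \<Longrightarrow> dbar_on U (brkt U a b) = brkt U (dbar_on U a) b + brkt U a (dbar_on U b)"
proof -
  have P: "dbar_on U (bv U a) = 0 - bv U (dbar_on U a)" if "a \<in> smooth_fields U" for a
    using dbar_on_bv[OF that] by (simp add: eq_neg_iff_add_eq_0)
  note D = odd_derivation_brkt[of "dbar_on U" "\<lambda>a. 0", OF fields_dbar_on dbar_on_add dbar_on_diff dbar_on_mult eps_on_dbar_on dbar_on_uminus P _ assms]
  show "even_field U a \<Longrightarrow> dbar_on U (brkt U a b) = brkt U (dbar_on U a) b - brkt U a (dbar_on U b)"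
    by (rule D(1)) auto
  show "odd_field U a \<Longrightarrow> dbar_on U (brkt U a b) = brkt U (dbar_on U a) b + brkt U a (dbar_on U b)"
    by (rule D(2)) auto
qed

text \<open>Expanding every bracket through \<open>bv\<close> leaves only terms that cancel or
  contain \<open>bv\<close> applied twice. Thus the anticommutator of \<open>bv\<close> and the
  bracket with \<open>c\<close> is the bracket with \<open>bv U c\<close>, which supplies the
  derivation \<open>P\<close> for the Jacobi identity.\<close>

lemma brkt_bv:
  assumes c: "even_field U c" and a: "a \<in> smooth_fields U"
  shows "brkt U c (bv U a) = brkt U (bv U c) a - bv U (brkt U c a)"
proof -
  note mem = even_fieldD(1)[OF c] a fields_bv fields_mult fields_add fields_diff
  show ?thesis
    unfolding brkt_even[OF c a] brkt_odd[OF bv_parity(1)[OF c] a] brkt_even[OF c fields_bv[OF a]]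
    by (simp add: mem bv_add bv_diff bv_bv)
qed

text \<open>In this form the graded Jacobi identity says that the bracket with \<open>c\<close> is
  an odd derivation of the bracket. The even field \<open>c\<close> will be the local form of
  Lambda_0.\<close>

lemma brkt_jacobi:
  assumes c: "even_field U c" and b: "b \<in> smooth_fields U"
  shows "even_field U a \<Longrightarrow> brkt U c (brkt U a b) = brkt U (brkt U c a) b - brkt U a (brkt U c b)"
    and "odd_field U a \<Longrightarrow> brkt U c (brkt U a b) = brkt U (brkt U c a) b + brkt U a (brkt U c b)"
proof -
  note c' = even_fieldD(1)[OF c]
  note D = odd_derivation_brkt[of "brkt U c" "brkt U (bv U c)", OF fields_brkt[OF c'] brkt_add_right brkt_diff_right
     brkt_mult_even[OF c] eps_on_brkt_even[OF c] brkt_uminus_right brkt_bv[OF c] brkt_mult_odd[OF bv_parity(1)[OF c]] b]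
  show "even_field U a \<Longrightarrow> brkt U c (brkt U a b) = brkt U (brkt U c a) b - brkt U a (brkt U c b)"
    by (rule D(1)) auto
  show "odd_field U a \<Longrightarrow> brkt U c (brkt U a b) = brkt U (brkt U c a) b + brkt U a (brkt U c b)"
    by (rule D(2)) auto
qed

end

section \<open>Changes of coordinates\<close>

lemma plinear_eqI:
  assumes "plinear h" "plinear h'" "\<And>I J. h (monomial I J) = h' (monomial I J)"
  shows "h a = h' a"
  by (subst (1 2) polyform_expand[of a]) (simp add: plinear_sum plinear_scl assms)

definition gprod :: "('n::{finite,linorder} \<Rightarrow> 'n polyform) \<Rightarrow> 'n set \<Rightarrow> 'n polyform" where
  "gprod x I = foldr (*) (map x (sorted_list_of_set I)) 1"

lemma gprod_empty [simp]: "gprod x {} = 1"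
  by (simp add: gprod_def)

lemma gprod_insert:
  assumes "\<forall>j\<in>I. i < j" shows "gprod x (insert i I) = x i * gprod x I"
proof -
  have "i \<notin> I" using assms by force
  then have "sorted_list_of_set (insert i I) = i # sorted_list_of_set I"
    using assms by (simp add: sorted_list_of_set_insert insort_is_Cons less_imp_le)
  then show ?thesis by (simp add: gprod_def)
qed

text \<open>The rule for multiplying an ordered monomial by a generator depends only on
  anticommutation and vanishing squares. The images of the generators under a linear substitution
  share these properties, hence obey the same rule.\<close>

lemma gen_gprod:
  fixes x :: "'n::{finite,linorder} \<Rightarrow> 'n polyform"
  assumes anti: "\<And>i j a. x i * (x j * a) = - (x j * (x i * a))" and sq: "\<And>i a. x i * (x i * a) = 0"
  shows "x i * gprod x I = (if i \<in> I then 0 else scl ((-1) ^ below i I) (gprod x (insert i I)))"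
proof (induction I rule: finite_linorder_min_induct[OF finite])
  case 1
  then show ?case using gprod_insert[of "{}" i x] by (simp add: below_def)
next
  case (2 m I)
  note less = \<open>\<forall>a\<in>I. m < a\<close> and IH = "2.IH"
  have m: "m \<notin> I" using less by force
  consider (eq) "i = m" | (lt) "i < m" | (gt) "m < i" by force
  then show ?case
  proof cases
    case eq
    then show ?thesis using less by (simp add: gprod_insert sq)
  next
    case lt
    then have l: "\<forall>j\<in>insert m I. i < j" using less by force
    then have "below i (insert m I) = 0" "i \<notin> insert m I" by (force simp: below_def)+
    then show ?thesis using gprod_insert[OF l, of x] by simp
  next
    case gt
    then have l: "\<forall>j\<in>insert i I. m < j" using less by force
    have b: "below i (insert m I) = Suc (below i I)" using below_simps(3)[OF m gt] .
    have "x i * gprod x (insert m I) = - (x m * (x i * gprod x I))"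
      by (simp only: gprod_insert[OF less] anti[of i m])
    also have "\<dots> = (if i \<in> I then 0 else scl ((-1) ^ below i (insert m I)) (x m * gprod x (insert i I)))"
      unfolding IH b by (simp add: scl_distrib)
    finally show ?thesis using gt gprod_insert[OF l, of x] by (auto simp: insert_commute)
  qed
qed

section \<open>Linear substitutions of the generators\<close>

definition eta_comb :: "('n::{finite,linorder} \<Rightarrow> complex) \<Rightarrow> 'n polyform" where
  "eta_comb q = (\<Sum>k\<in>UNIV. scl (q k) (eta k))"

definition xi_comb :: "('n::{finite,linorder} \<Rightarrow> complex) \<Rightarrow> 'n polyform" where
  "xi_comb p = (\<Sum>k\<in>UNIV. scl (p k) (xi k))"

lemma eta_comb_mult: "eta_comb q * a = (\<Sum>k\<in>UNIV. scl (q k) (eta k * a))"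
  by (simp add: eta_comb_def sum_distrib_right)

lemma xi_comb_mult: "xi_comb p * a = (\<Sum>k\<in>UNIV. scl (p k) (xi k * a))"
  by (simp add: xi_comb_def sum_distrib_right)

lemma eta_comb_anticommute:
  "eta_comb q * (eta_comb q' * a) = - (eta_comb q' * (eta_comb q * a))"
  "xi_comb p * (xi_comb p' * a) = - (xi_comb p' * (xi_comb p * a))"
  "xi_comb p * (eta_comb q * a) = - (eta_comb q * (xi_comb p * a))"
proof -
  have e1: "eta_comb q * (eta_comb q' * a) = (\<Sum>l\<in>UNIV. \<Sum>k\<in>UNIV. scl (q' l * q k) (eta k * (eta l * a)))" for q q'
    by (simp add: eta_comb_mult xi_comb_mult sum_distrib_left scl_sum)
  have e2: "eta_comb q' * (eta_comb q * a) = (\<Sum>k\<in>UNIV. \<Sum>l\<in>UNIV. scl (q k * q' l) (eta l * (eta k * a)))" for q q'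
    by (simp add: eta_comb_mult xi_comb_mult sum_distrib_left scl_sum)
  have "(\<Sum>l\<in>UNIV. \<Sum>k\<in>UNIV. scl (q' l * q k) (eta k * (eta l * a)))
      = (\<Sum>l\<in>UNIV. \<Sum>k\<in>UNIV. - scl (q k * q' l) (eta l * (eta k * a)))"
    by (intro sum.cong refl, subst gen_anticommute(1)) (simp only: scl_distrib mult.commute)
  also have "\<dots> = (\<Sum>k\<in>UNIV. \<Sum>l\<in>UNIV. - scl (q k * q' l) (eta l * (eta k * a)))" by (rule sum.swap)
  finally show "eta_comb q * (eta_comb q' * a) = - (eta_comb q' * (eta_comb q * a))"
    unfolding e1 e2 by (simp only: sum_negf)
  have e1: "xi_comb q * (xi_comb q' * a) = (\<Sum>l\<in>UNIV. \<Sum>k\<in>UNIV. scl (q' l * q k) (xi k * (xi l * a)))" for q q'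
    by (simp add: eta_comb_mult xi_comb_mult sum_distrib_left scl_sum)
  have e2: "xi_comb q' * (xi_comb q * a) = (\<Sum>k\<in>UNIV. \<Sum>l\<in>UNIV. scl (q k * q' l) (xi l * (xi k * a)))" for q q'
    by (simp add: eta_comb_mult xi_comb_mult sum_distrib_left scl_sum)
  have "(\<Sum>l\<in>UNIV. \<Sum>k\<in>UNIV. scl (p' l * p k) (xi k * (xi l * a)))
      = (\<Sum>l\<in>UNIV. \<Sum>k\<in>UNIV. - scl (p k * p' l) (xi l * (xi k * a)))"
    by (intro sum.cong refl, subst gen_anticommute(2)) (simp only: scl_distrib mult.commute)
  also have "\<dots> = (\<Sum>k\<in>UNIV. \<Sum>l\<in>UNIV. - scl (p k * p' l) (xi l * (xi k * a)))" by (rule sum.swap)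
  finally show "xi_comb p * (xi_comb p' * a) = - (xi_comb p' * (xi_comb p * a))"
    unfolding e1 e2 by (simp only: sum_negf)
  have e1: "xi_comb q * (eta_comb q' * a) = (\<Sum>l\<in>UNIV. \<Sum>k\<in>UNIV. scl (q' l * q k) (xi k * (eta l * a)))" for q q'
    by (simp add: eta_comb_mult xi_comb_mult sum_distrib_left scl_sum)
  have e2: "eta_comb q' * (xi_comb q * a) = (\<Sum>k\<in>UNIV. \<Sum>l\<in>UNIV. scl (q k * q' l) (eta l * (xi k * a)))" for q q'
    by (simp add: eta_comb_mult xi_comb_mult sum_distrib_left scl_sum)
  have "(\<Sum>l\<in>UNIV. \<Sum>k\<in>UNIV. scl (q l * p k) (xi k * (eta l * a)))
      = (\<Sum>l\<in>UNIV. \<Sum>k\<in>UNIV. - scl (p k * q l) (eta l * (xi k * a)))"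
    by (intro sum.cong refl, subst gen_anticommute(3)) (simp only: scl_distrib mult.commute minus_minus)
  also have "\<dots> = (\<Sum>k\<in>UNIV. \<Sum>l\<in>UNIV. - scl (p k * q l) (eta l * (xi k * a)))" by (rule sum.swap)
  finally show "xi_comb p * (eta_comb q * a) = - (eta_comb q * (xi_comb p * a))"
    unfolding e1 e2 by (simp only: sum_negf)
qed

lemma eta_comb_square: "eta_comb q * (eta_comb q * a) = 0" "xi_comb p * (xi_comb p * a) = 0"
  using eta_comb_anticommute(1)[of q q a] eta_comb_anticommute(2)[of p p a] by (auto intro: eq_neg_imp_0)

lemma eps_eta_comb_mult: "eps (eta_comb q * a) = - (eta_comb q * eps a)" "eps (xi_comb p * a) = - (xi_comb p * eps a)"
  by (simp_all add: eta_comb_mult xi_comb_mult plinear_sum[OF plinear_eps] eps_linear eps_gen_mult scl_distrib sum_negf)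

lemma left_con_eta_comb_mult: "left_con k (eta_comb q * a) = - (eta_comb q * left_con k a)"
  "left_con k (xi_comb p * a) = scl (p k) a - xi_comb p * left_con k a"
proof -
  show "left_con k (eta_comb q * a) = - (eta_comb q * left_con k a)"
    by (simp add: eta_comb_mult plinear_sum[OF plinear_left_con] left_con_linear left_con_eta_mult scl_distrib sum_negf)
  have "scl (p l) (if k = l then a else 0) = (if l = k then scl (p l) a else 0)" for l by auto
  then show "left_con k (xi_comb p * a) = scl (p k) a - xi_comb p * left_con k a"
    by (simp add: xi_comb_mult plinear_sum[OF plinear_left_con] left_con_linear left_con_xi_mult scl_distrib sum_subtractf)
qed

text \<open>The algebra homomorphism that sends the generators \<open>eta i\<close> and
  \<open>xi j\<close> to the combinations with coefficients \<open>q i\<close> and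
  \<open>p j\<close>. It is defined by linear extension from ordered monomials, because
  \<open>change_chart\<close> has this shape; multiplicativity is proved afterwards.\<close>

definition subst_hom :: "('n \<Rightarrow> 'n \<Rightarrow> complex) \<Rightarrow> ('n \<Rightarrow> 'n \<Rightarrow> complex) \<Rightarrow> 'n::{finite,linorder} polyform \<Rightarrow> 'n polyform" where
  "subst_hom q p a = (\<Sum>I\<in>UNIV. \<Sum>J\<in>UNIV. scl (coeff a I J) (gprod (\<lambda>i. eta_comb (q i)) I * gprod (\<lambda>j. xi_comb (p j)) J))"

lemma plinear_subst_hom: "plinear (subst_hom q p)"
  by (simp add: plinear_def subst_hom_def scl_distrib sum.distrib scl_sum)

lemma subst_hom_monomial:
  "subst_hom q p (monomial I J) = gprod (\<lambda>i. eta_comb (q i)) I * gprod (\<lambda>j. xi_comb (p j)) J"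
proof -
  have "subst_hom q p (monomial I J) = (\<Sum>I'\<in>UNIV. \<Sum>J'\<in>UNIV. if J' = J then if I' = I then
      gprod (\<lambda>i. eta_comb (q i)) I * gprod (\<lambda>j. xi_comb (p j)) J else 0 else 0)"
    unfolding subst_hom_def by (intro sum.cong refl) (simp add: coeff_monomial)
  then show ?thesis by simp
qed

lemma subst_hom_one [simp]: "subst_hom q p 1 = 1"
  using subst_hom_monomial[of q p "{}" "{}"] by simp

lemma eta_monomial: "eta i * monomial I J = (if i \<in> I then 0 else scl ((-1) ^ below i I) (monomial (insert i I) J))"
proof (rule polyform_eqI)
  fix K L
  have "below i K = below i I" if "K - {i} = I" using that below_simps(2)[of i i K] by auto
  then show "coeff (eta i * monomial I J) K L
      = coeff (if i \<in> I then 0 else scl ((-1) ^ below i I) (monomial (insert i I) J)) K L"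
    by (cases "i \<in> K") (auto simp: coeff_eta_mult coeff_monomial)
qed

lemma xi_monomial: "xi i * monomial I J =
  (if i \<in> J then 0 else scl ((-1) ^ (card I + below i J)) (monomial I (insert i J)))"
proof (rule polyform_eqI)
  fix K L
  have "below i L = below i J" if "L - {i} = J" using that below_simps(2)[of i i L] by auto
  then show "coeff (xi i * monomial I J) K L
      = coeff (if i \<in> J then 0 else scl ((-1) ^ (card I + below i J)) (monomial I (insert i J))) K L"
    by (cases "i \<in> L") (auto simp: coeff_xi_mult coeff_monomial)
qed

lemma xi_comb_gprod_eta_comb: "xi_comb p * (gprod (\<lambda>i. eta_comb (q i)) I * a) = scl ((-1) ^ card I) (gprod (\<lambda>i. eta_comb (q i)) I * (xi_comb p * a))"
proof (induction I rule: finite_linorder_min_induct[OF finite])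
  case (2 m I)
  then have "m \<notin> I" by force
  with 2 show ?case by (simp add: gprod_insert mult.assoc eta_comb_anticommute(3) scl_distrib)
qed simp

text \<open>On monomials both sides obey the same insertion rule with the same sign, by
  \<open>eta_monomial\<close> and \<open>gen_gprod\<close>.\<close>

lemma subst_hom_eta: "subst_hom q p (eta i * a) = eta_comb (q i) * subst_hom q p a"
proof (rule plinear_eqI[where h="\<lambda>a. subst_hom q p (eta i * a)"])
  show "subst_hom q p (eta i * monomial I J) = eta_comb (q i) * subst_hom q p (monomial I J)" for I J
    using gen_gprod[of "\<lambda>i. eta_comb (q i)" i I, OF eta_comb_anticommute(1) eta_comb_square(1)]
    by (simp add: eta_monomial plinear_0[OF plinear_subst_hom] plinear_scl[OF plinear_subst_hom] subst_hom_monomial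
        mult.assoc[symmetric])
qed (simp_all add: plinear_def distrib_left plinear_add[OF plinear_subst_hom] plinear_scl[OF plinear_subst_hom])

lemma subst_hom_xi: "subst_hom q p (xi i * a) = xi_comb (p i) * subst_hom q p a"
proof (rule plinear_eqI[where h="\<lambda>a. subst_hom q p (xi i * a)"])
  show "subst_hom q p (xi i * monomial I J) = xi_comb (p i) * subst_hom q p (monomial I J)" for I J
    using gen_gprod[of "\<lambda>i. xi_comb (p i)" i J, OF eta_comb_anticommute(2) eta_comb_square(2)]
    by (simp add: xi_monomial plinear_0[OF plinear_subst_hom] plinear_scl[OF plinear_subst_hom] subst_hom_monomial
        xi_comb_gprod_eta_comb power_add)
qed (simp_all add: plinear_def distrib_left plinear_add[OF plinear_subst_hom] plinear_scl[OF plinear_subst_hom])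

lemma subst_hom_mult: "subst_hom q p (a * b) = subst_hom q p a * subst_hom q p b"
  by (induction a rule: polyform_induct)
     (simp_all add: subst_hom_eta subst_hom_xi mult.assoc plinear_add[OF plinear_subst_hom] plinear_scl[OF plinear_subst_hom]
        distrib_right)

lemma subst_hom_eps: "eps (subst_hom q p a) = subst_hom q p (eps a)"
  by (induction a rule: polyform_induct)
     (simp_all add: subst_hom_eta subst_hom_xi plinear_add[OF plinear_subst_hom] plinear_scl[OF plinear_subst_hom]
       eps_linear eps_gen_mult eps_eta_comb_mult plinear_minus[OF plinear_subst_hom])

lemma sum_if_delta: "(\<Sum>j\<in>UNIV. scl (f j) (if j = m then a else 0)) = scl (f m) (a :: 'n::{finite,linorder} polyform)"
  for m :: "'m::finite"
proof -
  have "scl (f j) (if j = m then a else 0) = (if j = m then scl (f j) a else 0)" for j by auto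
  then show ?thesis by simp
qed

text \<open>The chain rule in the odd variables: each image of \<open>xi j\<close> is linear in the
  new generators, so its contraction by k is the constant \<open>p j k\<close>.\<close>

lemma left_con_subst_hom: "left_con k (subst_hom q p a) = (\<Sum>j\<in>UNIV. scl (p j k) (subst_hom q p (left_con j a)))"
proof (induction a rule: polyform_induct)
  case one
  then show ?case by (simp add: plinear_0[OF plinear_subst_hom])
next
  case (eta i a)
  then show ?case
    by (simp add: subst_hom_eta left_con_eta_comb_mult left_con_eta_mult plinear_minus[OF plinear_subst_hom] scl_distrib sum_negf sum_distrib_left)
next
  case (xi i a)
  have e: "subst_hom q p (if j = i then a else 0) = (if j = i then subst_hom q p a else 0)" for j
    by (simp add: plinear_0[OF plinear_subst_hom])
  show ?case using xi
    by (simp add: subst_hom_xi left_con_eta_comb_mult left_con_xi_mult plinear_diff[OF plinear_subst_hom] scl_distrib sum_subtractf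
        sum_distrib_left e sum_if_delta)
next
  case (add a b)
  then show ?case by (simp add: plinear_add[OF plinear_subst_hom] left_con_linear scl_distrib sum.distrib)
next
  case (scl c a)
  then show ?case by (simp add: plinear_scl[OF plinear_subst_hom] left_con_linear scl_sum mult.commute)
qed

lemma right_con_subst_hom: "right_con k (subst_hom q p a) = (\<Sum>j\<in>UNIV. scl (p j k) (subst_hom q p (right_con j a)))"
  by (simp add: right_con_eq left_con_subst_hom plinear_sum[OF plinear_eps] eps_linear subst_hom_eps)

section \<open>Derivatives of a varying substitution\<close>

lemma pdel_eta_comb:
  assumes "\<And>k. (\<lambda>w. q w k) differentiable (at z)"
  shows "pdiff (\<lambda>w. eta_comb (q w)) z" "pdel i (\<lambda>w. eta_comb (q w)) z = eta_comb (\<lambda>k. del i (\<lambda>w. q w k) z)"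
    "pdiff (\<lambda>w. xi_comb (q w)) z" "pdel i (\<lambda>w. xi_comb (q w)) z = xi_comb (\<lambda>k. del i (\<lambda>w. q w k) z)"
  unfolding eta_comb_def xi_comb_def by (simp_all add: pder_sum pder_scl assms)

text \<open>Differentiating a product of images replaces one image of a generator
  \<open>xi j\<close> at a time by its derivative, and \<open>left_con j\<close> finds the place.
  The images of the \<open>eta\<close> contribute nothing because the derivatives
  \<open>del i\<close> of their coefficients vanish at z.\<close>

lemma pdel_subst_hom_const:
  assumes q: "\<And>j k. (\<lambda>w. q w j k) differentiable (at z)" "\<And>i j k. del i (\<lambda>w. q w j k) z = 0"
    and p: "\<And>j k. (\<lambda>w. p w j k) differentiable (at z)"
  shows "pdiff (\<lambda>w. subst_hom (q w) (p w) a) z \<and> pdel i (\<lambda>w. subst_hom (q w) (p w) a) z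
    = (\<Sum>j\<in>UNIV. xi_comb (\<lambda>k. del i (\<lambda>w. p w j k) z) * subst_hom (q z) (p z) (left_con j a))"
proof (induction a rule: polyform_induct)
  case one
  then show ?case by (simp add: plinear_0[OF plinear_subst_hom])
next
  case (eta m a)
  have z: "eta_comb (\<lambda>k. 0) = (0 :: 'a polyform)" by (simp add: eta_comb_def)
  show ?case using eta q p
    by (simp add: subst_hom_eta pder_mult pdel_eta_comb z left_con_eta_mult plinear_minus[OF plinear_subst_hom] sum_negf
        sum_distrib_left eta_comb_anticommute(3))
next
  case (xi m a)
  have e: "x * subst_hom (q z) (p z) (if j = m then a else 0) = (if j = m then x * subst_hom (q z) (p z) a else 0)" for x j
    by (simp add: plinear_0[OF plinear_subst_hom])
  have c: "xi_comb x * (xi_comb (p z m) * y) = - (xi_comb (p z m) * (xi_comb x * y))" for x y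
    by (rule eta_comb_anticommute(2))
  show ?case using xi p
    by (simp add: subst_hom_xi pder_mult pdel_eta_comb left_con_xi_mult plinear_diff[OF plinear_subst_hom] sum_subtractf
        sum_distrib_left right_diff_distrib e c sum_negf sum.distrib)
next
  case (add a b)
  then show ?case by (simp add: plinear_add[OF plinear_subst_hom] pder_add left_con_linear distrib_left sum.distrib)
next
  case (scl c a)
  then show ?case by (simp add: plinear_scl[OF plinear_subst_hom] pder_scl left_con_linear scl_sum)
qed

text \<open>Expanding \<open>a\<close> in monomials separates the variation of its coefficients,
  which gives the first term, from that of the substitution, which gives the sum.\<close>

lemma pdel_subst_hom:
  assumes q: "\<And>j k. (\<lambda>w. q w j k) differentiable (at z)" "\<And>i j k. del i (\<lambda>w. q w j k) z = 0"
    and p: "\<And>j k. (\<lambda>w. p w j k) differentiable (at z)" and a: "pdiff a z"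
  shows "pdel i (\<lambda>w. subst_hom (q w) (p w) (a w)) z = subst_hom (q z) (p z) (pdel i a z)
    + (\<Sum>j\<in>UNIV. xi_comb (\<lambda>k. del i (\<lambda>w. p w j k) z) * subst_hom (q z) (p z) (left_con j (a z)))"
proof -
  note C = pdel_subst_hom_const[of q z p, OF q p]
  let ?T = "\<lambda>w. subst_hom (q w) (p w)"
  have e: "?T w b = (\<Sum>I\<in>UNIV. \<Sum>J\<in>UNIV. scl (coeff b I J) (?T w (monomial I J)))" for w b
    by (subst polyform_expand[of b]) (simp add: plinear_sum[OF plinear_subst_hom] plinear_scl[OF plinear_subst_hom])
  have d: "(\<lambda>w. coeff (a w) I J) differentiable (at z)" for I J using a by (simp add: pdiff_def)
  have l: "left_con j (a z) = (\<Sum>I\<in>UNIV. \<Sum>J\<in>UNIV. scl (coeff (a z) I J) (left_con j (monomial I J)))" for j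
    by (subst polyform_expand[of "a z"]) (simp add: plinear_sum[OF plinear_left_con] plinear_scl[OF plinear_left_con])
  have "pdel i (\<lambda>w. ?T w (a w)) z = (\<Sum>I\<in>UNIV. \<Sum>J\<in>UNIV. scl (del i (\<lambda>w. coeff (a w) I J) z) (?T z (monomial I J))
      + scl (coeff (a z) I J) (pdel i (\<lambda>w. ?T w (monomial I J)) z))"
    by (subst e) (simp add: pder_sum pder_scl C d)
  also have "\<dots> = ?T z (pdel i a z) + (\<Sum>I\<in>UNIV. \<Sum>J\<in>UNIV. \<Sum>j\<in>UNIV. scl (coeff (a z) I J)
      (xi_comb (\<lambda>k. del i (\<lambda>w. p w j k) z) * ?T z (left_con j (monomial I J))))"
    by (subst e[of z "pdel i a z"]) (simp add: pder_def[of "del i" a] sum.distrib C scl_sum)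
  also have "(\<Sum>I\<in>UNIV. \<Sum>J\<in>UNIV. \<Sum>j\<in>UNIV. scl (coeff (a z) I J)
      (xi_comb (\<lambda>k. del i (\<lambda>w. p w j k) z) * ?T z (left_con j (monomial I J))))
    = (\<Sum>j\<in>UNIV. xi_comb (\<lambda>k. del i (\<lambda>w. p w j k) z) * ?T z (left_con j (a z)))"
    by (simp add: l plinear_sum[OF plinear_subst_hom] plinear_scl[OF plinear_subst_hom] sum_distrib_left sum.swap[of _ "UNIV :: 'a set"])
  finally show ?thesis .
qed

text \<open>The bracket at a point, without extension by 0: a change of charts compares the images
  of one point in two different domains.\<close>

definition brkt_at :: "'n::{finite,linorder} pfield \<Rightarrow> 'n pfield \<Rightarrow>
    'n pfield" where
  "brkt_at a b z = (\<Sum>i\<in>UNIV. right_con i (a z) * pdel i b z - pdel i a z * left_con i (b z))"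

text \<open>The second derivatives of the coordinate change enter the bracket only through an expression
  that is antisymmetric in the two indices of differentiation.\<close>

lemma brkt_at_subst_hom:
  fixes f :: "complex ^ 'n::{finite,linorder} \<Rightarrow> complex ^ 'n::{finite,linorder}"
  assumes V: "open V" "z \<in> V"
    and f: "\<And>k. smooth_on V (\<lambda>w. f w $ k)" "\<And>i k. delbar i (\<lambda>w. f w $ k) z = 0"
    and q: "\<And>j k. (\<lambda>w. q w j k) differentiable (at z)" "\<And>i j k. del i (\<lambda>w. q w j k) z = 0"
    and p: "\<And>w j k. w \<in> V \<Longrightarrow> p w j k = del j (\<lambda>w. f w $ k) w"
    and a: "pdiff a z" "pdiff a' (f z)" "\<And>w. w \<in> V \<Longrightarrow> a' (f w) = subst_hom (q w) (p w) (a w)"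
    and b: "pdiff b z" "pdiff b' (f z)" "\<And>w. w \<in> V \<Longrightarrow> b' (f w) = subst_hom (q w) (p w) (b w)"
  shows "brkt_at a' b' (f z) = subst_hom (q z) (p z) (brkt_at a b z)"
proof -
  let ?T = "subst_hom (q z) (p z)"
  define P where "P i j k = del i (\<lambda>w. p w j k) z" for i j k
  have p1: "(\<lambda>w. p w j k) differentiable (at z)" for j k
    using smooth_on_differentiable[OF smooth_on_del(1)[OF V(1) f(1)] V(2)]
      differentiable_cong[OF V, of "\<lambda>w. p w j k" "\<lambda>w. del j (\<lambda>w. f w $ k) w"] p by blast
  have P: "P i j k = P j i k" for i j k
  proof -
    have "P i j k = del i (del j (\<lambda>w. f w $ k)) z" for i j
      unfolding P_def by (rule del_cong[OF V]) (rule p)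
    then show ?thesis using del_commute(1)[OF V(1) f(1) V(2)] by simp
  qed
  \<comment> \<open>The transformation law is differentiated in two ways: the left side by the chain
    rule for f, the right side as a varying substitution applied to c. The last sum is the
    inhomogeneous part with the second derivatives of f.\<close>
  have chain: "(\<Sum>k\<in>UNIV. scl (p z i k) (pdel k c' (f z))) = ?T (pdel i c z) + (\<Sum>j\<in>UNIV. xi_comb (P i j) * ?T (left_con j (c z)))"
    if c: "pdiff c z" "pdiff c' (f z)" "\<And>w. w \<in> V \<Longrightarrow> c' (f w) = subst_hom (q w) (p w) (c w)" for c c' i
  proof -
    have "(\<Sum>k\<in>UNIV. scl (p z i k) (pdel k c' (f z))) = pdel i (\<lambda>w. c' (f w)) z"
    proof (rule polyform_eqI)
      fix I J
      have "del i (\<lambda>w. coeff (c' (f w)) I J) z = (\<Sum>k\<in>UNIV. del k (\<lambda>w. coeff (c' w) I J) (f z) * del i (\<lambda>w. f w $ k) z)"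
        using del_compose(2)[of "\<lambda>w. coeff (c' w) I J" f z i] c(2) f(2) smooth_on_differentiable[OF f(1) V(2)]
        by (auto simp: pdiff_def)
      then show "coeff (\<Sum>k\<in>UNIV. scl (p z i k) (pdel k c' (f z))) I J = coeff (pdel i (\<lambda>w. c' (f w)) z) I J"
        using p[OF V(2)] by (simp add: coeff_sum pder_def mult.commute)
    qed
    also have "\<dots> = pdel i (\<lambda>w. subst_hom (q w) (p w) (c w)) z"
      unfolding pder_def by (intro arg_cong[where f=Pv] ext del_cong[OF V]) (simp add: c(3))
    also have "\<dots> = ?T (pdel i c z) + (\<Sum>j\<in>UNIV. xi_comb (P i j) * ?T (left_con j (c z)))"
      using pdel_subst_hom[of q z p c i, OF q p1 c(1)] by (simp add: P_def[abs_def])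
    finally show ?thesis .
  qed
  \<comment> \<open>Passing a polyform across a combination of the \<open>xi\<close> costs
    \<open>eps\<close>, and \<open>eps\<close> converts left into right contractions. This brings
    the two inhomogeneous parts into the same shape.\<close>
  have sw: "xi_comb x * ?T (left_con j c) = ?T (right_con j c) * xi_comb x" for x j c
    using mult_gen(2)[of "?T (right_con j c)"]
    by (simp add: xi_comb_def sum_distrib_left sum_distrib_right subst_hom_eps right_con_eq)
  have "brkt_at a' b' (f z) = (\<Sum>k\<in>UNIV. (\<Sum>j\<in>UNIV. scl (p z j k) (?T (right_con j (a z)))) * pdel k b' (f z)
      - pdel k a' (f z) * (\<Sum>j\<in>UNIV. scl (p z j k) (?T (left_con j (b z)))))"
    by (simp add: brkt_at_def a(3)[OF V(2)] b(3)[OF V(2)] right_con_subst_hom left_con_subst_hom)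
  also have "\<dots> = (\<Sum>k\<in>UNIV. \<Sum>j\<in>UNIV. ?T (right_con j (a z)) * scl (p z j k) (pdel k b' (f z))
      - scl (p z j k) (pdel k a' (f z)) * ?T (left_con j (b z)))"
    by (simp add: sum_distrib_left sum_distrib_right sum_subtractf)
  also have "\<dots> = (\<Sum>j\<in>UNIV. \<Sum>k\<in>UNIV. ?T (right_con j (a z)) * scl (p z j k) (pdel k b' (f z))
      - scl (p z j k) (pdel k a' (f z)) * ?T (left_con j (b z)))"
    by (rule sum.swap)
  also have "\<dots> = (\<Sum>j\<in>UNIV. ?T (right_con j (a z)) * (\<Sum>k\<in>UNIV. scl (p z j k) (pdel k b' (f z)))
      - (\<Sum>k\<in>UNIV. scl (p z j k) (pdel k a' (f z))) * ?T (left_con j (b z)))"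
    by (simp add: sum_subtractf sum_distrib_left sum_distrib_right)
  also have "\<dots> = (\<Sum>j\<in>UNIV. ?T (right_con j (a z)) * (?T (pdel j b z) + (\<Sum>l\<in>UNIV. xi_comb (P j l) * ?T (left_con l (b z))))
      - (?T (pdel j a z) + (\<Sum>l\<in>UNIV. xi_comb (P j l) * ?T (left_con l (a z)))) * ?T (left_con j (b z)))"
    by (simp only: chain[OF a] chain[OF b])
  also have "\<dots> = ?T (brkt_at a b z)
      + ((\<Sum>j\<in>UNIV. \<Sum>l\<in>UNIV. ?T (right_con j (a z)) * (xi_comb (P j l) * ?T (left_con l (b z))))
      - (\<Sum>j\<in>UNIV. \<Sum>l\<in>UNIV. ?T (right_con l (a z)) * (xi_comb (P j l) * ?T (left_con j (b z)))))"
    by (simp add: brkt_at_def sw[where c="a z"] plinear_sum[OF plinear_subst_hom] plinear_diff[OF plinear_subst_hom] subst_hom_mult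
        distrib_left distrib_right sum.distrib sum_subtractf sum_distrib_left sum_distrib_right mult.assoc[symmetric])
  also have "(\<Sum>j\<in>UNIV. \<Sum>l\<in>UNIV. ?T (right_con l (a z)) * (xi_comb (P j l) * ?T (left_con j (b z))))
      = (\<Sum>j\<in>UNIV. \<Sum>l\<in>UNIV. ?T (right_con j (a z)) * (xi_comb (P j l) * ?T (left_con l (b z))))"
  proof -
    have "P j l = P l j" for j l using P by blast
    then show ?thesis by (subst sum.swap) simp
  qed
  finally show ?thesis by simp
qed

section \<open>Global sections\<close>

lemma coeff_foldr: "coeff (foldr (*) xs 1) = foldr wedge (map coeff xs) one_pvform"
  by (induction xs) (simp_all add: times_polyform_def one_polyform_def)

lemma coeff_eta_comb: "coeff (eta_comb q) = (\<lambda>I J. \<Sum>k\<in>UNIV. if I = {k} \<and> J = {} then q k else 0)"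
  "coeff (xi_comb q) = (\<lambda>I J. \<Sum>k\<in>UNIV. if I = {} \<and> J = {k} then q k else 0)"
  by (auto simp: fun_eq_iff eta_comb_def xi_comb_def coeff_sum eta_def xi_def intro!: sum.cong)

lemma foldr_mult_append: "foldr (*) (xs @ ys) 1 = foldr (*) xs 1 * foldr (*) ys (1 :: 'a::monoid_mult)"
  by (induction xs) (simp_all add: mult.assoc)

definition chart_trans :: "('a, 'n::finite) chart \<Rightarrow> ('a, 'n) chart \<Rightarrow> complex ^ 'n \<Rightarrow> complex ^ 'n" where
  "chart_trans c c' z = snd c' (chart_inv c z)"

text \<open>The iterated wedge of transformed basis elements is an ordered product in the ring of
  polyforms. Hence a change of chart is an algebra homomorphism, with the Jacobian matrix acting on
  vectors and the conjugate of the inverse chart transition's Jacobian on covectors.\<close>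

lemma change_chart_eq:
  "change_chart c c' x a = coeff (subst_hom (\<lambda>i k. cnj (del k (\<lambda>w. chart_trans c' c w $ i) (snd c' x)))
     (\<lambda>j k. del j (\<lambda>z. chart_trans c c' z $ k) (snd c x)) (Pv a))"
proof -
  let ?q = "\<lambda>i k. cnj (del k (\<lambda>w. chart_trans c' c w $ i) (snd c' x))"
  let ?p = "\<lambda>j k. del j (\<lambda>z. chart_trans c c' z $ k) (snd c x)"
  have "covector_in_chart c c' x = (\<lambda>i. coeff (eta_comb (?q i)))" "vector_in_chart c c' x = (\<lambda>i. coeff (xi_comb (?p i)))"
    by (auto simp: fun_eq_iff covector_in_chart_def vector_in_chart_def coeff_eta_comb chart_trans_def)
  then have "basis_in_chart c c' x I J = coeff (foldr (*) (map (\<lambda>i. eta_comb (?q i)) (sorted_list_of_set I)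
      @ map (\<lambda>j. xi_comb (?p j)) (sorted_list_of_set J)) 1)" for I J
    by (simp only: basis_in_chart_def coeff_foldr map_append map_map comp_def)
  then have "basis_in_chart c c' x I J = coeff (gprod (\<lambda>i. eta_comb (?q i)) I * gprod (\<lambda>j. xi_comb (?p j)) J)" for I J
    by (simp only: gprod_def foldr_mult_append)
  then show ?thesis
    by (simp add: change_chart_def subst_hom_def fun_eq_iff coeff_sum)
qed

lemma coeff_sum_fun: "coeff (sum f S) = (\<Sum>x\<in>S. coeff (f x))"
  for f :: "'b \<Rightarrow> 'n::{finite,linorder} polyform"
proof -
  have "coeff (0 :: 'n polyform) = 0" by (simp add: fun_eq_iff)
  moreover have "coeff (a + b) = coeff a + coeff b" for a b :: "'n polyform" by (simp add: fun_eq_iff)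
  ultimately show ?thesis by (induction S rule: infinite_finite_induct) simp_all
qed

lemma local_schouten_eq: "local_schouten a b z = coeff (brkt_at (\<lambda>z. Pv (a z)) (\<lambda>z. Pv (b z)) z)"
proof -
  have "coeff (x - y) = coeff x - coeff y" for x y :: "'a polyform" by (simp add: fun_eq_iff)
  then show ?thesis
    by (simp add: local_schouten_def brkt_at_def coeff_sum_fun times_polyform_def right_con_def left_con_def pder_def coeff_del_def)
qed

lemma local_dbar_eq: "local_dbar a z = coeff (\<Sum>i\<in>UNIV. eta i * Pv (\<lambda>I J. delbar i (\<lambda>w. a w I J) z))"
proof (intro ext)
  fix I J
  show "local_dbar a z I J = coeff (\<Sum>i\<in>UNIV. eta i * Pv (\<lambda>I J. delbar i (\<lambda>w. a w I J) z)) I J"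
    by (simp add: local_dbar_def coeff_sum coeff_eta_mult below_def sum.If_cases)
qed

lemma brkt_eq_brkt_at: "z \<in> U \<Longrightarrow> brkt U a b z = brkt_at a b z"
  by (simp add: brkt_def brkt_at_def deriv_on_def)

definition localize :: "('a, 'n) pvsection \<Rightarrow> ('a, 'n) chart \<Rightarrow> complex ^ 'n \<Rightarrow> 'n polyform" where
  "localize s c = (\<lambda>z. Pv (s c z))"

lemma coeff_localize [simp]: "coeff (localize s c z) = s c z"
  by (simp add: localize_def)

lemma localize_linear:
  fixes s s' :: "('a, 'n::{finite,linorder}) pvsection"
  shows "localize (s + s') c = localize s c + localize s' c" "localize (s - s') c = localize s c - localize s' c" "localize 0 c = 0"
    "localize (scale k s) c = (\<lambda>z. scl k (localize s c z))"
  by (auto simp: fun_eq_iff scale_def intro!: polyform_eqI)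

section \<open>Sections read in charts\<close>

context
  fixes M :: "('a, 'n::{finite,linorder}) cplx_mfd"
  assumes M: "complex_manifold M"
begin

lemma chart_facts:
  assumes c: "c \<in> atlas M"
  shows "open (chart_image c)" "inj_on (snd c) (fst c)" "x \<in> fst c \<Longrightarrow> chart_inv c (snd c x) = x"
    "c' \<in> atlas M \<Longrightarrow> open (snd c ` (fst c \<inter> fst c'))"
proof -
  have h: "homeomorphic_map (subtopology (top_of M) (fst c)) (top_of_set (chart_image c)) (snd c)"
    and o: "openin (top_of M) (fst c)" and op: "open (chart_image c)"
    using M c by (auto simp: complex_manifold_def)
  show "open (chart_image c)" by (rule op)
  have "topspace (subtopology (top_of M) (fst c)) = fst c"
    using openin_subset[OF o] by auto
  then show inj: "inj_on (snd c) (fst c)"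
    using homeomorphic_imp_injective_map[OF h] by simp
  show "chart_inv c (snd c x) = x" if "x \<in> fst c" using inj that by simp
  show "open (snd c ` (fst c \<inter> fst c'))" if "c' \<in> atlas M"
  proof -
    have "openin (top_of M) (fst c')" using M that by (auto simp: complex_manifold_def)
    then have "openin (subtopology (top_of M) (fst c)) (fst c \<inter> fst c')"
      by (metis inf_commute openin_subtopology)
    then have "openin (top_of_set (chart_image c)) (snd c ` (fst c \<inter> fst c'))"
      using homeomorphic_imp_open_map[OF h] unfolding open_map_def by blast
    then show ?thesis using op openin_open_trans by blast
  qed
qed

lemma chart_trans_facts:
  assumes "c \<in> atlas M" "c' \<in> atlas M"
  shows "holo_on (snd c ` (fst c \<inter> fst c')) (\<lambda>z. chart_trans c c' z $ k)"
    "x \<in> fst c \<Longrightarrow> chart_trans c c' (snd c x) = snd c' x"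
proof -
  show "holo_on (snd c ` (fst c \<inter> fst c')) (\<lambda>z. chart_trans c c' z $ k)"
    using M assms unfolding complex_manifold_def chart_trans_def by blast
  show "chart_trans c c' (snd c x) = snd c' x" if "x \<in> fst c"
    using chart_facts(3)[OF assms(1) that] by (simp add: chart_trans_def)
qed

lemma localize_smooth_fields:
  "s \<in> smooth_sections M \<Longrightarrow> c \<in> atlas M \<Longrightarrow> localize s c \<in> smooth_fields (chart_image c)"
proof -
  assume s: "s \<in> smooth_sections M" and c: "c \<in> atlas M"
  have "localize s c z = 0" if "z \<notin> chart_image c" for z
  proof (rule polyform_eqI)
    fix I J
    have "s c z = 0" using s that unfolding smooth_sections_def by blast
    then show "coeff (localize s c z) I J = coeff 0 I J" by simp
  qed
  then show ?thesis using s c by (simp add: smooth_fields_def smooth_sections_def)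
qed

lemma section_eqI:
  assumes "\<And>c z. \<not> (c \<in> atlas M \<and> z \<in> chart_image c) \<Longrightarrow> s c z = 0"
    "\<And>c z. \<not> (c \<in> atlas M \<and> z \<in> chart_image c) \<Longrightarrow> s' c z = 0"
    "\<And>c. c \<in> atlas M \<Longrightarrow> localize s c = localize s' c"
  shows "s = s'"
proof (intro ext)
  fix c z I J
  show "s c z I J = s' c z I J"
  proof (cases "c \<in> atlas M \<and> z \<in> chart_image c")
    case True
    then have "coeff (localize s c z) I J = coeff (localize s' c z) I J" using assms(3) by simp
    then show ?thesis by simp
  next
    case False then show ?thesis using assms(1,2) by metis
  qed
qed

lemma localize_schouten:
  assumes "s \<in> smooth_sections M" "s' \<in> smooth_sections M" "c \<in> atlas M"
  shows "localize (schouten M s s') c = brkt (chart_image c) (localize s c) (localize s' c)"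
proof
  fix z
  have f: "brkt (chart_image c) (localize s c) (localize s' c) \<in> smooth_fields (chart_image c)"
    by (intro fields_brkt chart_facts localize_smooth_fields assms)
  show "localize (schouten M s s') c z = brkt (chart_image c) (localize s c) (localize s' c) z"
  proof (cases "z \<in> chart_image c")
    case True
    then show ?thesis using assms(3)
      by (intro polyform_eqI) (simp add: schouten_def on_charts_def local_schouten_eq brkt_eq_brkt_at localize_def)
  next
    case False
    then have "brkt (chart_image c) (localize s c) (localize s' c) z = 0"
      using f by (simp add: smooth_fields_def)
    moreover have "localize (schouten M s s') c z = 0"
      using False by (intro polyform_eqI) (auto simp: schouten_def on_charts_def)
    ultimately show ?thesis by simp
  qed
qed

lemma localize_dbar:
  assumes "c \<in> atlas M"
  shows "localize (dbar M s) c = dbar_on (chart_image c) (localize s c)"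
proof
  fix z
  show "localize (dbar M s) c z = dbar_on (chart_image c) (localize s c) z"
  proof (cases "z \<in> chart_image c")
    case True
    then show ?thesis using assms
      by (intro polyform_eqI) (simp add: dbar_def on_charts_def local_dbar_eq dbar_on_def deriv_on_def pder_def)
  next
    case False
    then have "dbar_on (chart_image c) (localize s c) z = 0" by (simp add: dbar_on_def deriv_on_def)
    moreover have "localize (dbar M s) c z = 0"
      using False by (intro polyform_eqI) (auto simp: dbar_def on_charts_def)
    ultimately show ?thesis by simp
  qed
qed

lemma off_charts:
  assumes "\<not> (c \<in> atlas M \<and> z \<in> chart_image c)"
  shows "schouten M s s' c z = 0" "dbar M s c z = 0" "s \<in> smooth_sections M \<Longrightarrow> s c z = 0"
proof -
  show "schouten M s s' c z = 0" "dbar M s c z = 0"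
    using assms by (auto simp: schouten_def dbar_def on_charts_def)
  show "s c z = 0" if "s \<in> smooth_sections M"
    using assms that unfolding smooth_sections_def by blast
qed

lemma smooth_section_transform:
  assumes "s \<in> smooth_sections M" "c \<in> atlas M" "c' \<in> atlas M" "x \<in> fst c" "x \<in> fst c'"
  shows "localize s c' (snd c' x) = subst_hom (\<lambda>i k. cnj (del k (\<lambda>w. chart_trans c' c w $ i) (snd c' x)))
     (\<lambda>j k. del j (\<lambda>z. chart_trans c c' z $ k) (snd c x)) (localize s c (snd c x))"
proof -
  have "s c' (snd c' x) = change_chart c c' x (s c (snd c x))"
    using assms unfolding smooth_sections_def by blast
  then show ?thesis by (simp add: localize_def change_chart_eq)
qed

text \<open>Smoothness is inherited from the local bracket. The transformation law is an instance of
  \<open>brkt_at_subst_hom\<close>, for which it has to be checked that the substitution on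
  covectors depends antiholomorphically on the point.\<close>

lemma schouten_smooth_sections:
  assumes s: "s \<in> smooth_sections M" and s': "s' \<in> smooth_sections M"
  shows "schouten M s s' \<in> smooth_sections M"
  unfolding smooth_sections_def
proof (intro CollectI conjI ballI allI impI)
  fix c z assume "\<not> (c \<in> atlas M \<and> z \<in> chart_image c)"
  then show "schouten M s s' c z = 0" by (rule off_charts)
next
  fix c I J assume c: "c \<in> atlas M"
  have "brkt (chart_image c) (localize s c) (localize s' c) \<in> smooth_fields (chart_image c)"
    by (intro fields_brkt chart_facts localize_smooth_fields s s' c)
  then have "smooth_on (chart_image c) (\<lambda>z. coeff (localize (schouten M s s') c z) I J)"
    unfolding localize_schouten[OF s s' c] by (simp add: smooth_fields_def)
  then show "smooth_on (chart_image c) (\<lambda>z. schouten M s s' c z I J)" by simp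
next
  fix c c' x assume c: "c \<in> atlas M" and c': "c' \<in> atlas M" and x: "x \<in> fst c \<inter> fst c'"
  define V where "V = snd c ` (fst c \<inter> fst c')"
  define V' where "V' = snd c' ` (fst c' \<inter> fst c)"
  define f where "f = chart_trans c c'"
  define g where "g = chart_trans c' c"
  have V: "open V" "open V'" using chart_facts(4) c c' by (auto simp: V_def V'_def)
  have hf: "smooth_on V (\<lambda>z. f z $ k)" "\<And>z i. z \<in> V \<Longrightarrow> delbar i (\<lambda>z. f z $ k) z = 0" for k
    using chart_trans_facts(1)[OF c c'] by (auto simp: holo_on_def V_def f_def)
  have hg: "smooth_on V' (\<lambda>z. g z $ k)" "\<And>z i. z \<in> V' \<Longrightarrow> delbar i (\<lambda>z. g z $ k) z = 0" for k
    using chart_trans_facts(1)[OF c' c] by (auto simp: holo_on_def V'_def g_def)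
  define z where "z = snd c x"
  have zV: "z \<in> V" "f z = snd c' x" "f z \<in> V'"
    using x chart_trans_facts(2)[OF c c'] by (auto simp: V_def V'_def z_def f_def)
  define q where "q w i k = cnj (del k (\<lambda>w. g w $ i) (f w))" for w i k
  define p where "p w j k = del j (\<lambda>z. f z $ k) w" for w j k
  have f1: "(\<lambda>z. f z $ k) differentiable (at z)" for k
    using smooth_on_differentiable[OF hf(1) zV(1)] .
  have q: "(\<lambda>w. q w i k) differentiable (at z)" "del j (\<lambda>w. q w i k) z = 0" for i j k
  proof -
    let ?h = "del k (\<lambda>w. g w $ i)"
    have h: "?h differentiable (at (f z))"
      using smooth_on_differentiable[OF smooth_on_del(1)[OF V(2) hg(1)] zV(3)] .
    note C = del_compose[of ?h f z, OF h f1 hf(2)[OF zV(1)]]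
    \<comment> \<open>A derivative of the holomorphic map g is holomorphic, and so is its
      composition with f at z; its conjugate q is therefore annihilated by
      \<open>del\<close>.\<close>
    have "delbar l ?h (f z) = del k (delbar l (\<lambda>w. g w $ i)) (f z)" for l
      using del_commute(2)[OF V(2) hg(1) zV(3)] by simp
    also have "\<dots> l = del k (\<lambda>w. 0) (f z)" for l
      by (rule del_cong[OF V(2) zV(3)]) (rule hg(2))
    finally have "delbar l ?h (f z) = 0" for l by simp
    then have "delbar j (\<lambda>w. ?h (f w)) z = 0" for j using C(3) by simp
    then show "del j (\<lambda>w. q w i k) z = 0"
      unfolding q_def using del_cnj(1)[OF C(1)] by simp
    show "(\<lambda>w. q w i k) differentiable (at z)"
      using bounded_linear.has_derivative[OF bounded_linear_cnj has_derivative_wirtinger[OF C(1)]]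
      unfolding q_def differentiable_def by blast
  qed
  \<comment> \<open>The law is stated on the whole overlap and not only at z, because
    \<open>brkt_at_subst_hom\<close> differentiates it.\<close>
  have tr: "localize t c' (f w) = subst_hom (q w) (p w) (localize t c w)" if "w \<in> V" "t \<in> smooth_sections M" for w t
  proof -
    obtain y where y: "y \<in> fst c" "y \<in> fst c'" "w = snd c y" using \<open>w \<in> V\<close> by (auto simp: V_def)
    then have "f w = snd c' y" using chart_trans_facts(2)[OF c c'] by (simp add: f_def)
    then show ?thesis
      using smooth_section_transform[OF that(2) c c' y(1,2)] y(3)
      by (simp add: q_def[abs_def] p_def[abs_def] f_def g_def)
  qed
  have d: "pdiff (localize t c) z" "pdiff (localize t c') (f z)" if "t \<in> smooth_sections M" for t
  proof -
    have zc: "z \<in> chart_image c" using x by (auto simp: z_def)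
    have fc: "f z \<in> chart_image c'" unfolding zV(2) using x by auto
    show "pdiff (localize t c) z" "pdiff (localize t c') (f z)"
      unfolding pdiff_def
      using fieldsD(3)[OF chart_facts(1)[OF c] localize_smooth_fields[OF that c] zc]
        fieldsD(3)[OF chart_facts(1)[OF c'] localize_smooth_fields[OF that c'] fc] by blast+
  qed
  have "brkt_at (localize s c') (localize s' c') (f z) = subst_hom (q z) (p z) (brkt_at (localize s c) (localize s' c) z)"
    by (rule brkt_at_subst_hom[OF V(1) zV(1) hf(1) hf(2)[OF zV(1)] q p_def d(1)[OF s] d(2)[OF s] tr[OF _ s]
        d(1)[OF s'] d(2)[OF s'] tr[OF _ s']])
  moreover have "schouten M s s' c z = coeff (brkt_at (localize s c) (localize s' c) z)"
    "schouten M s s' c' (f z) = coeff (brkt_at (localize s c') (localize s' c') (f z))"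
    using c c' x imageI[of x "fst c'" "snd c'"]
    by (simp_all add: schouten_def on_charts_def local_schouten_eq localize_def z_def zV(2)[unfolded z_def])
  ultimately show "schouten M s s' c' (snd c' x) = change_chart c c' x (schouten M s s' c (snd c x))"
    unfolding change_chart_eq using zV(2) z_def
    by (simp add: q_def[abs_def] p_def[abs_def] f_def g_def)
qed

lemma smooth_sections_linear:
  assumes "s \<in> smooth_sections M" "s' \<in> smooth_sections M"
  shows "s + s' \<in> smooth_sections M" "scale k s \<in> smooth_sections M"
proof -
  have o: "open (chart_image c)" if "c \<in> atlas M" for c using chart_facts(1)[OF that] .
  have 1: "Pv (a + b) = Pv a + Pv b" "Pv (\<lambda>I J. k * a I J) = scl k (Pv a)" for a b :: "'n pvform"
    by (rule polyform_eqI; simp)+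
  have 0: "s c z = 0" "s' c z = 0" if "\<not> (c \<in> atlas M \<and> z \<in> chart_image c)" for c z
    using off_charts(3)[OF that] assms by blast+
  show "s + s' \<in> smooth_sections M"
    unfolding smooth_sections_def
  proof (intro CollectI conjI ballI allI impI)
    fix c c' x assume c: "c \<in> atlas M" "c' \<in> atlas M" "x \<in> fst c \<inter> fst c'"
    then have "s c' (snd c' x) = change_chart c c' x (s c (snd c x))" "s' c' (snd c' x) = change_chart c c' x (s' c (snd c x))"
      using assms unfolding smooth_sections_def by blast+
    then show "(s + s') c' (snd c' x) = change_chart c c' x ((s + s') c (snd c x))"
      unfolding change_chart_eq by (simp add: 1 plinear_add[OF plinear_subst_hom] fun_eq_iff)
  qed (use assms 0 in \<open>simp_all add: smooth_on_add[OF o] smooth_sections_def\<close>)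
  show "scale k s \<in> smooth_sections M"
    unfolding smooth_sections_def
  proof (intro CollectI conjI ballI allI impI)
    fix c c' x assume c: "c \<in> atlas M" "c' \<in> atlas M" "x \<in> fst c \<inter> fst c'"
    then have "s c' (snd c' x) = change_chart c c' x (s c (snd c x))"
      using assms unfolding smooth_sections_def by blast
    then show "scale k s c' (snd c' x) = change_chart c c' x (scale k s c (snd c x))"
      unfolding change_chart_eq scale_def by (simp add: 1 plinear_scl[OF plinear_subst_hom] fun_eq_iff)
  qed (use assms 0 in \<open>simp_all add: smooth_on_cmult[OF o] smooth_sections_def scale_def fun_eq_iff\<close>)
qed

end

text \<open>A nonzero coefficient of the bracket comes from nonzero coefficients of both arguments,
  with one vector index contracted away. The points w and w' may differ from z: a nonzero derivative
  at z only shows that the coefficient does not vanish identically.\<close>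

lemma brkt_at_degree:
  assumes "coeff (brkt_at a b z) I J \<noteq> 0"
  shows "\<exists>w I1 J1 w' I2 J2. coeff (a w) I1 J1 \<noteq> 0 \<and> coeff (b w') I2 J2 \<noteq> 0 \<and>
    card I = card I1 + card I2 \<and> Suc (card J) = card J1 + card J2"
proof -
  have mult: "\<exists>I1 J1 I2 J2. coeff x I1 J1 \<noteq> 0 \<and> coeff y I2 J2 \<noteq> 0 \<and> card I = card I1 + card I2 \<and> card J = card J1 + card J2"
    if "coeff (x * y) I J \<noteq> 0" for x y :: "'a polyform"
  proof -
    obtain I' J' where *: "I' \<in> Pow I" "J' \<in> Pow J"
      "msign I' J' (I - I') (J - J') * coeff x I' J' * coeff y (I - I') (J - J') \<noteq> 0"
      using \<open>coeff (x * y) I J \<noteq> 0\<close> unfolding coeff_mult by (meson sum.not_neutral_contains_not_neutral)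
    then have "card I = card I' + card (I - I')" "card J = card J' + card (J - J')"
      by (simp_all add: card_Diff_subset card_mono)
    with * show ?thesis by (metis mult_zero_left mult_zero_right)
  qed
  have con: "\<exists>J'. coeff x I J' \<noteq> 0 \<and> card J' = Suc (card J)"
    if "coeff (left_con i x) I J \<noteq> 0 \<or> coeff (right_con i x) I J \<noteq> 0" for x :: "'a polyform" and i I J
  proof -
    have "i \<notin> J" "coeff x I (insert i J) \<noteq> 0"
      using that by (auto simp: coeff_left_con right_con_eq split: if_splits)
    then show ?thesis by (intro exI[of _ "insert i J"]) simp
  qed
  have del: "\<exists>w. coeff (x w) I J \<noteq> 0" if "coeff (pdel i x z) I J \<noteq> 0" for x i z I J
  proof (rule ccontr)
    assume "\<nexists>w. coeff (x w) I J \<noteq> 0"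
    then have "(\<lambda>w. coeff (x w) I J) = (\<lambda>w. 0)" by auto
    then show False using that by (simp add: pder_def)
  qed
  obtain i where "coeff (right_con i (a z) * pdel i b z) I J \<noteq> 0 \<or> coeff (pdel i a z * left_con i (b z)) I J \<noteq> 0"
    using assms unfolding brkt_at_def coeff_sum
    by (metis (no_types, lifting) coeff_simps(3) diff_zero sum.neutral)
  then show ?thesis
  proof
    assume "coeff (right_con i (a z) * pdel i b z) I J \<noteq> 0"
    from mult[OF this] obtain I1 J1 I2 J2 where "coeff (right_con i (a z)) I1 J1 \<noteq> 0" and b: "coeff (pdel i b z) I2 J2 \<noteq> 0"
      and card: "card I = card I1 + card I2" "card J = card J1 + card J2" by blast
    then obtain J' where "coeff (a z) I1 J' \<noteq> 0" "card J' = Suc (card J1)" using con by blast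
    moreover obtain w where "coeff (b w) I2 J2 \<noteq> 0" using del[OF b] by blast
    ultimately show ?thesis using card by (metis add_Suc)
  next
    assume "coeff (pdel i a z * left_con i (b z)) I J \<noteq> 0"
    from mult[OF this] obtain I1 J1 I2 J2 where "coeff (left_con i (b z)) I2 J2 \<noteq> 0" and a: "coeff (pdel i a z) I1 J1 \<noteq> 0"
      and card: "card I = card I1 + card I2" "card J = card J1 + card J2" by blast
    then obtain J' where "coeff (b z) I2 J' \<noteq> 0" "card J' = Suc (card J2)" using con by blast
    moreover obtain w where "coeff (a w) I1 J1 \<noteq> 0" using del[OF a] by blast
    ultimately show ?thesis using card by (metis add_Suc_right)
  qed
qed

lemma schouten_degree:
  assumes "schouten M s s' c z I J \<noteq> 0"
  shows "\<exists>w I1 J1 w' I2 J2. s c w I1 J1 \<noteq> 0 \<and> s' c w' I2 J2 \<noteq> 0 \<and>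
    card I = card I1 + card I2 \<and> Suc (card J) = card J1 + card J2"
proof -
  have "coeff (brkt_at (localize s c) (localize s' c) z) I J \<noteq> 0"
    using assms by (auto simp: schouten_def on_charts_def local_schouten_eq localize_def split: if_splits)
  from brkt_at_degree[OF this] show ?thesis by simp
qed

section \<open>Second-order jets\<close>

text \<open>The expansion g(t) = p t + q t^2 + o(t^2) for real t tending to 0. A constant term is
  absent because the family of cochains starts at 0.\<close>

definition jet :: "(real \<Rightarrow> complex) \<Rightarrow> complex \<Rightarrow> complex \<Rightarrow> bool" where
  "jet g p q \<longleftrightarrow> ((\<lambda>t. (g t - of_real t * p) / of_real (t * t)) \<longlongrightarrow> q) (at 0)"

lemma jet_add: "jet g p q \<Longrightarrow> jet h p' q' \<Longrightarrow> jet (\<lambda>t. g t + h t) (p + p') (q + q')"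
  unfolding jet_def by (drule (1) tendsto_add) (simp add: add_divide_distrib diff_divide_distrib algebra_simps)

lemma jet_cmult: "jet g p q \<Longrightarrow> jet (\<lambda>t. c * g t) (c * p) (c * q)"
  unfolding jet_def by (drule tendsto_mult_left[of _ _ _ c]) (simp add: algebra_simps)

lemma jet_0: "jet (\<lambda>t. 0) 0 0"
  by (simp add: jet_def)

lemma jet_sum: "(\<And>x. x \<in> S \<Longrightarrow> jet (g x) (p x) (q x)) \<Longrightarrow> jet (\<lambda>t. \<Sum>x\<in>S. g x t) (\<Sum>x\<in>S. p x) (\<Sum>x\<in>S. q x)"
  by (induction S rule: infinite_finite_induct) (simp_all add: jet_0 jet_add)

lemma jet_first_order:
  assumes "jet g p q" shows "((\<lambda>t. g t / of_real t) \<longlongrightarrow> p) (at 0)"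
proof -
  have "((\<lambda>t. of_real t * ((g t - of_real t * p) / of_real (t * t)) + p) \<longlongrightarrow> of_real 0 * q + p) (at 0)"
    using assms unfolding jet_def by (intro tendsto_intros)
  moreover have "eventually (\<lambda>t. of_real t * ((g t - of_real t * p) / of_real (t * t)) + p = g t / of_real t) (at 0)"
    unfolding eventually_at by (intro exI[of _ 1]) (auto simp: field_simps)
  ultimately show ?thesis by (auto elim: Lim_transform_eventually)
qed

text \<open>Both factors are of first order, so the product has no linear term. This is how the
  square of the first-order term arises in the t^2 coefficient.\<close>

lemma jet_mult:
  assumes "jet g p q" "jet h p' q'" shows "jet (\<lambda>t. g t * h t) 0 (p * p')"
proof -
  have "((\<lambda>t. (g t / of_real t) * (h t / of_real t)) \<longlongrightarrow> p * p') (at 0)"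
    by (intro tendsto_mult jet_first_order assms[THEN jet_first_order])
  then show ?thesis by (simp add: jet_def)
qed

text \<open>The first-order limit gives p = 0; after that, the quotient that defines q vanishes near
  0.\<close>

lemma jet_eq_0:
  assumes "jet g p q" "d > 0" "\<And>t. \<bar>t\<bar> < d \<Longrightarrow> g t = 0" shows "q = 0"
proof -
  have ev: "eventually (\<lambda>t. g t = 0) (at 0)"
    unfolding eventually_at using assms(2,3) by (intro exI[of _ d]) auto
  have "((\<lambda>t::real. 0 :: complex) \<longlongrightarrow> p) (at 0)"
    by (rule Lim_transform_eventually[OF jet_first_order[OF assms(1)] eventually_mono[OF ev]]) simp
  then have p: "p = 0" by (metis LIM_const_eq)
  have "((\<lambda>t::real. 0 :: complex) \<longlongrightarrow> q) (at 0)"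
    by (rule Lim_transform_eventually[OF assms(1)[unfolded jet_def] eventually_mono[OF ev]]) (simp add: p)
  then show "q = 0" by (metis LIM_const_eq)
qed

text \<open>The function h(t) - t^2 c / 2 has derivative k(t) - t c, which differs from
  \<open>k 0\<close> by o(t) because k is differentiable at 0. The mean value inequality turns this
  into an error o(t^2).\<close>

lemma jet_taylor:
  assumes d: "d > 0" and h: "\<And>t. \<bar>t\<bar> < d \<Longrightarrow> (h has_vector_derivative k t) (at t)"
    and k: "(k has_vector_derivative c) (at 0)" and h0: "h 0 = 0"
  shows "jet h (k 0) (c / 2)"
  unfolding jet_def LIM_def
proof (intro allI impI)
  fix e :: real assume e: "0 < e"
  have "((\<lambda>t. k t) has_derivative (\<lambda>x. x *\<^sub>R c)) (at 0)" using k by (simp add: has_vector_derivative_def)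
  then obtain d1 where d1: "d1 > 0" "\<And>t. norm (t - 0) < d1 \<Longrightarrow> norm (k t - k 0 - (t - 0) *\<^sub>R c) \<le> e / 2 * norm (t - 0)"
    unfolding has_derivative_within_alt using e by (metis UNIV_I half_gt_zero)
  show "\<exists>s>0. \<forall>x. x \<noteq> 0 \<and> dist x 0 < s \<longrightarrow> dist ((h x - of_real x * k 0) / of_real (x * x)) (c / 2) < e"
  proof (intro exI[of _ "min d d1"] conjI allI impI)
    fix x :: real assume x: "x \<noteq> 0 \<and> dist x 0 < min d d1"
    define f where "f t = h t - of_real (t * t) * (c / 2)" for t
    define f' where "f' t = k t - of_real t * c" for t
    have "norm (f x - f 0 - (x - 0) *\<^sub>R f' 0) \<le> norm (x - 0) * (e / 2 * norm x)"
    proof (rule vector_differentiable_bound_linearization[where S="{- norm x..norm x}"])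
      fix t assume t: "t \<in> {- norm x..norm x}"
      then have t': "\<bar>t\<bar> < d" "\<bar>t\<bar> < d1" "\<bar>t\<bar> \<le> \<bar>x\<bar>" using x by auto
      have "((\<lambda>t. of_real (t * t) * (c / 2)) has_vector_derivative (of_real t * c)) (at t)"
        unfolding has_vector_derivative_def of_real_mult
        by (auto intro!: derivative_eq_intros simp: scaleR_conv_of_real algebra_simps)
      then have "(f has_vector_derivative f' t) (at t)"
        unfolding f_def[abs_def] f'_def by (intro has_vector_derivative_diff h t')
      then show "(f has_vector_derivative f' t) (at t within {- norm x..norm x})"
        by (rule has_vector_derivative_at_within)
      have "norm (f' t - f' 0) \<le> e / 2 * \<bar>t\<bar>"
        using d1(2)[of t] t' by (simp add: f'_def scaleR_conv_of_real algebra_simps)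
      also have "\<dots> \<le> e / 2 * norm x" using t' e by (intro mult_left_mono) auto
      finally show "norm (f' t - f' 0) \<le> e / 2 * norm x" .
    qed (auto simp: closed_segment_eq_real_ivl)
    then have "norm (h x - of_real x * k 0 - of_real (x * x) * (c / 2)) \<le> (e / 2) * (x * x)"
      by (simp add: f_def f'_def h0 scaleR_conv_of_real algebra_simps abs_mult_self_eq)
    moreover define N where "N = h x - of_real x * k 0 - of_real (x * x) * (c / 2)"
    ultimately have N: "norm N \<le> (e / 2) * (x * x)" by simp
    have "(h x - of_real x * k 0) / of_real (x * x) - c / 2 = N / of_real (x * x)"
      using x by (simp add: N_def field_simps)
    then have "norm ((h x - of_real x * k 0) / of_real (x * x) - c / 2) = norm N / (x * x)"
      by (simp only: norm_divide norm_of_real abs_mult abs_mult_self_eq)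
    also have "\<dots> \<le> (e / 2) * (x * x) / (x * x)"
      by (intro divide_right_mono N) simp
    also have "\<dots> < e" using x e by simp
    finally show "dist ((h x - of_real x * k 0) / of_real (x * x)) (c / 2) < e" by (simp add: dist_norm)
  qed (use d d1 in auto)
qed

section \<open>Power series in t with jointly smooth sum\<close>

lemma power_series_derivative:
  fixes g :: "complex \<Rightarrow> complex"
  assumes s: "\<And>t. t \<in> ball 0 r \<Longrightarrow> (\<lambda>m. \<beta> m * t ^ m) sums g t" and t: "t \<in> ball 0 r"
  shows "(g has_field_derivative (\<Sum>m. diffs \<beta> m * t ^ m)) (at t)" "summable (\<lambda>m. diffs \<beta> m * t ^ m)"
proof -
  have sm: "summable (\<lambda>m. \<beta> m * x ^ m)" if "norm x < r" for x
    using s[of x] that by (simp add: sums_iff)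
  have "((\<lambda>t. \<Sum>m. \<beta> m * t ^ m) has_field_derivative (\<Sum>m. diffs \<beta> m * t ^ m)) (at t)"
    using t by (intro termdiffs_strong'[OF sm]) auto
  then show "(g has_field_derivative (\<Sum>m. diffs \<beta> m * t ^ m)) (at t)"
    by (rule has_field_derivative_transform_within_open[where S="ball 0 r"]) (use t s in \<open>auto simp: sums_iff\<close>)
  show "summable (\<lambda>m. diffs \<beta> m * t ^ m)"
    using t by (intro termdiff_converges[of t r \<beta>] sm) auto
qed

lemma partial_derivatives:
  fixes G :: "'v::real_normed_vector \<times> complex \<Rightarrow> complex"
  assumes "G differentiable (at (z, t))"
  shows "((\<lambda>w. G (w, t)) has_derivative (\<lambda>v. frechet_derivative G (at (z, t)) (v, 0))) (at z)"
    "((\<lambda>s. G (z, s)) has_derivative (\<lambda>s. frechet_derivative G (at (z, t)) (0, s))) (at t)"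
proof -
  have G: "(G has_derivative frechet_derivative G (at (z, t))) (at (z, t))"
    using assms frechet_derivative_works by blast
  have "((\<lambda>w. (w, t)) has_derivative (\<lambda>v. (v, 0))) (at z)" by (auto intro!: derivative_eq_intros)
  from has_derivative_compose[OF this, of G "frechet_derivative G (at (z, t))"] G
  show "((\<lambda>w. G (w, t)) has_derivative (\<lambda>v. frechet_derivative G (at (z, t)) (v, 0))) (at z)" by simp
  have "((\<lambda>s. (z, s)) has_derivative (\<lambda>s. (0, s))) (at t)" by (auto intro!: derivative_eq_intros)
  from has_derivative_compose[OF this, of G "frechet_derivative G (at (z, t))"] G
  show "((\<lambda>s. G (z, s)) has_derivative (\<lambda>s. frechet_derivative G (at (z, t)) (0, s))) (at t)" by simp
qed

text \<open>The directional derivative and the termwise derivative are both derivatives of the sum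
  in t, so they agree. The result has the form of the hypothesis and can be applied again.\<close>

lemma partial_power_series:
  fixes G :: "'v::real_normed_vector \<times> complex \<Rightarrow> complex"
  assumes G: "G differentiable (at (z, t))" and t: "t \<in> ball 0 r"
    and s: "\<And>t. t \<in> ball 0 r \<Longrightarrow> (\<lambda>m. \<beta> m * t ^ m) sums G (z, t)"
  shows "(\<lambda>m. diffs \<beta> m * t ^ m) sums frechet_derivative G (at (z, t)) (0, 1)"
proof -
  have "((\<lambda>s. G (z, s)) has_derivative (\<lambda>h. (\<Sum>m. diffs \<beta> m * t ^ m) * h)) (at t)"
    using power_series_derivative(1)[OF s t] by (simp add: has_field_derivative_def)
  then have "(\<lambda>s. frechet_derivative G (at (z, t)) (0, s)) = (\<lambda>h. (\<Sum>m. diffs \<beta> m * t ^ m) * h)"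
    using has_derivative_unique[OF partial_derivatives(2)[OF G]] by blast
  then have "frechet_derivative G (at (z, t)) (0, 1) = (\<Sum>m. diffs \<beta> m * t ^ m) * 1" by metis
  then show ?thesis using power_series_derivative(2)[OF s t] by (simp add: summable_sums)
qed

lemma jet_smooth:
  fixes H :: "'v::real_normed_vector \<times> complex \<Rightarrow> complex"
  assumes "open W" "smooth_on (W \<times> ball 0 r) H" "0 < r" "z \<in> W" "H (z, 0) = 0"
  shows "jet (\<lambda>t. H (z, of_real t)) (frechet_derivative H (at (z, 0)) (0, 1))
    (frechet_derivative (\<lambda>x. frechet_derivative H (at x) (0, 1)) (at (z, 0)) (0, 1) / 2)"
proof -
  have der: "((\<lambda>t. G (z, of_real t)) has_vector_derivative frechet_derivative G (at (z, of_real t)) (0, 1)) (at t)"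
    if "smooth_on (W \<times> ball 0 r) G" "\<bar>t\<bar> < r" for G :: "'v \<times> complex \<Rightarrow> complex" and t
  proof -
    have d: "G differentiable (at (z, of_real t))"
      using that assms(4) by (intro smooth_on_differentiable[OF that(1)]) auto
    have "linear (frechet_derivative G (at (z, of_real t)))" using d linear_frechet_derivative by blast
    then have l: "frechet_derivative G (at (z, of_real t)) (0, of_real h) = h *\<^sub>R frechet_derivative G (at (z, of_real t)) (0, 1)" for h
      using linear_scale[of "frechet_derivative G (at (z, of_real t))" h "(0, 1)"] by (simp add: scaleR_conv_of_real)
    have "((\<lambda>t. of_real t) has_derivative (\<lambda>h. of_real h)) (at t)" by (auto intro!: derivative_eq_intros)
    from has_derivative_compose[OF this partial_derivatives(2)[OF d]]
    show ?thesis unfolding has_vector_derivative_def l .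
  qed
  show ?thesis
    using jet_taylor[of r "\<lambda>t. H (z, of_real t)" "\<lambda>t. frechet_derivative H (at (z, of_real t)) (0, 1)",
      OF assms(3) der[OF assms(2)] der[OF smooth_on_derivative[OF assms(2)], of 0]] assms(3,5) by simp
qed

text \<open>Joint smoothness allows the exchange of the derivatives in \<open>t\<close> and along \<open>W\<close>.\<close>

lemma jet_power_series:
  fixes F :: "'v::real_normed_vector \<times> complex \<Rightarrow> complex"
  assumes W: "open W" and F: "smooth_on (W \<times> ball 0 r) F" and r: "0 < r" and z: "z \<in> W"
    and s: "\<And>w t. w \<in> W \<Longrightarrow> t \<in> ball 0 r \<Longrightarrow> (\<lambda>m. \<beta> w m * t ^ m) sums F (w, t)"
    and F0: "\<And>w. w \<in> W \<Longrightarrow> F (w, 0) = 0"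
  shows "jet (\<lambda>t. F (z, of_real t)) (\<beta> z 1) (\<beta> z 2)"
    and "jet (\<lambda>t. frechet_derivative (\<lambda>w. F (w, of_real t)) (at z) v)
      (frechet_derivative (\<lambda>w. \<beta> w 1) (at z) v) (frechet_derivative (\<lambda>w. \<beta> w 2) (at z) v)"
proof -
  let ?S = "W \<times> ball (0::complex) r"
  have S: "open ?S" using W by (intro open_Times) auto
  have inS: "(w, 0) \<in> ?S" if "w \<in> W" for w using that r by simp
  let ?D = "\<lambda>v G x. frechet_derivative G (at x) v"
  let ?\<tau> = "(0, 1) :: 'v \<times> complex"
  have T: "smooth_on ?S (?D u G)" if "smooth_on ?S G" for G :: "'v \<times> complex \<Rightarrow> complex" and u
    using smooth_on_derivative[OF that] .
  have s1: "(\<lambda>m. diffs (\<beta> w) m * t ^ m) sums ?D ?\<tau> F (w, t)" if "w \<in> W" "t \<in> ball 0 r" for w t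
    by (rule partial_power_series[OF smooth_on_differentiable[OF F] that(2) s[OF that(1)]]) (use that in auto)
  have s2: "(\<lambda>m. diffs (diffs (\<beta> w)) m * t ^ m) sums ?D ?\<tau> (?D ?\<tau> F) (w, t)" if "w \<in> W" "t \<in> ball 0 r" for w t
    by (rule partial_power_series[OF smooth_on_differentiable[OF T[OF F]] that(2) s1[OF that(1)]]) (use that in auto)
  have \<beta>1: "?D ?\<tau> F (w, 0) = \<beta> w 1" if "w \<in> W" for w
    using sums_unique2[OF s1[OF that] powser_sums_zero] r by (simp add: diffs_def)
  \<comment> \<open>The twice differentiated series has constant term
    \<open>2 * \<beta> w 2\<close>; the factor is cancelled by the 1/2 of Taylor's formula in
    \<open>jet_smooth\<close>.\<close>
  have \<beta>2: "?D ?\<tau> (?D ?\<tau> F) (w, 0) = 2 * \<beta> w 2" if "w \<in> W" for w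
    using sums_unique2[OF s2[OF that] powser_sums_zero] r by (simp add: diffs_def numeral_2_eq_2)
  show "jet (\<lambda>t. F (z, of_real t)) (\<beta> z 1) (\<beta> z 2)"
    using jet_smooth[OF W F r z F0[OF z]] by (simp add: \<beta>1[OF z] \<beta>2[OF z])
  have restr: "?D (v, 0) G (w, 0) = frechet_derivative (\<lambda>w. G (w, 0)) (at w) v" if "smooth_on ?S G" "w \<in> W" for G :: "'v \<times> complex \<Rightarrow> complex" and w
    using frechet_derivative_eqI[OF partial_derivatives(1)[OF smooth_on_differentiable[OF that(1) inS[OF that(2)]]]] by simp
  let ?H = "?D (v, 0) F"
  have H0: "?H (z, 0) = 0"
    using restr[OF F z] frechet_derivative_cong[OF W z, of "\<lambda>w. F (w, 0)" "\<lambda>w. 0"] F0 by simp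
  \<comment> \<open>The derivative in t is moved inside the derivative along v by symmetry. At t = 0
    it is then a coefficient of the series as a function of w, so the derivative along v falls on
    that coefficient.\<close>
  have "?D ?\<tau> ?H (z, 0) = ?D (v, 0) (?D ?\<tau> F) (z, 0)"
    using smooth_on_symmetric[OF S F inS[OF z]] .
  also have "\<dots> = frechet_derivative (\<lambda>w. \<beta> w 1) (at z) v"
    unfolding restr[OF T[OF F] z] using frechet_derivative_cong[OF W z, of "\<lambda>w. ?D ?\<tau> F (w, 0)" "\<lambda>w. \<beta> w 1"] \<beta>1 by simp
  finally have 1: "?D ?\<tau> ?H (z, 0) = frechet_derivative (\<lambda>w. \<beta> w 1) (at z) v" .
  have "?D ?\<tau> (?D ?\<tau> ?H) (z, 0) = ?D ?\<tau> (?D (v, 0) (?D ?\<tau> F)) (z, 0)"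
    using frechet_derivative_cong[OF S inS[OF z], of "?D ?\<tau> ?H" "?D (v, 0) (?D ?\<tau> F)"] smooth_on_symmetric[OF S F] by simp
  also have "\<dots> = ?D (v, 0) (?D ?\<tau> (?D ?\<tau> F)) (z, 0)"
    using smooth_on_symmetric[OF S T[OF F] inS[OF z]] .
  also have "\<dots> = frechet_derivative (\<lambda>w. 2 * \<beta> w 2) (at z) v"
    unfolding restr[OF T[OF T[OF F]] z]
    using frechet_derivative_cong[OF W z, of "\<lambda>w. ?D ?\<tau> (?D ?\<tau> F) (w, 0)" "\<lambda>w. 2 * \<beta> w 2"] \<beta>2 by simp
  also have "\<dots> = 2 * frechet_derivative (\<lambda>w. \<beta> w 2) (at z) v"
  proof -
    \<comment> \<open>Pulling the factor 2 out of the derivative requires that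
      \<open>\<beta> w 2\<close> is differentiable in w. It is, being half of the second
      t-derivative of the smooth function F at t = 0.\<close>
    have "(\<lambda>w. ?D ?\<tau> (?D ?\<tau> F) (w, 0)) differentiable (at z)"
      using partial_derivatives(1)[OF smooth_on_differentiable[OF T[OF T[OF F]] inS[OF z]]] unfolding differentiable_def by blast
    then have "(\<lambda>w. 2 * \<beta> w 2) differentiable (at z)"
      using differentiable_cong[OF W z, of "\<lambda>w. ?D ?\<tau> (?D ?\<tau> F) (w, 0)" "\<lambda>w. 2 * \<beta> w 2"] \<beta>2 by simp
    then have "(\<lambda>w. (1/2) * (2 * \<beta> w 2)) differentiable (at z)" by (intro differentiable_mult) auto
    then have "((\<lambda>w. \<beta> w 2) has_derivative frechet_derivative (\<lambda>w. \<beta> w 2) (at z)) (at z)"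
      unfolding frechet_derivative_works by simp
    from frechet_derivative_eqI[OF has_derivative_mult_right[OF this, of 2]] show ?thesis .
  qed
  finally have 2: "?D ?\<tau> (?D ?\<tau> ?H) (z, 0) = 2 * frechet_derivative (\<lambda>w. \<beta> w 2) (at z) v" .
  have j: "jet (\<lambda>t. ?H (z, of_real t)) (frechet_derivative (\<lambda>w. \<beta> w 1) (at z) v) (frechet_derivative (\<lambda>w. \<beta> w 2) (at z) v)"
    using jet_smooth[OF W T[OF F] r z H0] unfolding 1 2 by simp
  have "frechet_derivative (\<lambda>w. F (w, of_real t)) (at z) v = ?H (z, of_real t)" if "\<bar>t\<bar> < r" for t
    using frechet_derivative_eqI[OF partial_derivatives(1)[OF smooth_on_differentiable[OF F]]] that z by simp
  then have "eventually (\<lambda>t. (?H (z, of_real t) - of_real t * frechet_derivative (\<lambda>w. \<beta> w 1) (at z) v) / of_real (t * t)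
      = (frechet_derivative (\<lambda>w. F (w, of_real t)) (at z) v - of_real t * frechet_derivative (\<lambda>w. \<beta> w 1) (at z) v) / of_real (t * t)) (at 0)"
    unfolding eventually_at using r by (intro exI[of _ r]) auto
  then show "jet (\<lambda>t. frechet_derivative (\<lambda>w. F (w, of_real t)) (at z) v)
      (frechet_derivative (\<lambda>w. \<beta> w 1) (at z) v) (frechet_derivative (\<lambda>w. \<beta> w 2) (at z) v)"
    using j unfolding jet_def by (rule Lim_transform_eventually[rotated])
qed

lemma jet_wirtinger:
  fixes F :: "(complex ^ 'n::finite) \<times> complex \<Rightarrow> complex"
  assumes "\<And>v. jet (\<lambda>t. frechet_derivative (\<lambda>w. F (w, of_real t)) (at z) v)
      (frechet_derivative p (at z) v) (frechet_derivative q (at z) v)"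
  shows "jet (\<lambda>t. del i (\<lambda>w. F (w, of_real t)) z) (del i p z) (del i q z)"
    "jet (\<lambda>t. delbar i (\<lambda>w. F (w, of_real t)) z) (delbar i p z) (delbar i q z)"
proof -
  have 1: "jet (\<lambda>t. (1/2) * (frechet_derivative (\<lambda>w. F (w, of_real t)) (at z) (axis i 1) + c * frechet_derivative (\<lambda>w. F (w, of_real t)) (at z) (axis i \<i>)))
     ((1/2) * (frechet_derivative p (at z) (axis i 1) + c * frechet_derivative p (at z) (axis i \<i>)))
     ((1/2) * (frechet_derivative q (at z) (axis i 1) + c * frechet_derivative q (at z) (axis i \<i>)))" for c
    by (intro jet_add jet_cmult assms)
  show "jet (\<lambda>t. del i (\<lambda>w. F (w, of_real t)) z) (del i p z) (del i q z)"
    using 1[of "-\<i>"] by (simp add: del_def)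
  show "jet (\<lambda>t. delbar i (\<lambda>w. F (w, of_real t)) z) (delbar i p z) (delbar i q z)"
    using 1[of "\<i>"] by (simp add: delbar_def)
qed

section \<open>Jets of polyforms\<close>

definition pjet :: "(real \<Rightarrow> 'n::{finite,linorder} polyform) \<Rightarrow> 'n polyform \<Rightarrow> 'n polyform \<Rightarrow> bool" where
  "pjet X p q \<longleftrightarrow> (\<forall>I J. jet (\<lambda>t. coeff (X t) I J) (coeff p I J) (coeff q I J))"

lemma pjet_add: "pjet X p q \<Longrightarrow> pjet Y p' q' \<Longrightarrow> pjet (\<lambda>t. X t + Y t) (p + p') (q + q')"
  by (simp add: pjet_def jet_add)

lemma pjet_plinear: "plinear h \<Longrightarrow> pjet X p q \<Longrightarrow> pjet (\<lambda>t. h (X t)) (h p) (h q)"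
  unfolding pjet_def plinear_coeff[of h "X _"] plinear_coeff[of h p] plinear_coeff[of h q]
  by (intro allI jet_sum jet_cmult) auto

lemma pjet_diff: "pjet X p q \<Longrightarrow> pjet Y p' q' \<Longrightarrow> pjet (\<lambda>t. X t - Y t) (p - p') (q - q')"
  using pjet_add[of X p q "\<lambda>t. - Y t" "- p'" "- q'"] pjet_plinear[of uminus Y p' q'] by (simp add: plinear_def scl_distrib)

lemma pjet_sum: "(\<And>x. x \<in> S \<Longrightarrow> pjet (X x) (p x) (q x)) \<Longrightarrow> pjet (\<lambda>t. \<Sum>x\<in>S. X x t) (\<Sum>x\<in>S. p x) (\<Sum>x\<in>S. q x)"
  by (simp add: pjet_def coeff_sum jet_sum)

lemma pjet_mult:
  assumes "pjet X p q" "pjet Y p' q'" shows "pjet (\<lambda>t. X t * Y t) 0 (p * p')"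
proof -
  \<comment> \<open>The vanishing linear term is written as a sum of zeros so that it has the shape
    produced by \<open>jet_sum\<close> and \<open>jet_cmult\<close>.\<close>
  have "jet (\<lambda>t. coeff (X t * Y t) I J) (\<Sum>I'\<in>Pow I. \<Sum>J'\<in>Pow J. msign I' J' (I - I') (J - J') * 0) (coeff (p * p') I J)" for I J
    unfolding coeff_mult mult.assoc using assms
    by (intro jet_sum jet_cmult jet_mult) (auto simp: pjet_def)
  then show ?thesis by (simp add: pjet_def)
qed

section \<open>The differential graded Lie algebra of sections\<close>

context
  fixes U :: "(complex ^ 'n::{finite,linorder}) set"
  assumes U: "open U"
begin

lemma brkt_0_left [simp]: "brkt U 0 b = 0"
  by (simp add: brkt_def deriv_on_def zero_fun_def plinear_0[OF plinear_right_con] cong: if_cong)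

lemma brkt_0_right [simp]: "brkt U a 0 = 0"
  using brkt_diff_right[OF U fields_0[OF U] fields_0[OF U], of a] by simp

lemma dbar_on_scl: "a \<in> smooth_fields U \<Longrightarrow> dbar_on U (\<lambda>z. scl k (a z)) = (\<lambda>z. scl k (dbar_on U a z))"
  by (simp add: dbar_on_def deriv_on_plinear[OF U _ plinear_scl'] scl_sum)

lemma brkt_scl_right: "b \<in> smooth_fields U \<Longrightarrow> brkt U a (\<lambda>z. scl k (b z)) = (\<lambda>z. scl k (brkt U a b z))"
  by (simp add: brkt_def deriv_on_plinear[OF U _ plinear_scl'] scl_sum left_con_linear scl_distrib)

text \<open>Both parts of L obey the odd derivation rule on the bracket, so L [s, s] = [L s, s] -
  [s, L s].\<close>

lemma bracket_of_cocycle: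
  assumes c: "even_field U c" and s: "even_field U s" and "dbar_on U s + brkt U c s = 0"
  shows "dbar_on U (brkt U s s) + brkt U c (brkt U s s) = 0"
proof -
  note mem = even_fieldD(1)[OF U s] even_fieldD(1)[OF U c]
  note mem' = fields_dbar_on[OF U mem(1)] fields_brkt[OF U mem(2,1)]
  have "dbar_on U (brkt U s s) + brkt U c (brkt U s s) = brkt U (dbar_on U s + brkt U c s) s - brkt U s (dbar_on U s + brkt U c s)"
    unfolding dbar_on_brkt(1)[OF U mem(1) s] brkt_jacobi(1)[OF U c mem(1) s] brkt_add_left[OF U mem'] brkt_add_right[OF U mem']
    by simp
  then show ?thesis using assms(3) by simp
qed

text \<open>For an odd first argument the derivation rule has a plus sign, L [t, s] = [L t, s] +
  [t, L s], and the last term vanishes for a cocycle s.\<close>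

lemma bracket_with_cocycle:
  assumes c: "even_field U c" and t: "odd_field U t" and s: "even_field U s" and "dbar_on U s + brkt U c s = 0"
  shows "dbar_on U (brkt U t s) + brkt U c (brkt U t s) = brkt U (dbar_on U t + brkt U c t) s"
proof -
  note mem = odd_fieldD(1)[OF U t] even_fieldD(1)[OF U c] even_fieldD(1)[OF U s]
  have "dbar_on U (brkt U t s) + brkt U c (brkt U t s) = brkt U (dbar_on U t + brkt U c t) s + brkt U t (dbar_on U s + brkt U c s)"
    unfolding dbar_on_brkt(2)[OF U mem(3) t] brkt_jacobi(2)[OF U c mem(3) t]
      brkt_add_left[OF U fields_dbar_on[OF U mem(1)] fields_brkt[OF U mem(2,1)]]
      brkt_add_right[OF U fields_dbar_on[OF U mem(3)] fields_brkt[OF U mem(2,3)]]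
    by simp
  then show ?thesis using assms(4) by simp
qed

text \<open>The mixed terms [a, b] and [b, a] cancel because the bracket is symmetric on even
  fields.\<close>

lemma bracket_difference_of_squares:
  assumes a: "even_field U a" and b: "even_field U b"
  shows "brkt U a a - brkt U b b = brkt U (a - b) (a + b)"
proof -
  note mem = even_fieldD(1)[OF U a] even_fieldD(1)[OF U b]
  have l: "brkt U (a - b) x = brkt U a x - brkt U b x" for x
    using brkt_add_left[OF U fields_diff[OF U mem] mem(2), of x] by (simp add: algebra_simps)
  show ?thesis
    unfolding l brkt_add_right[OF U mem] using brkt_symmetric[OF U a b] by simp
qed

end

section \<open>Cochains and their parity\<close>

lemma zero_smooth_section: "0 \<in> smooth_sections M"
proof -
  have "Pv (0 :: 'b pvform) = (0 :: 'b::{finite,linorder} polyform)" by (rule polyform_eqI) simp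
  then show ?thesis
    by (simp add: smooth_sections_def change_chart_eq plinear_0[OF plinear_subst_hom] fun_eq_iff)
qed

lemma zero_total: "0 \<in> total M i"
  by (simp add: total_def zero_smooth_section)

lemma A_subset_total: "1 \<le> q \<Longrightarrow> p + q = Suc i \<Longrightarrow> A M p q \<subseteq> total M i"
  by (auto simp: A_def total_def)

lemma total_degree: "s \<in> total M i \<Longrightarrow> s c z I J \<noteq> 0 \<Longrightarrow> card I + card J = Suc i \<and> 1 \<le> card J"
  unfolding total_def by blast

lemma A_degree: "s \<in> A M p q \<Longrightarrow> s c z I J \<noteq> 0 \<Longrightarrow> card I = p \<and> card J = q"
  unfolding A_def by blast

text \<open>Parity is that of p + q, one more than the degree p + q - 1; hence cochains of odd
  degree are even polyforms.\<close>

lemma total_even: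
  assumes "s \<in> total M i" "odd i"
  shows "eps (localize s c z) = localize s c z"
proof (rule polyform_eqI)
  fix I J
  have "card I + card J = Suc i" if "s c z I J \<noteq> 0" using total_degree[OF assms(1) that] by simp
  then show "coeff (eps (localize s c z)) I J = coeff (localize s c z) I J"
    using assms(2) by (cases "s c z I J = 0") simp_all
qed

lemma total_odd:
  assumes "s \<in> total M i" "even i"
  shows "eps (localize s c z) = - localize s c z"
proof (rule polyform_eqI)
  fix I J
  have "card I + card J = Suc i" if "s c z I J \<noteq> 0" using total_degree[OF assms(1) that] by simp
  then show "coeff (eps (localize s c z)) I J = coeff (- localize s c z) I J"
    using assms(2) by (cases "s c z I J = 0") simp_all
qed

section \<open>Identities for global cochains\<close>

context
  fixes M :: "('a, 'n::{finite,linorder}) cplx_mfd"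
  assumes M: "complex_manifold M"
begin

lemma total_even_field: "s \<in> total M i \<Longrightarrow> odd i \<Longrightarrow> c \<in> atlas M \<Longrightarrow> even_field (chart_image c) (localize s c)"
  using total_even[of s M i c] localize_smooth_fields[OF M, of s c]
  by (auto simp: even_field_def eps_on_def total_def)

lemma total_odd_field: "s \<in> total M i \<Longrightarrow> even i \<Longrightarrow> c \<in> atlas M \<Longrightarrow> odd_field (chart_image c) (localize s c)"
  using total_odd[of s M i c] localize_smooth_fields[OF M, of s c]
  by (auto simp: odd_field_def eps_on_def total_def fun_eq_iff)

lemma total_linear:
  assumes "s \<in> total M i" "s' \<in> total M i"
  shows "s + s' \<in> total M i" "scale k s \<in> total M i"
proof -
  have a: "x + y \<in> total M i" if "x \<in> total M i" "y \<in> total M i" for x y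
  proof -
    have "card I + card J = Suc i \<and> 1 \<le> card J" if "(x + y) c z I J \<noteq> 0" for c z I J
      using total_degree[OF \<open>x \<in> total M i\<close>, of c z I J] total_degree[OF \<open>y \<in> total M i\<close>, of c z I J] that by fastforce
    moreover have "x + y \<in> smooth_sections M"
      using that by (intro smooth_sections_linear[OF M]) (simp_all add: total_def)
    ultimately show ?thesis unfolding total_def by blast
  qed
  have k: "scale k x \<in> total M i" if "x \<in> total M i" for k x
  proof -
    have "card I + card J = Suc i \<and> 1 \<le> card J" if "scale k x c z I J \<noteq> 0" for c z I J
      using total_degree[OF \<open>x \<in> total M i\<close>, of c z I J] that by (simp add: scale_def)
    moreover have "scale k x \<in> smooth_sections M"
      using smooth_sections_linear(2)[OF M, of x x] that by (simp add: total_def)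
    ultimately show ?thesis unfolding total_def by blast
  qed
  show "s + s' \<in> total M i" "scale k s \<in> total M i" using a k assms by auto
qed

text \<open>One vector index is lost, so the shifted degrees p + q - 1 add up. At least one vector
  index remains because each argument has one.\<close>

lemma schouten_total:
  assumes s: "s \<in> total M i" and s': "s' \<in> total M j"
  shows "schouten M s s' \<in> total M (i + j)"
proof -
  have "card I + card J = Suc (i + j) \<and> 1 \<le> card J" if nz: "schouten M s s' c z I J \<noteq> 0" for c z I J
  proof -
    obtain w I1 J1 w' I2 J2 where *: "s c w I1 J1 \<noteq> 0" "s' c w' I2 J2 \<noteq> 0"
      "card I = card I1 + card I2" "Suc (card J) = card J1 + card J2"
      using schouten_degree[OF nz] by blast
    have "card I1 + card J1 = Suc i \<and> 1 \<le> card J1" "card I2 + card J2 = Suc j \<and> 1 \<le> card J2"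
      using total_degree[OF s] total_degree[OF s'] * by blast+
    with * show ?thesis by linarith
  qed
  then show ?thesis
    using schouten_smooth_sections[OF M, of s s'] s s' by (simp add: total_def)
qed

lemma schouten_A:
  assumes s: "s \<in> A M p q" and s': "s' \<in> A M p' q'"
  shows "schouten M s s' \<in> A M (p + p') (q + q' - 1)"
proof -
  have "card I = p + p' \<and> card J = q + q' - 1" if nz: "schouten M s s' c z I J \<noteq> 0" for c z I J
  proof -
    obtain w I1 J1 w' I2 J2 where *: "s c w I1 J1 \<noteq> 0" "s' c w' I2 J2 \<noteq> 0"
      "card I = card I1 + card I2" "Suc (card J) = card J1 + card J2"
      using schouten_degree[OF nz] by blast
    have "card I1 = p \<and> card J1 = q" "card I2 = p' \<and> card J2 = q'"
      using A_degree[OF s] A_degree[OF s'] * by blast+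
    with * show ?thesis by linarith
  qed
  then show ?thesis
    using schouten_smooth_sections[OF M, of s s'] s s' by (simp add: A_def)
qed

lemma poisson_dbar_off_charts:
  "\<not> (c \<in> atlas M \<and> z \<in> chart_image c) \<Longrightarrow> poisson_dbar M \<Lambda> s c z = 0"
  using off_charts(1,2)[OF M, of c z] by (simp add: poisson_dbar_def)

lemma localize_poisson_dbar:
  assumes "\<Lambda> \<in> smooth_sections M" "s \<in> smooth_sections M" "c \<in> atlas M"
  shows "localize (poisson_dbar M \<Lambda> s) c = dbar_on (chart_image c) (localize s c) + brkt (chart_image c) (localize \<Lambda> c) (localize s c)"
  by (simp add: poisson_dbar_def localize_linear localize_dbar[OF M assms(3)] localize_schouten[OF M assms])

lemma poisson_dbar_linear:
  assumes \<Lambda>: "\<Lambda> \<in> smooth_sections M" and s: "s \<in> smooth_sections M" and s': "s' \<in> smooth_sections M"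
  shows "poisson_dbar M \<Lambda> (s + s') = poisson_dbar M \<Lambda> s + poisson_dbar M \<Lambda> s'"
    "poisson_dbar M \<Lambda> (scale k s) = scale k (poisson_dbar M \<Lambda> s)"
proof -
  note mem = smooth_sections_linear[OF M s s']
  show "poisson_dbar M \<Lambda> (s + s') = poisson_dbar M \<Lambda> s + poisson_dbar M \<Lambda> s'"
  proof (rule section_eqI[OF M])
    fix c assume c: "c \<in> atlas M"
    note o = chart_facts(1)[OF M c]
    note f = localize_smooth_fields[OF M _ c]
    show "localize (poisson_dbar M \<Lambda> (s + s')) c = localize (poisson_dbar M \<Lambda> s + poisson_dbar M \<Lambda> s') c"
      by (simp add: localize_linear localize_poisson_dbar \<Lambda> s s' c mem dbar_on_add[OF o] brkt_add_right[OF o] f)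
  qed (simp_all add: poisson_dbar_off_charts)
  show "poisson_dbar M \<Lambda> (scale k s) = scale k (poisson_dbar M \<Lambda> s)"
  proof (rule section_eqI[OF M])
    fix c assume c: "c \<in> atlas M"
    note o = chart_facts(1)[OF M c]
    note f = localize_smooth_fields[OF M _ c]
    show "localize (poisson_dbar M \<Lambda> (scale k s)) c = localize (scale k (poisson_dbar M \<Lambda> s)) c"
      by (simp add: localize_linear localize_poisson_dbar \<Lambda> s c mem dbar_on_scl[OF o] brkt_scl_right[OF o] f fun_eq_iff scl_distrib)
  qed (simp_all add: poisson_dbar_off_charts scale_def fun_eq_iff)
qed

text \<open>Symmetry of the bracket on even cochains permits either order in the mixed term;
  \<open>s'\<close> is put first so that the choice s = theta, s' = lambda produces
  [lambda, theta].\<close>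

lemma schouten_add:
  assumes s: "s \<in> total M 1" and s': "s' \<in> total M 1"
  shows "schouten M (s + s') (s + s') = schouten M s' s' + scale 2 (schouten M s' s) + schouten M s s"
proof (rule section_eqI[OF M])
  have m: "s \<in> smooth_sections M" "s' \<in> smooth_sections M" using s s' by (auto simp: total_def)
  fix c assume c: "c \<in> atlas M"
  note o = chart_facts(1)[OF M c]
  note f = localize_smooth_fields[OF M _ c]
  have sym: "brkt (chart_image c) (localize s c) (localize s' c) = brkt (chart_image c) (localize s' c) (localize s c)"
    using brkt_symmetric[OF o] total_even_field[OF s _ c] total_even_field[OF s' _ c] by simp
  have two: "scl 2 x = x + x" for x :: "'n polyform" by (rule polyform_eqI) simp
  show "localize (schouten M (s + s') (s + s')) c = localize (schouten M s' s' + scale 2 (schouten M s' s) + schouten M s s) c"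
    using smooth_sections_linear(1)[OF M m]
    by (simp add: localize_linear localize_schouten[OF M] m c brkt_add_left[OF o] brkt_add_right[OF o] f fields_add[OF o] sym two fun_eq_iff)
qed (simp_all add: off_charts[OF M] scale_def fun_eq_iff)

lemma schouten_cocycle:
  assumes \<Lambda>: "\<Lambda> \<in> total M 1" and s: "s \<in> total M 1" and cl: "poisson_dbar M \<Lambda> s = 0"
  shows "poisson_dbar M \<Lambda> (schouten M s s) = 0"
proof (rule section_eqI[OF M])
  have m: "\<Lambda> \<in> smooth_sections M" "s \<in> smooth_sections M" using \<Lambda> s by (auto simp: total_def)
  fix c assume c: "c \<in> atlas M"
  have "dbar_on (chart_image c) (localize s c) + brkt (chart_image c) (localize \<Lambda> c) (localize s c) = 0"
    using localize_poisson_dbar[OF m c] cl by (simp add: localize_linear)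
  from bracket_of_cocycle[OF chart_facts(1)[OF M c] total_even_field[OF \<Lambda> _ c] total_even_field[OF s _ c] this]
  show "localize (poisson_dbar M \<Lambda> (schouten M s s)) c = localize 0 c"
    by (simp add: localize_poisson_dbar[OF m(1) schouten_smooth_sections[OF M m(2,2)] c] localize_schouten[OF M m(2,2) c] localize_linear)
qed (simp_all add: poisson_dbar_off_charts)

lemma schouten_cohomologous:
  assumes \<Lambda>: "\<Lambda> \<in> total M 1" and s: "s \<in> total M 1" and s': "s' \<in> total M 1" and t: "t \<in> total M 0"
    and cl: "poisson_dbar M \<Lambda> s = 0" "poisson_dbar M \<Lambda> s' = 0" and st: "s' - s = poisson_dbar M \<Lambda> t"
  shows "schouten M s' s' - schouten M s s = poisson_dbar M \<Lambda> (schouten M t (s' + s))"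
proof (rule section_eqI[OF M])
  have m: "\<Lambda> \<in> smooth_sections M" "s \<in> smooth_sections M" "s' \<in> smooth_sections M" "t \<in> smooth_sections M"
    using \<Lambda> s s' t by (auto simp: total_def)
  have r: "s' + s \<in> total M 1" using total_linear(1)[OF s' s] .
  then have mr: "s' + s \<in> smooth_sections M" by (simp add: total_def)
  fix c assume c: "c \<in> atlas M"
  note o = chart_facts(1)[OF M c]
  have "poisson_dbar M \<Lambda> (s' + s) = 0" using poisson_dbar_linear(1)[OF m(1,3,2)] cl by simp
  then have "dbar_on (chart_image c) (localize (s' + s) c) + brkt (chart_image c) (localize \<Lambda> c) (localize (s' + s) c) = 0"
    using localize_poisson_dbar[OF m(1) mr c] by (simp add: localize_linear)
  from bracket_with_cocycle[OF o total_even_field[OF \<Lambda> _ c] total_odd_field[OF t _ c] total_even_field[OF r _ c] this]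
  have "localize (poisson_dbar M \<Lambda> (schouten M t (s' + s))) c
      = brkt (chart_image c) (localize (poisson_dbar M \<Lambda> t) c) (localize (s' + s) c)"
    by (simp add: localize_poisson_dbar[OF m(1) schouten_smooth_sections[OF M m(4) mr] c] localize_schouten[OF M m(4) mr c]
        localize_poisson_dbar[OF m(1,4) c])
  also have "\<dots> = brkt (chart_image c) (localize s' c) (localize s' c) - brkt (chart_image c) (localize s c) (localize s c)"
    unfolding st[symmetric] localize_linear
    using bracket_difference_of_squares[OF o total_even_field[OF s' _ c] total_even_field[OF s _ c]] by simp
  finally show "localize (schouten M s' s' - schouten M s s) c = localize (poisson_dbar M \<Lambda> (schouten M t (s' + s))) c"
    by (simp add: localize_linear localize_schouten[OF M] m c)
qed (simp_all add: poisson_dbar_off_charts off_charts[OF M])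

end

text \<open>At a fixed point of a chart the equation is polynomial in the coefficients of the
  cochain and their first derivatives. Second-order jets of these therefore determine its t^2
  coefficient, which must vanish.\<close>

lemma second_order_maurer_cartan:
  fixes M :: "('a, 'n::{finite,linorder}) cplx_mfd"
  assumes M: "complex_manifold M" and r: "0 < r"
    and mc: "\<And>t. t \<in> ball 0 r \<Longrightarrow> maurer_cartan M \<Lambda> (s t)" and s0: "s 0 = 0"
    and ser: "\<And>t c z I J. t \<in> ball 0 r \<Longrightarrow> (\<lambda>m. \<alpha> m c z I J * t ^ m) sums s t c z I J"
    and sm: "\<And>c I J. c \<in> atlas M \<Longrightarrow> smooth_on (chart_image c \<times> ball 0 r) (\<lambda>(z, t). s t c z I J)"
  shows "poisson_dbar M \<Lambda> (\<alpha> 2) + scale (1/2) (schouten M (\<alpha> 1) (\<alpha> 1)) = 0"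
proof (intro ext)
  fix c z I J
  show "(poisson_dbar M \<Lambda> (\<alpha> 2) + scale (1/2) (schouten M (\<alpha> 1) (\<alpha> 1))) c z I J = 0 c z I J"
  proof (cases "c \<in> atlas M \<and> z \<in> chart_image c")
    case False
    then show ?thesis using poisson_dbar_off_charts[OF M False] off_charts(1)[OF M False] by (simp add: scale_def)
  next
    case True
    then have c: "c \<in> atlas M" and z: "z \<in> chart_image c" by auto
    let ?s = "\<lambda>t::real. localize (s (of_real t)) c"
    \<comment> \<open>The quadratic term is a separate argument, because linear and quadratic parts
      behave differently: in the t^2 coefficient the former sees \<open>\<alpha> 2\<close> and the
      latter the square of \<open>\<alpha> 1\<close>.\<close>
    define mcx where "mcx a x = (\<Sum>i\<in>UNIV. eta i * pdelbar i a z) + brkt_at (localize \<Lambda> c) a z + scl (1/2) x"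
      for a and x :: "'n polyform"
    have mcx: "coeff (mcx (localize u c) (brkt_at (localize v c) (localize v c) z)) I J
        = (poisson_dbar M \<Lambda> u + scale (1/2) (schouten M v v)) c z I J" for u v I J
      using c z by (simp add: mcx_def poisson_dbar_def scale_def schouten_def dbar_def on_charts_def
          local_dbar_eq local_schouten_eq localize_def pder_def)
    have j: "pjet (\<lambda>t. ?s t z) (localize (\<alpha> 1) c z) (localize (\<alpha> 2) c z)"
      "pjet (\<lambda>t. pdel i (?s t) z) (pdel i (localize (\<alpha> 1) c) z) (pdel i (localize (\<alpha> 2) c) z)"
      "pjet (\<lambda>t. pdelbar i (?s t) z) (pdelbar i (localize (\<alpha> 1) c) z) (pdelbar i (localize (\<alpha> 2) c) z)" for i
    proof -
      have *: "jet (\<lambda>t. s (of_real t) c z K L) (\<alpha> 1 c z K L) (\<alpha> 2 c z K L)"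
        "jet (\<lambda>t. frechet_derivative (\<lambda>w. s (of_real t) c w K L) (at z) v)
          (frechet_derivative (\<lambda>w. \<alpha> 1 c w K L) (at z) v) (frechet_derivative (\<lambda>w. \<alpha> 2 c w K L) (at z) v)" for K L v
        using jet_power_series(1)[OF chart_facts(1)[OF M c] sm[OF c, of K L] r z, of "\<lambda>w m. \<alpha> m c w K L"]
          jet_power_series(2)[OF chart_facts(1)[OF M c] sm[OF c, of K L] r z, of "\<lambda>w m. \<alpha> m c w K L" v] ser s0
        by simp_all
      show "pjet (\<lambda>t. ?s t z) (localize (\<alpha> 1) c z) (localize (\<alpha> 2) c z)"
        using *(1) by (simp add: pjet_def)
      have "jet (\<lambda>t. del i (\<lambda>w. s (of_real t) c w K L) z) (del i (\<lambda>w. \<alpha> 1 c w K L) z) (del i (\<lambda>w. \<alpha> 2 c w K L) z)"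
        "jet (\<lambda>t. delbar i (\<lambda>w. s (of_real t) c w K L) z) (delbar i (\<lambda>w. \<alpha> 1 c w K L) z) (delbar i (\<lambda>w. \<alpha> 2 c w K L) z)" for K L
        using jet_wirtinger[of "\<lambda>(w, t). s t c w K L" z "\<lambda>w. \<alpha> 1 c w K L" "\<lambda>w. \<alpha> 2 c w K L"] *(2) by simp_all
      then show "pjet (\<lambda>t. pdel i (?s t) z) (pdel i (localize (\<alpha> 1) c) z) (pdel i (localize (\<alpha> 2) c) z)"
        "pjet (\<lambda>t. pdelbar i (?s t) z) (pdelbar i (localize (\<alpha> 1) c) z) (pdelbar i (localize (\<alpha> 2) c) z)"
        by (simp_all add: pjet_def pder_def)
    qed
    have "pjet (\<lambda>t. mcx (?s t) (brkt_at (?s t) (?s t) z)) (mcx (localize (\<alpha> 1) c) 0) (mcx (localize (\<alpha> 2) c) (brkt_at (localize (\<alpha> 1) c) (localize (\<alpha> 1) c) z))"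
    proof -
      \<comment> \<open>Every summand of the bracket is a product of two first-order jets, so its
        linear term is 0.\<close>
      have 1: "pjet (\<lambda>t. brkt_at (?s t) (?s t) z) (\<Sum>i\<in>(UNIV::'n set). 0 - 0) (brkt_at (localize (\<alpha> 1) c) (localize (\<alpha> 1) c) z)"
        unfolding brkt_at_def by (intro pjet_sum pjet_diff pjet_mult[OF pjet_plinear[OF plinear_right_con j(1)] j(2)]
            pjet_mult[OF j(2) pjet_plinear[OF plinear_left_con j(1)]])
      then have 1: "pjet (\<lambda>t. brkt_at (?s t) (?s t) z) 0 (brkt_at (localize (\<alpha> 1) c) (localize (\<alpha> 1) c) z)" by simp
      \<comment> \<open>With Lambda fixed, the bracket is linear in the value and the first
        derivatives of its second argument, so the jets pass through unchanged.\<close>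
      have 2: "pjet (\<lambda>t. brkt_at (localize \<Lambda> c) (?s t) z) (brkt_at (localize \<Lambda> c) (localize (\<alpha> 1) c) z) (brkt_at (localize \<Lambda> c) (localize (\<alpha> 2) c) z)"
        unfolding brkt_at_def by (intro pjet_sum pjet_diff pjet_plinear[OF plinear_mult_left] pjet_plinear[OF plinear_left_con] j)
      show ?thesis
        unfolding mcx_def by (intro pjet_add 1 2 pjet_sum pjet_plinear[OF plinear_mult_left] pjet_plinear[OF plinear_scl'] j)
    qed
    then have J: "jet (\<lambda>t. coeff (mcx (?s t) (brkt_at (?s t) (?s t) z)) I J) (coeff (mcx (localize (\<alpha> 1) c) 0) I J)
        (coeff (mcx (localize (\<alpha> 2) c) (brkt_at (localize (\<alpha> 1) c) (localize (\<alpha> 1) c) z)) I J)"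
      by (simp add: pjet_def)
    have "coeff (mcx (?s t) (brkt_at (?s t) (?s t) z)) I J = 0" if "\<bar>t\<bar> < r" for t
      using mc[of "of_real t"] that unfolding mcx maurer_cartan_def by simp
    from jet_eq_0[OF J r this] show ?thesis unfolding mcx by simp
  qed
qed

lemma convergent_series_coefficients:
  assumes "convergent_series M p q r \<phi>" "0 < r"
  obtains a where "\<And>m. a m \<in> A M p q" "\<And>t c z I J. t \<in> ball 0 r \<Longrightarrow> (\<lambda>m. a m c z I J * t ^ m) sums \<phi> t c z I J"
    "derivative_at_0 \<phi> = a 1"
proof -
  obtain a where a: "\<And>m. a m \<in> A M p q" "\<And>t c z I J. t \<in> ball 0 r \<Longrightarrow> (\<lambda>m. a m c z I J * t ^ m) sums \<phi> t c z I J"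
    using assms(1) unfolding convergent_series_def by blast
  have "deriv (\<lambda>t. \<phi> t c z I J) 0 = a 1 c z I J" for c z I J
  proof -
    have "((\<lambda>t. \<phi> t c z I J) has_field_derivative (\<Sum>m. diffs (\<lambda>m. a m c z I J) m * 0 ^ m)) (at 0)"
      by (rule power_series_derivative(1)[OF a(2)]) (use assms(2) in auto)
    then show ?thesis using DERIV_imp_deriv by (fastforce simp: diffs_def)
  qed
  then have "derivative_at_0 \<phi> = a 1" by (simp add: derivative_at_0_def fun_eq_iff)
  with a show ?thesis using that by blast
qed

theorem theorem2p3p3:
  fixes M :: "('a, 'n::{finite,linorder}) cplx_mfd"
    and \<Lambda>\<^sub>0 lam \<theta> :: "('a, 'n) pvsection"
  assumes "holomorphic_poisson_manifold M \<Lambda>\<^sub>0" and "compact_space (top_of M)"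
    and "lam \<in> A M 0 2" and "\<theta> \<in> A M 1 1"
    and "schouten M \<Lambda>\<^sub>0 lam = 0" and "dbar M lam + schouten M \<Lambda>\<^sub>0 \<theta> = 0" and "dbar M \<theta> = 0"
    and "\<exists>(N :: ('e, 'n option) cplx_mfd) \<Lambda> B \<omega> e.
           poisson_analytic_family N \<Lambda> B \<omega> \<and> 0 \<in> B \<and> central_fibre M \<Lambda>\<^sub>0 N \<Lambda> \<omega> e \<and>
           infinitesimal_deformation M \<Lambda>\<^sub>0 N \<Lambda> B \<omega> e (hyper_class M \<Lambda>\<^sub>0 1 (\<theta> + lam))"
  shows "schouten M (\<theta> + lam) (\<theta> + lam)
           = schouten M lam lam + scale 2 (schouten M lam \<theta>) + schouten M \<theta> \<theta> \<and>
         schouten M lam lam \<in> A M 0 3 \<and> schouten M lam \<theta> \<in> A M 1 2 \<and> schouten M \<theta> \<theta> \<in> A M 2 1 \<and>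
         schouten M (\<theta> + lam) (\<theta> + lam) \<in> cocycles M \<Lambda>\<^sub>0 2 \<and>
         hyper_class M \<Lambda>\<^sub>0 2 (schouten M (\<theta> + lam) (\<theta> + lam)) = hyper_class M \<Lambda>\<^sub>0 2 0"
proof -
  let ?L = "poisson_dbar M \<Lambda>\<^sub>0"
  have M: "complex_manifold M" and \<Lambda>: "\<Lambda>\<^sub>0 \<in> total M 1" "\<Lambda>\<^sub>0 \<in> smooth_sections M"
    using assms(1) A_subset_total[of 2 0 1 M]
    by (auto simp: holomorphic_poisson_manifold_def holomorphic_sections_def A_def)
  have lam: "lam \<in> total M 1" "lam \<in> smooth_sections M" and \<theta>: "\<theta> \<in> total M 1" "\<theta> \<in> smooth_sections M"
    using assms(3,4) A_subset_total[of 2 0 1 M] A_subset_total[of 1 1 1 M] by (auto simp: A_def)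
  define \<sigma> where "\<sigma> = \<theta> + lam"
  have \<sigma>: "\<sigma> \<in> total M 1" unfolding \<sigma>_def by (rule total_linear(1)[OF M \<theta>(1) lam(1)])
  \<comment> \<open>The three hypotheses on lambda and theta are the components of L \<sigma> = 0 in
    vector degrees 3, 2 and 1.\<close>
  have cl: "?L \<sigma> = 0"
    unfolding \<sigma>_def poisson_dbar_linear(1)[OF M \<Lambda>(2) \<theta>(2) lam(2)]
    using assms(5-7) by (simp add: poisson_dbar_def add.commute)
  have lin: "?L (x + y) = ?L x + ?L y" "?L (scale k x) = scale k (?L x)" if "x \<in> total M i" "y \<in> total M i" for x y k i
    using poisson_dbar_linear[OF M \<Lambda>(2)] that by (auto simp: total_def)
  have L0: "?L 0 = 0" using lin(2)[OF zero_total zero_total, of 0] by (simp add: scale_def zero_fun_def)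
  obtain N :: "('e, 'n option) cplx_mfd" and \<Lambda> B \<omega> e where
    "infinitesimal_deformation M \<Lambda>\<^sub>0 N \<Lambda> B \<omega> e (hyper_class M \<Lambda>\<^sub>0 1 \<sigma>)"
    using assms(8) unfolding \<sigma>_def by blast
  then obtain r \<phi> L where repr: "represented_by M \<Lambda>\<^sub>0 N \<Lambda> B \<omega> e r \<phi> L"
    and class_eq: "hyper_class M \<Lambda>\<^sub>0 1 \<sigma> = hyper_class M \<Lambda>\<^sub>0 1 (derivative_at_0 \<phi> + derivative_at_0 L)"
    unfolding infinitesimal_deformation_def by blast
  have r: "0 < r" and ser: "convergent_series M 1 1 r \<phi>" "convergent_series M 0 2 r L"
    and init: "\<phi> 0 = 0" "L 0 = 0" and mc: "\<And>t. t \<in> ball 0 r \<Longrightarrow> maurer_cartan M \<Lambda>\<^sub>0 (\<phi> t + L t)"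
    using repr unfolding represented_by_def by simp_all
  obtain a where a: "\<And>m. a m \<in> A M 1 1" "\<And>t c z I J. t \<in> ball 0 r \<Longrightarrow> (\<lambda>m. a m c z I J * t ^ m) sums \<phi> t c z I J"
    "derivative_at_0 \<phi> = a 1"
    using convergent_series_coefficients[OF ser(1) r] by blast
  obtain b where b: "\<And>m. b m \<in> A M 0 2" "\<And>t c z I J. t \<in> ball 0 r \<Longrightarrow> (\<lambda>m. b m c z I J * t ^ m) sums L t c z I J"
    "derivative_at_0 L = b 1"
    using convergent_series_coefficients[OF ser(2) r] by blast
  define \<alpha> where "\<alpha> m = a m + b m" for m
  have \<alpha>: "\<alpha> m \<in> total M 1" for m
    using total_linear(1)[OF M, of "a m" 1 "b m"] a(1) b(1) A_subset_total[of 2 0 1 M] A_subset_total[of 1 1 1 M]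
    unfolding \<alpha>_def by auto
  have second: "?L (\<alpha> 2) + scale (1/2) (schouten M (\<alpha> 1) (\<alpha> 1)) = 0"
  proof (rule second_order_maurer_cartan[OF M r mc])
    show "(\<lambda>m. \<alpha> m c z I J * t ^ m) sums (\<phi> t + L t) c z I J" if "t \<in> ball 0 r" for t c z I J
      using sums_add[OF a(2)[OF that] b(2)[OF that]] by (simp add: \<alpha>_def distrib_right)
    show "smooth_on (chart_image c \<times> ball 0 r) (\<lambda>(z, t). (\<phi> t + L t) c z I J)" if c: "c \<in> atlas M" for c I J
    proof -
      have "smooth_on (chart_image c \<times> ball 0 r) (\<lambda>x. (case x of (z, t) \<Rightarrow> \<phi> t c z I J) + (case x of (z, t) \<Rightarrow> L t c z I J))"
        using ser c unfolding convergent_series_def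
        by (intro smooth_on_add open_Times chart_facts(1)[OF M c]) auto
      then show ?thesis by (simp add: case_prod_unfold)
    qed
  qed (simp_all add: init)
  \<comment> \<open>Equality of the two classes yields a relation between their representatives only
    because one of them is known to lie in its class; this uses that \<sigma> is a cocycle and that
    0 = L 0 is a coboundary.\<close>
  have "\<sigma> \<in> hyper_class M \<Lambda>\<^sub>0 1 \<sigma>"
    using \<sigma> cl zero_total[of M 0] L0
    by (auto simp: hyper_class_def cohomologous_def cocycles_def coboundaries_def intro!: image_eqI[where x=0])
  then have "(\<alpha> 1, \<sigma>) \<in> cohomologous M \<Lambda>\<^sub>0 1"
    unfolding class_eq by (simp add: hyper_class_def a(3) b(3) \<alpha>_def)
  then obtain t where t: "t \<in> total M 0" "\<alpha> 1 - \<sigma> = ?L t" and cl1: "?L (\<alpha> 1) = 0"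
    by (auto simp: cohomologous_def cocycles_def coboundaries_def)
  have diff: "schouten M (\<alpha> 1) (\<alpha> 1) - schouten M \<sigma> \<sigma> = ?L (schouten M t (\<alpha> 1 + \<sigma>))"
    by (rule schouten_cohomologous[OF M \<Lambda>(1) \<sigma> \<alpha> t(1) cl cl1 t(2)])
  have tt: "schouten M t (\<alpha> 1 + \<sigma>) \<in> total M 1"
    using schouten_total[OF M t(1) total_linear(1)[OF M \<alpha> \<sigma>]] by simp
  \<comment> \<open>From L (\<open>\<alpha> 2\<close>) = -(1/2) [\<open>\<alpha> 1\<close>,
    \<open>\<alpha> 1\<close>] and L [t, \<open>\<alpha> 1\<close> + \<sigma>] =
    [\<open>\<alpha> 1\<close>, \<open>\<alpha> 1\<close>] - [\<sigma>, \<sigma>] the square of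
    \<open>\<alpha> 1\<close> is eliminated, which leaves [\<sigma>, \<sigma>] = L u.\<close>
  define u where "u = scale (-2) (\<alpha> 2) + scale (-1) (schouten M t (\<alpha> 1 + \<sigma>))"
  have u: "u \<in> total M 1"
    unfolding u_def by (rule total_linear(1)[OF M total_linear(2)[OF M \<alpha> \<alpha>] total_linear(2)[OF M tt tt]])
  have "?L u = scale (-2) (?L (\<alpha> 2)) + scale (-1) (?L (schouten M t (\<alpha> 1 + \<sigma>)))"
    unfolding u_def using lin[of _ 1] total_linear(2)[OF M _ \<alpha>] \<alpha> tt by metis
  also have "\<dots> = schouten M \<sigma> \<sigma>"
  proof (intro ext)
    fix c z I J
    have arith: "(-2) * p + (-1) * l = w" if "p + (1/2) * q = 0" "l = q - w" for p q l w :: complex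
    proof -
      have "p = - ((1/2) * q)" using that(1) by (simp only: eq_neg_iff_add_eq_0)
      with that(2) show ?thesis by simp
    qed
    have "?L (\<alpha> 2) c z I J + (1/2) * schouten M (\<alpha> 1) (\<alpha> 1) c z I J = 0"
      using fun_cong[OF fun_cong[OF fun_cong[OF fun_cong[OF second]]], of c z I J] by (simp add: scale_def)
    moreover have "?L (schouten M t (\<alpha> 1 + \<sigma>)) c z I J = schouten M (\<alpha> 1) (\<alpha> 1) c z I J - schouten M \<sigma> \<sigma> c z I J"
      unfolding diff[symmetric] by simp
    ultimately show "(scale (-2) (?L (\<alpha> 2)) + scale (-1) (?L (schouten M t (\<alpha> 1 + \<sigma>)))) c z I J = schouten M \<sigma> \<sigma> c z I J"
      unfolding scale_def plus_fun_apply by (rule arith)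
  qed
  finally have Lu: "?L u = schouten M \<sigma> \<sigma>" .
  have co: "schouten M \<sigma> \<sigma> \<in> cocycles M \<Lambda>\<^sub>0 2"
    using schouten_total[OF M \<sigma> \<sigma>] schouten_cocycle[OF M \<Lambda>(1) \<sigma> cl] by (simp add: cocycles_def numeral_2_eq_2)
  \<comment> \<open>Classes are sets of cocycles, so their equality means that the same x are
    cohomologous to [\<sigma>, \<sigma>] and to 0. The primitives for the two differences differ by
    u.\<close>
  have "schouten M \<sigma> \<sigma> - x \<in> ?L ` total M 1 \<longleftrightarrow> 0 - x \<in> ?L ` total M 1" for x
  proof
    assume "schouten M \<sigma> \<sigma> - x \<in> ?L ` total M 1"
    then obtain v where v: "v \<in> total M 1" "schouten M \<sigma> \<sigma> - x = ?L v" by blast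
    have "?L (v + scale (-1) u) = ?L v + scale (-1) (?L u)"
      using lin[of _ 1] v u total_linear(2)[OF M u u] by metis
    also have "\<dots> = 0 - x" unfolding Lu v(2)[symmetric] by (simp add: scale_def fun_eq_iff)
    finally show "0 - x \<in> ?L ` total M 1" using total_linear(1)[OF M v(1) total_linear(2)[OF M u u, of "-1"]] by (metis image_eqI)
  next
    assume "0 - x \<in> ?L ` total M 1"
    then obtain v where v: "v \<in> total M 1" "0 - x = ?L v" by blast
    have "?L (v + u) = schouten M \<sigma> \<sigma> - x" using lin(1)[OF v(1) u] Lu v(2) by simp
    then show "schouten M \<sigma> \<sigma> - x \<in> ?L ` total M 1" using total_linear(1)[OF M v(1) u] by (metis image_eqI)
  qed
  moreover have "0 \<in> cocycles M \<Lambda>\<^sub>0 2" using zero_total L0 by (simp add: cocycles_def)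
  ultimately have "hyper_class M \<Lambda>\<^sub>0 2 (schouten M \<sigma> \<sigma>) = hyper_class M \<Lambda>\<^sub>0 2 0"
    using co by (auto simp: hyper_class_def cohomologous_def coboundaries_def numeral_2_eq_2)
  moreover have "schouten M lam lam \<in> A M 0 3" "schouten M lam \<theta> \<in> A M 1 2" "schouten M \<theta> \<theta> \<in> A M 2 1"
    using schouten_A[OF M assms(3,3)] schouten_A[OF M assms(3,4)] schouten_A[OF M assms(4,4)] by (simp_all add: numeral_2_eq_2 numeral_3_eq_3)
  ultimately show ?thesis
    using schouten_add[OF M \<theta>(1) lam(1)] co unfolding \<sigma>_def by blast
qed

end
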